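(* Let $\mathcal{M}$ be a manifold of dimension $n\in\mathbb{N}$ and let $(a,b)\subset(0,\infty)$ be a time interval. Suppose $g(\tau)$, $\tau\in(a,b)$, is a (reverse) Ricci flow on $\mathcal{M}$, i.e. a solution of $\frac{\partial g}{\partial\tau}=2\,\mathrm{Ric}(g(\tau))$, with bounded curvature. Let $N\in\mathbb{N}$ be sufficiently large that the symmetric $2$-tensor $\hat g=\hat g_N$ on $\hat{\mathcal{M}}:=\mathcal{M}\times(a,b)$ defined by $$\hat g_{ij}=\frac{g_{ij}}{\tau};\qquad \hat g_{00}=\frac{N}{2\tau^3}+\frac{R}{\tau}-\frac{n}{2\tau^2};\qquad \hat g_{0i}=0$$ is positive definite. Then, up to errors of order $\frac1N$, the metric $\hat g$ is a gradient shrinking Ricci soliton on $\hat{\mathcal{M}}$: $$\mathrm{Ric}(\hat g)+\mathrm{Hess}_{\hat g}\left(\frac{N}{2\tau}\right)\simeq\frac12\hat g,$$ by which is meant that the quantity $$N\left[\mathrm{Ric}(\hat g)+\mathrm{Hess}_{\hat g}\left(\frac{N}{2\tau}\right)-\frac12\hat g\right]$$ is locally bounded independently of $N$, with respect to any fixed metric on $\hat{\mathcal{M}}$; that is, for every fixed Riemannian metric $h$ on $\hat{\mathcal{M}}$ (independent of $N$) and every compact $K\subset\hat{\mathcal{M}}$ there is a constant $C$ such that for all such $N$ the $h$-norm of this tensor is at most $C$ at every point of $K$.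
   Context: Indices $i,j$ are coordinate indices on the $\mathcal{M}$ factor of $\hat{\mathcal{M}}=\mathcal{M}\times(a,b)$, and $0$ is the index of the time coordinate $\tau\in(a,b)$. $R=R(x,\tau)$ is the scalar curvature of $g(\tau)$ at $x\in\mathcal{M}$. At a point $(x,\tau)\in\hat{\mathcal{M}}$, $g_{ij}$ denotes the components of $g(\tau)$ at $x$. The function $\frac{N}{2\tau}$ is regarded as a function on $\hat{\mathcal{M}}$ via $(x,\tau)\mapsto\frac{N}{2\tau}$. $\mathrm{Ric}(\hat g)$ is the Ricci tensor and $\mathrm{Hess}_{\hat g}$ the Hessian (second covariant derivative) with respect to $\hat g$. *)

theory Defs
  imports "HOL-Analysis.Analysis"
begin

primrec Ck_on :: "nat \<Rightarrow> ('a::real_normed_vector \<Rightarrow> 'b::real_normed_vector) \<Rightarrow> 'a set \<Rightarrow> bool" where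
  "Ck_on 0 f S \<longleftrightarrow> continuous_on S f"
| "Ck_on (Suc k) f S \<longleftrightarrow> (\<forall>x\<in>S. f differentiable (at x)) \<and>
      (\<forall>v. Ck_on k (\<lambda>x. frechet_derivative f (at x) v) S)"

text \<open>Only meant for open \<^term>\<open>S\<close>: the derivatives are the full ones, not those within \<^term>\<open>S\<close>.\<close>

definition smooth_on :: "('a::real_normed_vector \<Rightarrow> 'b::real_normed_vector) \<Rightarrow> 'a set \<Rightarrow> bool" where
  "smooth_on f S \<longleftrightarrow> (\<forall>k. Ck_on k f S)"

text \<open>An atlas is a family of charts, each a pair of a domain and a coordinate map. Charts are
  indexed so that a chart of \<open>M \<times> (a,b)\<close> can carry the same index as the chart of \<open>M\<close> that
  induces it.\<close>

type_synonym ('i, 'm, 'n) atlas = "'i \<Rightarrow> 'm set \<times> ('m \<Rightarrow> real^'n)"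

definition chart_dom :: "('i, 'm, 'n) atlas \<Rightarrow> 'i \<Rightarrow> 'm set" where
  "chart_dom A i = fst (A i)"

definition chart_map :: "('i, 'm, 'n) atlas \<Rightarrow> 'i \<Rightarrow> 'm \<Rightarrow> real^'n" where
  "chart_map A i = snd (A i)"

definition chart_img :: "('i, 'm, 'n) atlas \<Rightarrow> 'i \<Rightarrow> (real^'n) set" where
  "chart_img A i = chart_map A i ` chart_dom A i"

definition chart_inv :: "('i, 'm, 'n) atlas \<Rightarrow> 'i \<Rightarrow> real^'n \<Rightarrow> 'm" where
  "chart_inv A i = inv_into (chart_dom A i) (chart_map A i)"

definition transition :: "('i, 'm, 'n) atlas \<Rightarrow> 'i \<Rightarrow> 'i \<Rightarrow> real^'n \<Rightarrow> real^'n" where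
  "transition A i j = chart_map A j \<circ> chart_inv A i"

text \<open>The set \<^term>\<open>M\<close> carries the subspace topology; it is Hausdorff and second countable
  because the ambient type is. The dimension is \<open>CARD('n)\<close>.\<close>

definition smooth_manifold ::
    "'m::{t2_space,second_countable_topology} set \<Rightarrow> ('i, 'm, 'n::finite) atlas \<Rightarrow> bool" where
  "smooth_manifold M A \<longleftrightarrow>
     (\<Union>i. chart_dom A i) = M \<and>
     (\<forall>i. openin (top_of_set M) (chart_dom A i) \<and> open (chart_img A i) \<and>
          homeomorphism (chart_dom A i) (chart_img A i) (chart_map A i) (chart_inv A i)) \<and>
     (\<forall>i j. smooth_on (transition A i j) (chart_map A i ` (chart_dom A i \<inter> chart_dom A j)))"

text \<open>A covariant 2-tensor field is given by its component matrices: \<open>T i y $ k $ l\<close> is the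
  \<open>(k,l)\<close> component, in the \<open>i\<close>-th chart, at the point with coordinates \<open>y\<close>. Components in
  different charts are related by the tensor transformation law.\<close>

type_synonym ('i, 'n) tensor2 = "'i \<Rightarrow> real^'n \<Rightarrow> real^'n^'n"

definition is_tensor2 :: "('i, 'm, 'n::finite) atlas \<Rightarrow> ('i, 'n) tensor2 \<Rightarrow> bool" where
  "is_tensor2 A T \<longleftrightarrow> (\<forall>i j. \<forall>p \<in> chart_dom A i \<inter> chart_dom A j.
     let y = chart_map A i p; J = jacobian (transition A i j) (at y)
     in T i y = transpose J ** T j (chart_map A j p) ** J)"

definition pos_def_matrix :: "real^'n^'n::finite \<Rightarrow> bool" where
  "pos_def_matrix B \<longleftrightarrow> (\<forall>v. v \<noteq> 0 \<longrightarrow> v \<bullet> (B *v v) > 0)"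

definition pos_def_tensor :: "('i, 'm, 'n::finite) atlas \<Rightarrow> ('i, 'n) tensor2 \<Rightarrow> bool" where
  "pos_def_tensor A T \<longleftrightarrow> (\<forall>i. \<forall>y \<in> chart_img A i. pos_def_matrix (T i y))"

definition riemannian_metric :: "('i, 'm, 'n::finite) atlas \<Rightarrow> ('i, 'n) tensor2 \<Rightarrow> bool" where
  "riemannian_metric A G \<longleftrightarrow>
     is_tensor2 A G \<and> pos_def_tensor A G \<and>
     (\<forall>i. smooth_on (G i) (chart_img A i) \<and> (\<forall>y \<in> chart_img A i. transpose (G i y) = G i y))"

text \<open>The norm, with respect to the inner product with Gram matrix \<^term>\<open>H\<close>, of the bilinear
  form with matrix \<^term>\<open>B\<close>: \<open>|B|\<^sup>2 = H\<^sup>k\<^sup>p H\<^sup>l\<^sup>q B\<^sub>k\<^sub>l B\<^sub>p\<^sub>q\<close>.\<close>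

definition tensor2_norm :: "real^'n^'n \<Rightarrow> real^'n^'n \<Rightarrow> real" where
  "tensor2_norm H B = sqrt (\<Sum>k\<in>UNIV. \<Sum>l\<in>UNIV. \<Sum>p\<in>UNIV. \<Sum>q\<in>UNIV.
     matrix_inv H $ k $ p * matrix_inv H $ l $ q * B $ k $ l * B $ p $ q)"

text \<open>From here to \<open>hessian\<close>, \<open>G\<close> is the component matrix of a metric in one chart, as a function of the
  coordinates.\<close>

definition pderiv_at :: "'n::finite \<Rightarrow> (real^'n \<Rightarrow> real) \<Rightarrow> real^'n \<Rightarrow> real" where
  "pderiv_at k f y = frechet_derivative f (at y) (axis k 1)"

text \<open>\<open>christoffel G l i j = \<Gamma>\<^sup>l\<^sub>i\<^sub>j\<close>.\<close>

definition christoffel ::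
    "(real^'n \<Rightarrow> real^'n^'n) \<Rightarrow> 'n::finite \<Rightarrow> 'n \<Rightarrow> 'n \<Rightarrow> real^'n \<Rightarrow> real" where
  "christoffel G l i j y = (\<Sum>m\<in>UNIV. matrix_inv (G y) $ l $ m *
     (pderiv_at i (\<lambda>z. G z $ j $ m) y + pderiv_at j (\<lambda>z. G z $ i $ m) y
       - pderiv_at m (\<lambda>z. G z $ i $ j) y)) / 2"

text \<open>\<open>riemann G i j k l\<close> is the \<open>\<partial>\<^sub>l\<close>-component of
  \<open>Rm(\<partial>\<^sub>i,\<partial>\<^sub>j)\<partial>\<^sub>k = \<nabla>\<^sub>i\<nabla>\<^sub>j\<partial>\<^sub>k - \<nabla>\<^sub>j\<nabla>\<^sub>i\<partial>\<^sub>k\<close>.\<close>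

definition riemann ::
    "(real^'n \<Rightarrow> real^'n^'n) \<Rightarrow> 'n::finite \<Rightarrow> 'n \<Rightarrow> 'n \<Rightarrow> 'n \<Rightarrow> real^'n \<Rightarrow> real" where
  "riemann G i j k l y =
     pderiv_at i (christoffel G l j k) y - pderiv_at j (christoffel G l i k) y
     + (\<Sum>m\<in>UNIV. christoffel G m j k y * christoffel G l i m y
                 - christoffel G m i k y * christoffel G l j m y)"

text \<open>With the contraction below, round spheres have positive Ricci curvature.\<close>

definition ricci :: "(real^'n \<Rightarrow> real^'n^'n) \<Rightarrow> real^'n \<Rightarrow> real^'n^'n::finite" where
  "ricci G y = (\<chi> j k. \<Sum>i\<in>UNIV. riemann G i j k i y)"

definition scalar_curv :: "(real^'n \<Rightarrow> real^'n^'n::finite) \<Rightarrow> real^'n \<Rightarrow> real" where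
  "scalar_curv G y = (\<Sum>j\<in>UNIV. \<Sum>k\<in>UNIV. matrix_inv (G y) $ j $ k * ricci G y $ j $ k)"

definition riemann_norm :: "(real^'n \<Rightarrow> real^'n^'n::finite) \<Rightarrow> real^'n \<Rightarrow> real" where
  "riemann_norm G y = sqrt
     (\<Sum>i\<in>UNIV. \<Sum>j\<in>UNIV. \<Sum>k\<in>UNIV. \<Sum>l\<in>UNIV. \<Sum>p\<in>UNIV. \<Sum>q\<in>UNIV. \<Sum>r\<in>UNIV. \<Sum>s\<in>UNIV.
        matrix_inv (G y) $ i $ p * matrix_inv (G y) $ j $ q * matrix_inv (G y) $ k $ r *
        G y $ l $ s * riemann G i j k l y * riemann G p q r s y)"

definition hessian ::
    "(real^'n \<Rightarrow> real^'n^'n) \<Rightarrow> (real^'n \<Rightarrow> real) \<Rightarrow> real^'n \<Rightarrow> real^'n^'n::finite" where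
  "hessian G f y = (\<chi> i j. pderiv_at i (pderiv_at j f) y
     - (\<Sum>k\<in>UNIV. christoffel G k i j y * pderiv_at k f y))"

definition Ric :: "('i, 'n::finite) tensor2 \<Rightarrow> ('i, 'n) tensor2" where
  "Ric G = (\<lambda>i. ricci (G i))"

definition Hess ::
    "('i, 'm, 'n::finite) atlas \<Rightarrow> ('i, 'n) tensor2 \<Rightarrow> ('m \<Rightarrow> real) \<Rightarrow> ('i, 'n) tensor2" where
  "Hess A G f = (\<lambda>i. hessian (G i) (f \<circ> chart_inv A i))"

text \<open>\<^term>\<open>I\<close> is an open time interval; smoothness is joint in space and time.\<close>

definition reverse_ricci_flow ::
    "('i, 'm, 'n::finite) atlas \<Rightarrow> real set \<Rightarrow> (real \<Rightarrow> ('i, 'n) tensor2) \<Rightarrow> bool" where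
  "reverse_ricci_flow A I g \<longleftrightarrow>
     (\<forall>t\<in>I. riemannian_metric A (g t)) \<and>
     (\<forall>i. smooth_on (\<lambda>(y, t). g t i y) (chart_img A i \<times> I)) \<and>
     (\<forall>i. \<forall>y \<in> chart_img A i. \<forall>t\<in>I.
        ((\<lambda>s. g s i y) has_vector_derivative 2 *\<^sub>R Ric (g t) i y) (at t))"

definition bounded_curvature ::
    "('i, 'm, 'n::finite) atlas \<Rightarrow> real set \<Rightarrow> (real \<Rightarrow> ('i, 'n) tensor2) \<Rightarrow> bool" where
  "bounded_curvature A I g \<longleftrightarrow>
     (\<exists>B. \<forall>t\<in>I. \<forall>i. \<forall>y \<in> chart_img A i. riemann_norm (g t i) y \<le> B)"

text \<open>Coordinates on \<open>M \<times> I\<close> are indexed by \<open>'n option\<close>: \<^term>\<open>None\<close> is the time index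
  (the index 0) and \<^term>\<open>Some k\<close> is the \<open>k\<close>-th space index.\<close>

definition prod_atlas ::
    "('i, 'm, 'n::finite) atlas \<Rightarrow> real set \<Rightarrow> ('i, 'm \<times> real, 'n option) atlas" where
  "prod_atlas A I = (\<lambda>i. (chart_dom A i \<times> I,
     \<lambda>(x, t). \<chi> \<alpha>. case \<alpha> of None \<Rightarrow> t | Some k \<Rightarrow> chart_map A i x $ k))"

definition ghat ::
    "(real \<Rightarrow> ('i, 'n::finite) tensor2) \<Rightarrow> nat \<Rightarrow> ('i, 'n option) tensor2" where
  "ghat g N = (\<lambda>i z.
     let t = z $ None; y = (\<chi> k. z $ Some k)
     in \<chi> \<alpha> \<beta>. case (\<alpha>, \<beta>) of
          (Some k, Some l) \<Rightarrow> g t i y $ k $ l / t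
        | (None, None) \<Rightarrow> real N / (2 * t^3) + scalar_curv (g t i) y / t - real CARD('n) / (2 * t^2)
        | _ \<Rightarrow> 0)"

end

theory Submission
  imports Defs
begin

text \<open>
  In a chart, the nonzero components of the space-time metric are \<open>g\<^sub>i\<^sub>j / \<tau>\<close> and \<open>(N + c) / (2 \<tau>\<^sup>3)\<close> with
  \<open>c = 2 \<tau>\<^sup>2 R - n \<tau>\<close>. Put \<open>w = 1 / (N + c)\<close>. The Christoffel symbols of this metric are \<open>A + B w\<close> with smooth functions
  \<open>A\<close>, \<open>B\<close> that do not depend on \<open>N\<close>, and \<open>\<partial> w = - w\<^sup>2 \<partial> c\<close>. Hence the space-time Ricci tensor is a polynomial in
  \<open>w\<close> with smooth coefficients independent of \<open>N\<close>. The Hessian of \<open>N / (2 \<tau>)\<close> contains the factor \<open>N\<close>, but mostly next to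
  a factor \<open>w\<close>, and \<open>N w = 1 - c w\<close>; the remaining multiples of \<open>N\<close> in its time component cancel against
  half the metric. So the tensor to be estimated is also such a polynomial, and the point is that it can be
  written without a constant term. Then \<open>N\<close> times the tensor is \<open>1 - c w\<close> times a polynomial in \<open>w\<close>, which is
  bounded on compact sets because \<open>w\<close> is, uniformly in \<open>N\<close> (lemmas \<open>small_tame_scaled\<close> and \<open>w_bounded\<close>).

  The constant term vanishes in the space components by the flow equation \<open>\<partial>\<^sub>\<tau> g = 2 Ric\<close>, in the mixed
  components by the contracted Bianchi identity \<open>2 div Ric = dR\<close>, and in the time component by the evolution
  equation \<open>\<partial>\<^sub>\<tau> R = - \<Delta> R - 2 |Ric|\<^sup>2\<close> (lemmas \<open>small_T_space\<close>, \<open>small_T_mixed\<close>, \<open>small_T_time\<close>).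

  The last two identities have a common source. On space-time, extend the Levi-Civita connections of the slices to the
  time direction by the endomorphism \<open>Ric\<close>. By the flow equation the metric is parallel for this connection, so its
  curvature is skew, and it satisfies the second Bianchi identity \<open>raised_bianchi\<close>. Contracting that identity with three
  spatial directions gives \<open>contracted_bianchi\<close>; with one time direction it gives \<open>evolution_scalar_curvature\<close>.

  The bound has to hold in all charts at once. Finitely many small coordinate balls cover the
  compact set, and the norm of a tensor does not depend on the chart. This requires the transformation laws of the
  Ricci tensor and of the Hessian under a change of coordinates (\<open>ricci_pullback\<close>, \<open>hessian_pullback\<close>), which are derived
  from the fact that the Jacobian is a gauge transformation between the two connections (\<open>gauge\<close>).
\<close>

section \<open>Calculus of smooth functions\<close>

lemma Ck_on_cong:
  assumes "open S" "\<And>x. x \<in> S \<Longrightarrow> f x = g x" "Ck_on k f S"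
  shows "Ck_on k g S"
  using assms(2,3)
proof (induction k arbitrary: f g)
  case 0
  then show ?case using continuous_on_cong by fastforce
next
  case (Suc k)
  have eq: "frechet_derivative f (at x) = frechet_derivative g (at x)" "g differentiable (at x)" if "x \<in> S" for x
  proof -
    have "f differentiable (at x)" using Suc.prems that by simp
    then have D: "(f has_derivative frechet_derivative f (at x)) (at x)"
      using frechet_derivative_works by blast
    then have "(g has_derivative frechet_derivative f (at x)) (at x)"
      using has_derivative_transform_within_open[OF D assms(1) that] Suc.prems(1) by simp
    then show "frechet_derivative f (at x) = frechet_derivative g (at x)" "g differentiable (at x)"
      using frechet_derivative_at differentiableI by blast+
  qed
  show ?case
    using Suc.prems(2) eq Suc.IH[of "\<lambda>x. frechet_derivative f (at x) v" "\<lambda>x. frechet_derivative g (at x) v" for v]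
    by simp
qed

lemma Ck_on_SucD: "Ck_on (Suc k) f S \<Longrightarrow> Ck_on k f S"
proof (induction k arbitrary: f)
  case 0
  then show ?case
    by (auto intro!: continuous_at_imp_continuous_on differentiable_imp_continuous_within)
next
  case (Suc k)
  then show ?case by auto
qed

lemma Ck_on_const: "Ck_on k (\<lambda>x. c) S"
  by (induction k arbitrary: c) auto

lemma Ck_on_SucI:
  assumes "open S" "\<And>x. x \<in> S \<Longrightarrow> (f has_derivative f' x) (at x)"
    and "\<And>v. Ck_on k (\<lambda>x. f' x v) S"
  shows "Ck_on (Suc k) f S"
proof -
  have "f differentiable (at x)" if "x \<in> S" for x using assms(2)[OF that] differentiableI by blast
  moreover have "Ck_on k (\<lambda>x. frechet_derivative f (at x) v) S" for v
    by (rule Ck_on_cong[OF assms(1) _ assms(3)[of v]]) (metis assms(2) frechet_derivative_at)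
  ultimately show ?thesis by simp
qed

lemma Ck_on_SucE:
  assumes "Ck_on (Suc k) f S" "x \<in> S"
  shows "(f has_derivative frechet_derivative f (at x)) (at x)"
  using assms frechet_derivative_works by auto

lemma Ck_on_linear:
  assumes "bounded_linear L" "open S"
  shows "Ck_on k L S"
proof (cases k)
  case 0
  then show ?thesis using assms linear_continuous_on by auto
next
  case (Suc m)
  then show ?thesis
    using Ck_on_SucI[where f'="\<lambda>x. L", OF assms(2) bounded_linear_imp_has_derivative[OF assms(1)] Ck_on_const] by simp
qed

lemma Ck_on_add:
  assumes S: "open S" and "Ck_on k f S" "Ck_on k g S"
  shows "Ck_on k (\<lambda>x. f x + g x) S"
  using assms(2,3)
proof (induction k arbitrary: f g)
  case 0
  then show ?case by (auto intro: continuous_on_add)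
next
  case (Suc k)
  show ?case
    by (rule Ck_on_SucI[OF S has_derivative_add[OF Ck_on_SucE[OF Suc.prems(1)] Ck_on_SucE[OF Suc.prems(2)]]])
      (use Suc in auto)
qed

lemma Ck_on_bilinear:
  assumes S: "open S" and B: "bounded_bilinear B" and "Ck_on k f S" "Ck_on k g S"
  shows "Ck_on k (\<lambda>x. B (f x) (g x)) S"
  using assms(3,4)
proof (induction k arbitrary: f g)
  case 0
  then show ?case using bounded_bilinear.continuous_on[OF B] by simp
next
  case (Suc k)
  show ?case
  proof (rule Ck_on_SucI[OF S])
    fix x assume "x \<in> S"
    then show "((\<lambda>x. B (f x) (g x)) has_derivative (\<lambda>v. B (f x) (frechet_derivative g (at x) v) + B (frechet_derivative f (at x) v) (g x))) (at x)"
      using bounded_bilinear.FDERIV[OF B Ck_on_SucE[OF Suc.prems(1)] Ck_on_SucE[OF Suc.prems(2)]] by simp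
  next
    fix v
    show "Ck_on k (\<lambda>x. B (f x) (frechet_derivative g (at x) v) + B (frechet_derivative f (at x) v) (g x)) S"
      by (rule Ck_on_add[OF S]; rule Suc.IH) (use Suc.prems in \<open>auto intro: Ck_on_SucD\<close>)
  qed
qed

lemma Ck_on_sum:
  assumes S: "open S" and "finite I" "\<And>i. i \<in> I \<Longrightarrow> Ck_on k (f i) S"
  shows "Ck_on k (\<lambda>x. \<Sum>i\<in>I. f i x) S"
  using assms(2,3) by (induction I rule: finite_induct) (auto intro: Ck_on_const Ck_on_add[OF S])

text \<open>The chain rule is expanded over the standard basis, so that the derivative of the composition is a sum of
  products to which the induction hypothesis applies.\<close>

lemma Ck_on_compose:
  fixes \<phi> :: "'a::real_normed_vector \<Rightarrow> 'b::euclidean_space" and f :: "'b \<Rightarrow> 'c::real_normed_vector"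
  assumes S: "open S" and "Ck_on k \<phi> S" "Ck_on k f T" "\<phi> ` S \<subseteq> T"
  shows "Ck_on k (\<lambda>x. f (\<phi> x)) S"
  using assms(2,3)
proof (induction k arbitrary: f)
  case 0
  then show ?case using continuous_on_compose2[OF _ _ assms(4)] by auto
next
  case (Suc k)
  show ?case
  proof (rule Ck_on_SucI[OF S])
    fix x assume x: "x \<in> S"
    then have "\<phi> x \<in> T" using assms(4) by auto
    note D = Ck_on_SucE[OF Suc.prems(2) this]
    have L: "bounded_linear (frechet_derivative f (at (\<phi> x)))"
      by (rule has_derivative_bounded_linear[OF D])
    have C: "((\<lambda>x. f (\<phi> x)) has_derivative (\<lambda>v. frechet_derivative f (at (\<phi> x)) (frechet_derivative \<phi> (at x) v))) (at x)"
      using diff_chain_at[OF Ck_on_SucE[OF Suc.prems(1) x] D] by (simp add: o_def)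
    have eq: "frechet_derivative f (at (\<phi> x)) w = (\<Sum>b\<in>Basis. (w \<bullet> b) *\<^sub>R frechet_derivative f (at (\<phi> x)) b)" for w
      using linear_sum[OF bounded_linear.linear[OF L], of "\<lambda>b. (w \<bullet> b) *\<^sub>R b" Basis]
      by (simp add: euclidean_representation linear_simps[OF L])
    show "((\<lambda>x. f (\<phi> x)) has_derivative (\<lambda>v. \<Sum>b\<in>Basis. (frechet_derivative \<phi> (at x) v \<bullet> b) *\<^sub>R frechet_derivative f (at (\<phi> x)) b)) (at x)"
      using C by (subst (asm) eq)
  next
    fix v
    have 1: "Ck_on k (\<lambda>x. frechet_derivative \<phi> (at x) v \<bullet> b) S" if "b \<in> Basis" for b
      by (rule Ck_on_bilinear[OF S bounded_bilinear_inner]) (use Suc.prems Ck_on_const in auto)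
    have 2: "Ck_on k (\<lambda>x. frechet_derivative f (at (\<phi> x)) b) S" for b
      by (rule Suc.IH) (use Suc.prems Ck_on_SucD in auto)
    show "Ck_on k (\<lambda>x. \<Sum>b\<in>Basis. (frechet_derivative \<phi> (at x) v \<bullet> b) *\<^sub>R frechet_derivative f (at (\<phi> x)) b) S"
      by (rule Ck_on_sum[OF S finite_Basis], rule Ck_on_bilinear[OF S bounded_bilinear_scaleR 1 2])
  qed
qed

lemma Ck_on_inverse:
  fixes f :: "'a::real_normed_vector \<Rightarrow> real"
  assumes S: "open S" and "Ck_on k f S" and nz: "\<And>x. x \<in> S \<Longrightarrow> f x \<noteq> 0"
  shows "Ck_on k (\<lambda>x. inverse (f x)) S"
  using assms(2)
proof (induction k)
  case 0
  then show ?case using nz by (auto intro!: continuous_on_inverse)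
next
  case (Suc k)
  note mult = Ck_on_bilinear[OF S bounded_bilinear_mult]
  have IH: "Ck_on k (\<lambda>x. inverse (f x)) S" using Suc Ck_on_SucD by blast
  show ?case
  proof (rule Ck_on_SucI[OF S])
    fix x assume x: "x \<in> S"
    show "((\<lambda>x. inverse (f x)) has_derivative (\<lambda>v. (-1) * (inverse (f x) * frechet_derivative f (at x) v * inverse (f x)))) (at x)"
      using Deriv.has_derivative_inverse[OF nz[OF x] Ck_on_SucE[OF Suc.prems x]] by simp
  next
    fix v
    show "Ck_on k (\<lambda>x. (-1) * (inverse (f x) * frechet_derivative f (at x) v * inverse (f x))) S"
      by (intro mult IH Ck_on_const) (use Suc.prems in auto)
  qed
qed

text \<open>Closure rules for smoothness: goals \<^term>\<open>smooth_on f S\<close> are proved by following the syntax of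
  \<open>f\<close>.\<close>

named_theorems smooth_intros

lemma smooth_on_cong:
  assumes "open S" "\<And>x. x \<in> S \<Longrightarrow> f x = g x" "smooth_on f S"
  shows "smooth_on g S"
  using assms Ck_on_cong unfolding smooth_on_def by blast

lemma smooth_on_subset: "smooth_on f S \<Longrightarrow> T \<subseteq> S \<Longrightarrow> smooth_on f T"
proof -
  have "Ck_on k f S \<Longrightarrow> T \<subseteq> S \<Longrightarrow> Ck_on k f T" for k
    by (induction k arbitrary: f) (auto intro: continuous_on_subset)
  then show "smooth_on f S \<Longrightarrow> T \<subseteq> S \<Longrightarrow> smooth_on f T" unfolding smooth_on_def by blast
qed

lemma smooth_on_const [smooth_intros]: "smooth_on (\<lambda>x. c) S"
  unfolding smooth_on_def using Ck_on_const by blast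

lemma smooth_on_bounded_linear: "bounded_linear L \<Longrightarrow> open S \<Longrightarrow> smooth_on L S"
  unfolding smooth_on_def using Ck_on_linear by blast

lemma smooth_on_bilinear:
  "bounded_bilinear B \<Longrightarrow> open S \<Longrightarrow> smooth_on f S \<Longrightarrow> smooth_on g S \<Longrightarrow> smooth_on (\<lambda>x. B (f x) (g x)) S"
  unfolding smooth_on_def using Ck_on_bilinear by blast

lemmas smooth_on_mult [smooth_intros] = smooth_on_bilinear[OF bounded_bilinear_mult]
lemmas smooth_on_scaleR [smooth_intros] = smooth_on_bilinear[OF bounded_bilinear_scaleR]

lemma smooth_on_add [smooth_intros]:
  "open S \<Longrightarrow> smooth_on f S \<Longrightarrow> smooth_on g S \<Longrightarrow> smooth_on (\<lambda>x. f x + g x) S"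
  unfolding smooth_on_def using Ck_on_add by blast

lemma smooth_on_sum [smooth_intros]:
  "open S \<Longrightarrow> finite I \<Longrightarrow> (\<And>i. i \<in> I \<Longrightarrow> smooth_on (f i) S) \<Longrightarrow> smooth_on (\<lambda>x. \<Sum>i\<in>I. f i x) S"
  unfolding smooth_on_def using Ck_on_sum by blast

lemma smooth_on_compose:
  fixes \<phi> :: "'a::real_normed_vector \<Rightarrow> 'b::euclidean_space"
  shows "open S \<Longrightarrow> smooth_on \<phi> S \<Longrightarrow> smooth_on f T \<Longrightarrow> \<phi> ` S \<subseteq> T \<Longrightarrow> smooth_on (\<lambda>x. f (\<phi> x)) S"
  unfolding smooth_on_def using Ck_on_compose by blast

lemma smooth_on_bounded_linear_compose:
  fixes f :: "'a::real_normed_vector \<Rightarrow> 'b::euclidean_space"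
  assumes "bounded_linear L" "open S" "smooth_on f S"
  shows "smooth_on (\<lambda>x. L (f x)) S"
  using smooth_on_compose[OF assms(2,3) smooth_on_bounded_linear[OF assms(1) open_UNIV]] by simp

lemma smooth_on_minus [smooth_intros]:
  fixes f :: "'a::real_normed_vector \<Rightarrow> 'b::real_normed_vector"
  assumes "open S" "smooth_on f S"
  shows "smooth_on (\<lambda>x. - f x) S"
  using smooth_on_scaleR[OF assms(1) smooth_on_const[of "-1"] assms(2)] by simp

lemma smooth_on_diff [smooth_intros]:
  fixes f :: "'a::real_normed_vector \<Rightarrow> 'b::real_normed_vector"
  assumes "open S" "smooth_on f S" "smooth_on g S"
  shows "smooth_on (\<lambda>x. f x - g x) S"
  using smooth_on_add[OF assms(1,2) smooth_on_minus[OF assms(1,3)]] by simp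

lemma smooth_on_inverse [smooth_intros]:
  fixes f :: "'a::real_normed_vector \<Rightarrow> real"
  shows "open S \<Longrightarrow> smooth_on f S \<Longrightarrow> (\<And>x. x \<in> S \<Longrightarrow> f x \<noteq> 0) \<Longrightarrow> smooth_on (\<lambda>x. inverse (f x)) S"
  unfolding smooth_on_def using Ck_on_inverse by blast

lemma smooth_on_divide [smooth_intros]:
  fixes f :: "'a::real_normed_vector \<Rightarrow> real"
  shows "open S \<Longrightarrow> smooth_on f S \<Longrightarrow> smooth_on g S \<Longrightarrow> (\<And>x. x \<in> S \<Longrightarrow> g x \<noteq> 0) \<Longrightarrow> smooth_on (\<lambda>x. f x / g x) S"
  unfolding divide_inverse by (intro smooth_intros)

lemma smooth_on_prod [smooth_intros]:
  fixes f :: "'i \<Rightarrow> 'a::real_normed_vector \<Rightarrow> real"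
  assumes "open S" "finite I" "\<And>i. i \<in> I \<Longrightarrow> smooth_on (f i) S"
  shows "smooth_on (\<lambda>x. \<Prod>i\<in>I. f i x) S"
  using assms(2,3) by (induction I rule: finite_induct) (auto intro!: smooth_intros assms(1))

lemma smooth_on_power [smooth_intros]:
  fixes f :: "'a::real_normed_vector \<Rightarrow> real"
  shows "open S \<Longrightarrow> smooth_on f S \<Longrightarrow> smooth_on (\<lambda>x. f x ^ n) S"
  by (induction n) (auto intro!: smooth_intros)

lemma smooth_on_vec_nth [smooth_intros]:
  fixes f :: "'a::real_normed_vector \<Rightarrow> 'b::euclidean_space^'n"
  shows "open S \<Longrightarrow> smooth_on f S \<Longrightarrow> smooth_on (\<lambda>x. f x $ k) S"
  by (rule smooth_on_bounded_linear_compose[OF bounded_linear_vec_nth])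

lemma smooth_on_vec_lambda [smooth_intros]:
  fixes f :: "'n::finite \<Rightarrow> 'a::real_normed_vector \<Rightarrow> 'b::euclidean_space"
  assumes "open S" "\<And>k. smooth_on (f k) S"
  shows "smooth_on (\<lambda>x. \<chi> k. f k x) S"
proof -
  have L: "linear (\<lambda>y::'b. axis k y)" for k :: 'n
    by (rule linearI) (auto simp: axis_def vec_eq_iff)
  have "(\<lambda>x. \<chi> k. f k x) = (\<lambda>x. \<Sum>k\<in>UNIV. axis k (f k x))"
    by (auto simp: fun_eq_iff vec_eq_iff axis_def if_distrib cong: if_cong)
  moreover have "smooth_on (\<lambda>x. axis k (f k x)) S" for k
    using smooth_on_bounded_linear_compose[OF linear_conv_bounded_linear[THEN iffD1, OF L] assms(1) assms(2)] .
  ultimately show ?thesis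
    using smooth_on_sum[OF assms(1) finite_class.finite_UNIV, where f="\<lambda>k x. axis k (f k x)"] by simp
qed

lemma smooth_on_differentiable: "smooth_on f S \<Longrightarrow> x \<in> S \<Longrightarrow> f differentiable (at x)"
  unfolding smooth_on_def using Ck_on.simps(2) by blast

lemma smooth_on_continuous: "smooth_on f S \<Longrightarrow> continuous_on S f"
  unfolding smooth_on_def using Ck_on.simps(1) by blast

lemma smooth_on_frechet_derivative: "smooth_on f S \<Longrightarrow> smooth_on (\<lambda>x. frechet_derivative f (at x) v) S"
  unfolding smooth_on_def using Ck_on.simps(2) by blast

text \<open>The partial derivative of \<^const>\<open>pderiv_at\<close>, for vector-valued and in particular matrix-valued functions.\<close>

definition pd :: "'m::finite \<Rightarrow> (real^'m \<Rightarrow> 'b::real_normed_vector) \<Rightarrow> real^'m \<Rightarrow> 'b" where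
  "pd k f z = frechet_derivative f (at z) (axis k 1)"

lemma pderiv_at_eq_pd: "pderiv_at = pd"
  by (simp add: fun_eq_iff pderiv_at_def pd_def)

lemma smooth_on_pd [smooth_intros]: "smooth_on f S \<Longrightarrow> smooth_on (pd k f) S"
  unfolding pd_def[abs_def] by (rule smooth_on_frechet_derivative)

lemma pd_cong_open:
  assumes "open S" "z \<in> S" "\<And>x. x \<in> S \<Longrightarrow> f x = g x"
  shows "pd k f z = pd k g z"
proof (cases "f differentiable at z")
  case True
  have "frechet_derivative f (at z) = frechet_derivative g (at z)"
    by (rule frechet_derivative_transform_within_open[OF True assms(1,2)]) (use assms(3) in auto)
  then show ?thesis by (simp add: pd_def)
next
  case False
  have "(f has_derivative D) (at z) \<longleftrightarrow> (g has_derivative D) (at z)" for D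
    using has_derivative_transform_within_open[OF _ assms(1,2)] assms(3) by (metis (no_types, lifting))
  then show ?thesis by (simp add: pd_def frechet_derivative_def)
qed

lemma pd_has_derivative: "(f has_derivative f') (at z) \<Longrightarrow> pd k f z = f' (axis k 1)"
  by (metis frechet_derivative_at pd_def)

lemma pd_const [simp]: "pd k (\<lambda>z. c) z = 0"
  by (simp add: pd_def)

lemma pd_bilinear:
  assumes "bounded_bilinear B" "f differentiable (at z)" "g differentiable (at z)"
  shows "pd k (\<lambda>z. B (f z) (g z)) z = B (f z) (pd k g z) + B (pd k f z) (g z)"
  using pd_has_derivative[OF bounded_bilinear.FDERIV[OF assms(1) frechet_derivative_works[THEN iffD1, OF assms(2)] frechet_derivative_works[THEN iffD1, OF assms(3)]]]
  by (simp add: pd_def)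

lemmas pd_mult = pd_bilinear[OF bounded_bilinear_mult]

lemma pd_add:
  assumes "f differentiable (at z)" "g differentiable (at z)"
  shows "pd k (\<lambda>z. f z + g z) z = pd k f z + pd k g z"
  using pd_has_derivative[OF has_derivative_add[OF frechet_derivative_works[THEN iffD1, OF assms(1)] frechet_derivative_works[THEN iffD1, OF assms(2)]]]
  by (simp add: pd_def)

lemma pd_diff:
  assumes "f differentiable (at z)" "g differentiable (at z)"
  shows "pd k (\<lambda>z. f z - g z) z = pd k f z - pd k g z"
  using pd_has_derivative[OF has_derivative_diff[OF frechet_derivative_works[THEN iffD1, OF assms(1)] frechet_derivative_works[THEN iffD1, OF assms(2)]]]
  by (simp add: pd_def)

lemma pd_minus:
  assumes "f differentiable (at z)"
  shows "pd k (\<lambda>z. - f z) z = - pd k f z"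
  using pd_diff[OF differentiable_const[of 0] assms] by simp

lemma pd_sum:
  assumes "finite I" "\<And>i. i \<in> I \<Longrightarrow> f i differentiable (at z)"
  shows "pd k (\<lambda>z. \<Sum>i\<in>I. f i z) z = (\<Sum>i\<in>I. pd k (f i) z)"
  using pd_has_derivative[OF has_derivative_sum[of I f "\<lambda>i. frechet_derivative (f i) (at z)" "at z"]] assms
  by (simp add: pd_def frechet_derivative_works)

lemma pd_bounded_linear:
  assumes "bounded_linear L" "f differentiable (at z)"
  shows "pd k (\<lambda>z. L (f z)) z = L (pd k f z)"
  using pd_has_derivative[OF bounded_linear.has_derivative[OF assms(1) frechet_derivative_works[THEN iffD1, OF assms(2)]]]
  by (simp add: pd_def)

lemma pd_vec_nth:
  assumes "f differentiable (at z)"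
  shows "pd k (\<lambda>z. f z $ i) z = pd k f z $ i"
  by (rule pd_bounded_linear[OF bounded_linear_vec_nth assms])

lemma differentiable_vec_nth: "f differentiable (at z) \<Longrightarrow> (\<lambda>z. f z $ i) differentiable (at z)"
  using bounded_linear.has_derivative[OF bounded_linear_vec_nth] unfolding differentiable_def by blast

lemma pd_vec_nth2:
  assumes "f differentiable (at z)"
  shows "pd k (\<lambda>z. f z $ i $ j) z = pd k f z $ i $ j"
  using assms by (simp add: pd_vec_nth differentiable_vec_nth)

lemma pd_inverse:
  fixes f :: "real^'m \<Rightarrow> real"
  assumes "f differentiable (at z)" "f z \<noteq> 0"
  shows "pd k (\<lambda>z. inverse (f z)) z = - pd k f z * (inverse (f z))\<^sup>2"
  using pd_has_derivative[OF Deriv.has_derivative_inverse[OF assms(2) frechet_derivative_works[THEN iffD1, OF assms(1)]]]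
  by (simp add: pd_def power2_eq_square)

lemma pd_coord: "pd k (\<lambda>z. z $ i) z = (if k = i then 1 else 0)"
  by (subst pd_has_derivative[OF bounded_linear_imp_has_derivative[OF bounded_linear_vec_nth]])
    (auto simp: axis_def)

lemma pd_compose:
  fixes \<phi> :: "real^'m::finite \<Rightarrow> real^'k::finite" and f :: "real^'k \<Rightarrow> 'b::real_normed_vector"
  assumes "f differentiable (at (\<phi> z))" "\<phi> differentiable (at z)"
  shows "pd a (\<lambda>z. f (\<phi> z)) z = (\<Sum>d\<in>UNIV. (pd a \<phi> z $ d) *\<^sub>R pd d f (\<phi> z))"
proof -
  have L: "linear (frechet_derivative f (at (\<phi> z)))"
    using assms(1) linear_frechet_derivative by blast
  have "pd a (\<lambda>z. f (\<phi> z)) z = frechet_derivative f (at (\<phi> z)) (pd a \<phi> z)"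
    using pd_has_derivative[OF diff_chain_at[OF frechet_derivative_works[THEN iffD1, OF assms(2)] frechet_derivative_works[THEN iffD1, OF assms(1)]]]
    by (simp add: pd_def o_def)
  also have "pd a \<phi> z = (\<Sum>d\<in>UNIV. (pd a \<phi> z $ d) *\<^sub>R axis d 1)"
    using basis_expansion[of "pd a \<phi> z"] by (simp add: scalar_mult_eq_scaleR)
  finally show ?thesis
    by (simp add: linear_sum[OF L] linear_cmul[OF L] pd_def)
qed

lemma mvt_pd:
  fixes f :: "real^'m::finite \<Rightarrow> real"
  assumes "0 < h" "\<And>s. 0 \<le> s \<Longrightarrow> s \<le> h \<Longrightarrow> f differentiable (at (x + s *\<^sub>R axis a 1))"
  shows "\<exists>s. 0 < s \<and> s < h \<and> f (x + h *\<^sub>R axis a 1) - f x = h * pd a f (x + s *\<^sub>R axis a 1)"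
proof -
  have "((\<lambda>s. f (x + s *\<^sub>R axis a 1)) has_real_derivative pd a f (x + s *\<^sub>R axis a 1)) (at s)"
    if "0 \<le> s" "s \<le> h" for s
  proof -
    note D = frechet_derivative_works[THEN iffD1, OF assms(2)[OF that]]
    have "((\<lambda>s. x + s *\<^sub>R axis a 1) has_derivative (\<lambda>s. s *\<^sub>R axis a 1)) (at s)"
      by (auto intro!: derivative_eq_intros)
    from diff_chain_at[OF this D]
    have "((\<lambda>s. f (x + s *\<^sub>R axis a 1)) has_derivative
        (\<lambda>t. frechet_derivative f (at (x + s *\<^sub>R axis a 1)) (t *\<^sub>R axis a 1))) (at s)"
      by (simp add: o_def)
    moreover have "(\<lambda>t. frechet_derivative f (at (x + s *\<^sub>R axis a 1)) (t *\<^sub>R axis a 1)) = (*) (pd a f (x + s *\<^sub>R axis a 1))"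
      by (rule ext) (simp add: pd_def linear_cmul[OF linear_frechet_derivative[OF assms(2)[OF that]]])
    ultimately show ?thesis
      unfolding has_field_derivative_def by simp
  qed
  from MVT2[OF assms(1) this] show ?thesis by auto
qed

text \<open>Clairaut's theorem. The mean value theorem in each variable writes the second difference of
  \<open>f\<close> over a small square as a mixed derivative at some point of the square, in either order.\<close>

lemma pd_commute:
  fixes f :: "real^'m::finite \<Rightarrow> real"
  assumes S: "open S" and x: "x \<in> S" and f: "smooth_on f S"
  shows "pd a (pd b f) x = pd b (pd a f) x"
proof -
  have diff: "p differentiable (at y)" if "smooth_on p S" "y \<in> S" for p :: "real^'m \<Rightarrow> real" and y
    using that smooth_on_differentiable by blast
  obtain e where e: "e > 0" "ball x e \<subseteq> S" using S x open_contains_ball by blast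
  have square: "x + s *\<^sub>R axis a 1 + t *\<^sub>R axis b 1 \<in> ball x d" if "0 \<le> s" "0 \<le> t" "s \<le> d/3" "t \<le> d/3" "d > 0"
    for s t d and a b :: 'm
  proof -
    have "norm (s *\<^sub>R axis a 1 + t *\<^sub>R axis b (1::real)) \<le> s + t"
      using norm_triangle_ineq[of "s *\<^sub>R axis a 1" "t *\<^sub>R axis b (1::real)"] that by simp
    moreover have "dist x (x + s *\<^sub>R axis a 1 + t *\<^sub>R axis b 1) = norm (s *\<^sub>R axis a 1 + t *\<^sub>R axis b (1::real))"
      by (simp add: dist_norm add.assoc norm_minus_commute add.commute)
    ultimately show ?thesis using that by simp
  qed
  have second_diff: "\<exists>y\<in>ball x d. f (x + h *\<^sub>R axis a 1 + h *\<^sub>R axis b 1) - f (x + h *\<^sub>R axis a 1)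
      - (f (x + h *\<^sub>R axis b 1) - f x) = h * h * pd b (pd a f) y"
    if d: "0 < d" "d \<le> e" "h = d/3" for d h and a b
  proof -
    have inS: "x + s *\<^sub>R axis a 1 + t *\<^sub>R axis b 1 \<in> S" if "0 \<le> s" "0 \<le> t" "s \<le> h" "t \<le> h" for s t
    proof -
      have "x + s *\<^sub>R axis a 1 + t *\<^sub>R axis b 1 \<in> ball x d"
        using square[of s t d a b] that d by simp
      also have "ball x d \<subseteq> S" using d e subset_ball[of d e x] by auto
      finally show ?thesis .
    qed
    have 1: "(\<lambda>y. f (y + h *\<^sub>R axis b 1)) differentiable (at (x + s *\<^sub>R axis a 1))"
       "pd a (\<lambda>y. f (y + h *\<^sub>R axis b 1)) (x + s *\<^sub>R axis a 1) = pd a f (x + s *\<^sub>R axis a 1 + h *\<^sub>R axis b 1)"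
      if "0 \<le> s" "s \<le> h" for s
    proof -
      have "f differentiable (at (x + s *\<^sub>R axis a 1 + h *\<^sub>R axis b 1))"
        using diff[OF f inS[of s h]] that d by auto
      note D = frechet_derivative_works[THEN iffD1, OF this]
      have "((\<lambda>y. y + h *\<^sub>R axis b 1) has_derivative (\<lambda>v. v)) (at (x + s *\<^sub>R axis a 1))"
        by (auto intro!: derivative_eq_intros)
      from diff_chain_at[OF this D]
      have *: "((\<lambda>y. f (y + h *\<^sub>R axis b 1)) has_derivative frechet_derivative f (at (x + s *\<^sub>R axis a 1 + h *\<^sub>R axis b 1))) (at (x + s *\<^sub>R axis a 1))"
        by (simp add: o_def)
      then show "(\<lambda>y. f (y + h *\<^sub>R axis b 1)) differentiable (at (x + s *\<^sub>R axis a 1))"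
        using differentiableI by blast
      show "pd a (\<lambda>y. f (y + h *\<^sub>R axis b 1)) (x + s *\<^sub>R axis a 1) = pd a f (x + s *\<^sub>R axis a 1 + h *\<^sub>R axis b 1)"
        using pd_has_derivative[OF *] by (simp add: pd_def)
    qed
    have 2: "f differentiable (at (x + s *\<^sub>R axis a 1))" if "0 \<le> s" "s \<le> h" for s
      using diff[OF f inS[of s 0]] that d by auto
    have "\<exists>s. 0 < s \<and> s < h \<and> (f (x + h *\<^sub>R axis a 1 + h *\<^sub>R axis b 1) - f (x + h *\<^sub>R axis a 1)) - (f (x + h *\<^sub>R axis b 1) - f x) =
       h * pd a (\<lambda>y. f (y + h *\<^sub>R axis b 1) - f y) (x + s *\<^sub>R axis a 1)"
      using mvt_pd[of h "\<lambda>y. f (y + h *\<^sub>R axis b 1) - f y" x a] 1 2 d by auto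
    then obtain s where s: "0 < s" "s < h" and
      eq: "(f (x + h *\<^sub>R axis a 1 + h *\<^sub>R axis b 1) - f (x + h *\<^sub>R axis a 1)) - (f (x + h *\<^sub>R axis b 1) - f x) =
       h * pd a (\<lambda>y. f (y + h *\<^sub>R axis b 1) - f y) (x + s *\<^sub>R axis a 1)" by blast
    have eq2: "pd a (\<lambda>y. f (y + h *\<^sub>R axis b 1) - f y) (x + s *\<^sub>R axis a 1) =
       pd a f (x + s *\<^sub>R axis a 1 + h *\<^sub>R axis b 1) - pd a f (x + s *\<^sub>R axis a 1)"
      using pd_diff[OF 1(1) 2] 1(2) s by simp
    have "\<exists>t. 0 < t \<and> t < h \<and> pd a f (x + s *\<^sub>R axis a 1 + h *\<^sub>R axis b 1) - pd a f (x + s *\<^sub>R axis a 1) =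
       h * pd b (pd a f) (x + s *\<^sub>R axis a 1 + t *\<^sub>R axis b 1)"
      by (rule mvt_pd) (use d s inS smooth_on_pd[OF f] diff in auto)
    then obtain t where t: "0 < t" "t < h" "pd a f (x + s *\<^sub>R axis a 1 + h *\<^sub>R axis b 1) - pd a f (x + s *\<^sub>R axis a 1) =
       h * pd b (pd a f) (x + s *\<^sub>R axis a 1 + t *\<^sub>R axis b 1)" by blast
    show ?thesis
      by (rule bexI[of _ "x + s *\<^sub>R axis a 1 + t *\<^sub>R axis b 1"])
        (use eq eq2 s d t square[of s t d a b] in auto)
  qed
  have close: "\<bar>pd a (pd b f) x - pd b (pd a f) x\<bar> < \<epsilon>" if "\<epsilon> > 0" for \<epsilon>
  proof -
    have "continuous (at x) (pd a (pd b f))" "continuous (at x) (pd b (pd a f))"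
      using smooth_on_continuous[OF smooth_on_pd[OF smooth_on_pd[OF f]]] S x continuous_on_eq_continuous_at by blast+
    then obtain d1 d2 where d: "d1 > 0" "d2 > 0"
       "\<And>y. dist y x < d1 \<Longrightarrow> dist (pd a (pd b f) y) (pd a (pd b f) x) < \<epsilon>/2"
       "\<And>y. dist y x < d2 \<Longrightarrow> dist (pd b (pd a f) y) (pd b (pd a f) x) < \<epsilon>/2"
      unfolding continuous_at_eps_delta using \<open>\<epsilon> > 0\<close> half_gt_zero by metis
    define d where "d = min e (min d1 d2)"
    have d0: "0 < d" "d \<le> e" using d e d_def by auto
    obtain y where y: "y \<in> ball x d" "f (x + (d/3) *\<^sub>R axis a 1 + (d/3) *\<^sub>R axis b 1) - f (x + (d/3) *\<^sub>R axis a 1)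
      - (f (x + (d/3) *\<^sub>R axis b 1) - f x) = (d/3) * (d/3) * pd b (pd a f) y"
      using second_diff[OF d0 refl] by blast
    obtain y' where y': "y' \<in> ball x d" "f (x + (d/3) *\<^sub>R axis b 1 + (d/3) *\<^sub>R axis a 1) - f (x + (d/3) *\<^sub>R axis b 1)
      - (f (x + (d/3) *\<^sub>R axis a 1) - f x) = (d/3) * (d/3) * pd a (pd b f) y'"
      using second_diff[OF d0 refl] by blast
    have "pd b (pd a f) y = pd a (pd b f) y'"
    proof -
      have "(d/3) * (d/3) * pd b (pd a f) y = (d/3) * (d/3) * pd a (pd b f) y'"
        unfolding y(2)[symmetric] y'(2)[symmetric] by (simp add: algebra_simps)
      then show ?thesis using d0 by simp
    qed
    moreover have "dist y x < d2" "dist y' x < d1" using y(1) y'(1) d_def by (auto simp: dist_commute)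
    ultimately show ?thesis using d(3)[of y'] d(4)[of y] by (simp add: dist_real_def abs_if split: if_splits)
  qed
  then show ?thesis
    using close[of "\<bar>pd a (pd b f) x - pd b (pd a f) x\<bar>"] by fastforce
qed

section \<open>Matrix-valued functions\<close>

lemma bounded_bilinear_matrix_mult:
  "bounded_bilinear ((**) :: real^'k::finite^'n::finite \<Rightarrow> real^'m::finite^'k \<Rightarrow> real^'m^'n)"
  unfolding bilinear_conv_bounded_bilinear[symmetric] bilinear_def
  by (auto intro!: linearI simp: vec_eq_iff matrix_matrix_mult_def sum.distrib sum_distrib_left algebra_simps)

lemma bounded_linear_transpose:
  "bounded_linear (transpose :: real^'k::finite^'n::finite \<Rightarrow> real^'n^'k)"
  unfolding linear_conv_bounded_linear[symmetric]
  by (auto intro!: linearI simp: vec_eq_iff transpose_def)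

lemmas matrix_distrib =
  bounded_bilinear.add_left[OF bounded_bilinear_matrix_mult]
  bounded_bilinear.add_right[OF bounded_bilinear_matrix_mult]
  bounded_bilinear.diff_left[OF bounded_bilinear_matrix_mult]
  bounded_bilinear.diff_right[OF bounded_bilinear_matrix_mult]
  bounded_bilinear.minus_left[OF bounded_bilinear_matrix_mult]
  bounded_bilinear.minus_right[OF bounded_bilinear_matrix_mult]

lemmas matrix_zero =
  bounded_bilinear.zero_left[OF bounded_bilinear_matrix_mult]
  bounded_bilinear.zero_right[OF bounded_bilinear_matrix_mult]

lemmas matrix_mult_scaleR =
  bounded_bilinear.scaleR_left[OF bounded_bilinear_matrix_mult]
  bounded_bilinear.scaleR_right[OF bounded_bilinear_matrix_mult]

lemmas transpose_linear =
  linear_add[OF bounded_linear.linear[OF bounded_linear_transpose]]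
  linear_diff[OF bounded_linear.linear[OF bounded_linear_transpose]]
  linear_neg[OF bounded_linear.linear[OF bounded_linear_transpose]]

lemmas smooth_on_matrix_mult [smooth_intros] = smooth_on_bilinear[OF bounded_bilinear_matrix_mult]
lemmas smooth_on_transpose [smooth_intros] = smooth_on_bounded_linear_compose[OF bounded_linear_transpose]
lemmas pd_matrix_mult = pd_bilinear[OF bounded_bilinear_matrix_mult]
lemmas pd_transpose = pd_bounded_linear[OF bounded_linear_transpose]

lemma matrix_inv_left: "det A \<noteq> 0 \<Longrightarrow> matrix_inv A ** A = mat 1"
  and matrix_inv_right: "det A \<noteq> 0 \<Longrightarrow> A ** matrix_inv A = mat 1" for A :: "real^'n::finite^'n"
  using someI_ex[of "\<lambda>A'. A ** A' = mat 1 \<and> A' ** A = mat 1"]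
  unfolding invertible_det_nz[symmetric] invertible_def matrix_inv_def by auto

lemma matrix_inv_unique:
  fixes A B :: "real^'n::finite^'n"
  assumes "A ** B = mat 1"
  shows "matrix_inv A = B"
proof -
  have "det A * det B = 1" using assms det_mul[of A B] by simp
  then have "det A \<noteq> 0" by auto
  then have "matrix_inv A = matrix_inv A ** (A ** B)" using assms by simp
  then show ?thesis using matrix_inv_left[OF \<open>det A \<noteq> 0\<close>] by (simp add: matrix_mul_assoc)
qed

lemma transpose_matrix_inv:
  fixes A :: "real^'n::finite^'n"
  assumes "det A \<noteq> 0"
  shows "transpose (matrix_inv A) = matrix_inv (transpose A)"
  by (rule matrix_inv_unique[symmetric])
    (simp add: matrix_transpose_mul[symmetric] matrix_inv_left[OF assms])

lemma smooth_on_det [smooth_intros]: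
  fixes A :: "'a::real_normed_vector \<Rightarrow> real^'n::finite^'n"
  assumes "open S" "smooth_on A S"
  shows "smooth_on (\<lambda>x. det (A x)) S"
  unfolding det_def using assms by (intro smooth_intros finite_permutations finite)

lemma smooth_on_matrix_inv [smooth_intros]:
  fixes A :: "'a::real_normed_vector \<Rightarrow> real^'n::finite^'n"
  assumes S: "open S" "smooth_on A S" and nz: "\<And>x. x \<in> S \<Longrightarrow> det (A x) \<noteq> 0"
  shows "smooth_on (\<lambda>x. matrix_inv (A x)) S"
proof -
  define B where "B x = (\<chi> k l. det (\<chi> i j. if j = k then axis l 1 $ i else A x $ i $ j) / det (A x))" for x
  have "smooth_on B S"
  proof -
    have "smooth_on (\<lambda>x. if j = k then axis l 1 $ i else A x $ i $ j) S" for i j k l :: 'n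
      using S by (cases "j = k") (auto intro!: smooth_intros)
    then show ?thesis unfolding B_def[abs_def] using S nz by (intro smooth_intros) auto
  qed
  \<comment> \<open>\<open>B\<close> is Cramer's rule for the columns of the inverse.\<close>
  moreover have "B x = matrix_inv (A x)" if "x \<in> S" for x
  proof -
    have "A x *v (matrix_inv (A x) *v axis l 1) = axis l 1" for l
      using matrix_inv_right[OF nz[OF that]] by (simp add: matrix_vector_mul_assoc)
    then have "matrix_inv (A x) *v axis l 1 = (\<chi> k. det (\<chi> i j. if j = k then axis l 1 $ i else A x $ i $ j) / det (A x))" for l
      using cramer[OF nz[OF that]] by blast
    then have "matrix_inv (A x) $ k $ l = B x $ k $ l" for k l
      by (simp add: B_def matrix_vector_mul_component vec_eq_iff inner_axis)
    then show ?thesis by (simp add: vec_eq_iff)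
  qed
  ultimately show ?thesis using smooth_on_cong[OF S(1)] by metis
qed

text \<open>Clairaut's theorem, applied to each coordinate of the values.\<close>

lemma pd_commute_vec:
  fixes f :: "real^'m::finite \<Rightarrow> 'b::euclidean_space"
  assumes S: "open S" and x: "x \<in> S" and f: "smooth_on f S"
  shows "pd a (pd b f) x = pd b (pd a f) x"
proof (rule euclidean_eqI)
  fix i :: 'b assume "i \<in> Basis"
  have fi: "smooth_on (\<lambda>z. f z \<bullet> i) S"
    using smooth_on_bounded_linear_compose[OF bounded_linear_inner_left S f] .
  have *: "pd a (pd b f) x \<bullet> i = pd a (pd b (\<lambda>z. f z \<bullet> i)) x" for a b
  proof -
    have "pd a (pd b f) x \<bullet> i = pd a (\<lambda>z. pd b f z \<bullet> i) x"
      using pd_bounded_linear[OF bounded_linear_inner_left smooth_on_differentiable[OF smooth_on_pd[OF f] x]] by simp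
    also have "\<dots> = pd a (pd b (\<lambda>z. f z \<bullet> i)) x"
      by (rule pd_cong_open[OF S x])
        (use pd_bounded_linear[OF bounded_linear_inner_left smooth_on_differentiable[OF f]] in simp)
    finally show ?thesis .
  qed
  show "pd a (pd b f) x \<bullet> i = pd b (pd a f) x \<bullet> i"
    unfolding * by (rule pd_commute[OF S x fi])
qed

section \<open>Curvature of a connection\<close>

text \<open>The curvature matrices of the connection \<open>d + \<Gamma>\<close> on a trivial bundle. Only the directions of
  differentiation are coordinates of the base: the bundle may have another rank than the base, which makes room for a time
  direction.\<close>

definition curv :: "('m::finite \<Rightarrow> real^'m \<Rightarrow> real^'n::finite^'n) \<Rightarrow> 'm \<Rightarrow> 'm \<Rightarrow> real^'m \<Rightarrow> real^'n^'n" where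
  "curv \<Gamma> a b z = pd a (\<Gamma> b) z - pd b (\<Gamma> a) z + \<Gamma> a z ** \<Gamma> b z - \<Gamma> b z ** \<Gamma> a z"

lemma smooth_on_curv [smooth_intros]:
  "open S \<Longrightarrow> (\<And>a. smooth_on (\<Gamma> a) S) \<Longrightarrow> smooth_on (curv \<Gamma> a b) S"
  unfolding curv_def[abs_def] by (intro smooth_intros)

lemma curv_swap: "curv \<Gamma> a b z = - curv \<Gamma> b a z"
  by (simp add: curv_def)

text \<open>In this matrix form the identity is the Jacobi identity for the covariant derivatives
  \<open>\<partial>\<^sub>a + \<Gamma>\<^sub>a\<close>.\<close>

lemma second_bianchi:
  fixes \<Gamma> :: "'m::finite \<Rightarrow> real^'m \<Rightarrow> real^'n::finite^'n"
  assumes S: "open S" "z \<in> S" and sm: "\<And>a. smooth_on (\<Gamma> a) S"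
  shows "(pd a (curv \<Gamma> b c) z + \<Gamma> a z ** curv \<Gamma> b c z - curv \<Gamma> b c z ** \<Gamma> a z)
    + (pd b (curv \<Gamma> c a) z + \<Gamma> b z ** curv \<Gamma> c a z - curv \<Gamma> c a z ** \<Gamma> b z)
    + (pd c (curv \<Gamma> a b) z + \<Gamma> c z ** curv \<Gamma> a b z - curv \<Gamma> a b z ** \<Gamma> c z) = 0"
proof -
  have D: "p differentiable (at z)" if "smooth_on p S" for p :: "real^'m \<Rightarrow> real^'n^'n"
    using smooth_on_differentiable[OF that S(2)] .
  have *: "pd a (curv \<Gamma> b c) z = pd a (pd b (\<Gamma> c)) z - pd a (pd c (\<Gamma> b)) z
      + (\<Gamma> b z ** pd a (\<Gamma> c) z + pd a (\<Gamma> b) z ** \<Gamma> c z) - (\<Gamma> c z ** pd a (\<Gamma> b) z + pd a (\<Gamma> c) z ** \<Gamma> b z)" for a b c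
    unfolding curv_def[abs_def]
    by (subst pd_diff pd_add pd_matrix_mult; (intro D smooth_intros S sm)?)+ simp
  show ?thesis
    unfolding * curv_def
    by (simp add: matrix_distrib matrix_mul_assoc pd_commute_vec[OF S sm, of a b] pd_commute_vec[OF S sm, of a c] pd_commute_vec[OF S sm, of b c])
qed

lemma sum_antisym:
  fixes f :: "'a \<Rightarrow> 'a \<Rightarrow> real"
  assumes "\<And>x y. f x y = - f y x"
  shows "(\<Sum>x\<in>A. \<Sum>y\<in>A. f x y) = 0"
proof -
  have "(\<Sum>x\<in>A. \<Sum>y\<in>A. f x y) = (\<Sum>x\<in>A. \<Sum>y\<in>A. - f y x)"
    by (intro sum.cong refl) (rule assms)
  also have "\<dots> = - (\<Sum>x\<in>A. \<Sum>y\<in>A. f x y)" by (subst sum.swap) (simp add: sum_negf)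
  finally show ?thesis by simp
qed

lemma sum_rotate:
  "(\<Sum>a\<in>A. \<Sum>b\<in>B. \<Sum>c\<in>C. f a b c) = (\<Sum>b\<in>B. \<Sum>c\<in>C. \<Sum>a\<in>A. f a b c)"
  by (subst sum.swap, rule sum.cong[OF refl], rule sum.swap)

locale metric_connection =
  fixes S :: "(real^'m::finite) set" and G :: "real^'m \<Rightarrow> real^'n::finite^'n"
    and \<Gamma> :: "'m \<Rightarrow> real^'m \<Rightarrow> real^'n^'n"
  assumes open_S: "open S"
    and smooth_G: "smooth_on G S"
    and smooth_\<Gamma>: "smooth_on (\<Gamma> a) S"
    and sym_G: "z \<in> S \<Longrightarrow> transpose (G z) = G z"
    and det_G: "z \<in> S \<Longrightarrow> det (G z) \<noteq> 0"
    and compatible: "z \<in> S \<Longrightarrow> pd a G z = G z ** \<Gamma> a z + transpose (\<Gamma> a z) ** G z"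
begin

definition Gi where "Gi z = matrix_inv (G z)"

text \<open>The curvature with its endomorphism index raised, so that skewness becomes skewness of a matrix.\<close>

definition E where "E a b z = curv \<Gamma> a b z ** Gi z"

lemma smooth_Gi: "smooth_on Gi S"
  unfolding Gi_def[abs_def] by (intro smooth_intros open_S smooth_G det_G)

lemma smooth_E: "smooth_on (E a b) S"
  unfolding E_def[abs_def] by (intro smooth_intros open_S smooth_\<Gamma> smooth_Gi)

lemma Gi_G: "z \<in> S \<Longrightarrow> Gi z ** G z = mat 1" and G_Gi: "z \<in> S \<Longrightarrow> G z ** Gi z = mat 1"
  unfolding Gi_def using matrix_inv_left matrix_inv_right det_G by auto

lemma sym_Gi: "z \<in> S \<Longrightarrow> transpose (Gi z) = Gi z"
  unfolding Gi_def by (simp add: transpose_matrix_inv det_G sym_G)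

lemma sym_Gi_comp: "z \<in> S \<Longrightarrow> Gi z $ p $ q = Gi z $ q $ p"
  using arg_cong[OF sym_Gi, of z "\<lambda>A. A $ q $ p"] by (simp add: transpose_def)

lemma sym_G_comp: "z \<in> S \<Longrightarrow> G z $ p $ q = G z $ q $ p"
  using arg_cong[OF sym_G, of z "\<lambda>A. A $ q $ p"] by (simp add: transpose_def)

lemma diff: "smooth_on p S \<Longrightarrow> z \<in> S \<Longrightarrow> p differentiable (at z)"
  by (rule smooth_on_differentiable)

lemma pd_Gi:
  assumes z: "z \<in> S"
  shows "pd a Gi z = - (\<Gamma> a z ** Gi z) - Gi z ** transpose (\<Gamma> a z)"
proof -
  have "0 = pd a (\<lambda>z. Gi z ** G z) z"
    using pd_cong_open[OF open_S z, of "\<lambda>z. Gi z ** G z" "\<lambda>z. mat 1" a] Gi_G by simp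
  also have "\<dots> = Gi z ** (G z ** \<Gamma> a z + transpose (\<Gamma> a z) ** G z) + pd a Gi z ** G z"
    by (simp add: pd_matrix_mult diff smooth_G smooth_Gi z compatible)
  finally have "0 = (Gi z ** (G z ** \<Gamma> a z + transpose (\<Gamma> a z) ** G z) + pd a Gi z ** G z) ** Gi z"
    by (simp add: matrix_zero(1))
  also have "\<dots> = (Gi z ** G z) ** \<Gamma> a z ** Gi z + Gi z ** transpose (\<Gamma> a z) ** (G z ** Gi z) + pd a Gi z ** (G z ** Gi z)"
    by (simp only: matrix_distrib matrix_mul_assoc)
  finally have "\<Gamma> a z ** Gi z + Gi z ** transpose (\<Gamma> a z) + pd a Gi z = 0"
    by (simp add: Gi_G G_Gi z)
  moreover have "pd a Gi z = (\<Gamma> a z ** Gi z + Gi z ** transpose (\<Gamma> a z) + pd a Gi z) - \<Gamma> a z ** Gi z - Gi z ** transpose (\<Gamma> a z)"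
    by simp
  ultimately show ?thesis by (simp only: diff_0)
qed

text \<open>A connection that preserves the metric has curvature with values in the skew endomorphisms:
  this is the symmetry of the second derivatives of \<open>G\<close>.\<close>

lemma curv_skew:
  assumes z: "z \<in> S"
  shows "G z ** curv \<Gamma> a b z + transpose (curv \<Gamma> a b z) ** G z = 0"
proof -
  have *: "pd a (pd b G) z = G z ** pd a (\<Gamma> b) z + (G z ** \<Gamma> a z + transpose (\<Gamma> a z) ** G z) ** \<Gamma> b z
     + (transpose (\<Gamma> b z) ** (G z ** \<Gamma> a z + transpose (\<Gamma> a z) ** G z) + transpose (pd a (\<Gamma> b) z) ** G z)" for a b
  proof -
    have "pd a (pd b G) z = pd a (\<lambda>z. G z ** \<Gamma> b z + transpose (\<Gamma> b z) ** G z) z"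
      by (rule pd_cong_open[OF open_S z compatible])
    also have "\<dots> = G z ** pd a (\<Gamma> b) z + pd a G z ** \<Gamma> b z
     + (transpose (\<Gamma> b z) ** pd a G z + transpose (pd a (\<Gamma> b) z) ** G z)"
      by (subst pd_add pd_matrix_mult pd_transpose; (intro diff smooth_intros open_S z smooth_\<Gamma> smooth_G)?)+ simp
    finally show ?thesis by (simp add: compatible z)
  qed
  have "pd a (pd b G) z - pd b (pd a G) z = 0"
    using pd_commute_vec[OF open_S z smooth_G] by simp
  then show ?thesis
    unfolding * curv_def
    by (simp add: matrix_distrib matrix_mul_assoc transpose_linear matrix_transpose_mul algebra_simps)
qed

lemma E_skew:
  assumes z: "z \<in> S"
  shows "transpose (E a b z) = - E a b z"
proof -
  have "Gi z ** (G z ** curv \<Gamma> a b z + transpose (curv \<Gamma> a b z) ** G z) ** Gi z = 0"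
    by (simp add: curv_skew z matrix_zero)
  then have "(Gi z ** G z) ** curv \<Gamma> a b z ** Gi z + Gi z ** transpose (curv \<Gamma> a b z) ** (G z ** Gi z) = 0"
    by (simp only: matrix_distrib matrix_mul_assoc)
  then show ?thesis
    by (simp add: Gi_G G_Gi z E_def matrix_transpose_mul sym_Gi eq_neg_iff_add_eq_0 add.commute)
qed

lemma E_flip: "z \<in> S \<Longrightarrow> E a b z $ p $ q = - E a b z $ q $ p"
  using arg_cong[OF E_skew[of z a b], of "\<lambda>A. A $ q $ p"] by (simp add: transpose_def)

lemma E_swap: "E a b z $ p $ q = - E b a z $ p $ q"
  unfolding E_def by (subst curv_swap) (simp add: matrix_distrib)

text \<open>Raising the endomorphism index with the parallel metric turns the commutator in the second Bianchi
  identity into one connection term for each upper index.\<close>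

lemma raised_bianchi:
  assumes z: "z \<in> S"
  shows "(pd a (E b c) z + \<Gamma> a z ** E b c z + E b c z ** transpose (\<Gamma> a z))
    + (pd b (E c a) z + \<Gamma> b z ** E c a z + E c a z ** transpose (\<Gamma> b z))
    + (pd c (E a b) z + \<Gamma> c z ** E a b z + E a b z ** transpose (\<Gamma> c z)) = 0"
proof -
  have *: "pd a (E b c) z + \<Gamma> a z ** E b c z + E b c z ** transpose (\<Gamma> a z)
     = (pd a (curv \<Gamma> b c) z + \<Gamma> a z ** curv \<Gamma> b c z - curv \<Gamma> b c z ** \<Gamma> a z) ** Gi z" for a b c
  proof -
    have "pd a (E b c) z = curv \<Gamma> b c z ** pd a Gi z + pd a (curv \<Gamma> b c) z ** Gi z"
      unfolding E_def[abs_def]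
      by (rule pd_matrix_mult) (intro diff smooth_intros open_S z smooth_\<Gamma> smooth_Gi)+
    then show ?thesis by (simp add: pd_Gi z E_def matrix_distrib matrix_mul_assoc)
  qed
  show ?thesis
    using arg_cong[OF second_bianchi[OF open_S z smooth_\<Gamma>, where a=a and b=b and c=c], of "\<lambda>A. A ** Gi z"]
    unfolding * by (simp only: matrix_distrib(1) matrix_zero(1))
qed

lemma raised_bianchi_comp:
  assumes z: "z \<in> S"
  shows "(pd a (E b c) z $ p $ q + (\<Sum>m\<in>UNIV. \<Gamma> a z $ p $ m * E b c z $ m $ q) + (\<Sum>m\<in>UNIV. E b c z $ p $ m * \<Gamma> a z $ q $ m))
    + (pd b (E c a) z $ p $ q + (\<Sum>m\<in>UNIV. \<Gamma> b z $ p $ m * E c a z $ m $ q) + (\<Sum>m\<in>UNIV. E c a z $ p $ m * \<Gamma> b z $ q $ m))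
    + (pd c (E a b) z $ p $ q + (\<Sum>m\<in>UNIV. \<Gamma> c z $ p $ m * E a b z $ m $ q) + (\<Sum>m\<in>UNIV. E a b z $ p $ m * \<Gamma> c z $ q $ m)) = 0"
  using arg_cong[OF raised_bianchi[OF z, of a b c], of "\<lambda>A. A $ p $ q"]
  by (simp add: matrix_matrix_mult_def transpose_def)

text \<open>The raised identity with arbitrary choices of directions for each pair of upper indices, summed over these
  pairs and split into its nine terms; the two contractions that are needed are instances.\<close>

lemma summed_bianchi:
  assumes z: "z \<in> S"
  shows "(\<Sum>p\<in>UNIV. \<Sum>q\<in>UNIV. pd (\<alpha> p q) (E (\<beta> p q) (\<delta> p q)) z $ p $ q)
    + (\<Sum>p\<in>UNIV. \<Sum>q\<in>UNIV. \<Sum>m\<in>UNIV. \<Gamma> (\<alpha> p q) z $ p $ m * E (\<beta> p q) (\<delta> p q) z $ m $ q)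
    + (\<Sum>p\<in>UNIV. \<Sum>q\<in>UNIV. \<Sum>m\<in>UNIV. E (\<beta> p q) (\<delta> p q) z $ p $ m * \<Gamma> (\<alpha> p q) z $ q $ m)
    + ((\<Sum>p\<in>UNIV. \<Sum>q\<in>UNIV. pd (\<beta> p q) (E (\<delta> p q) (\<alpha> p q)) z $ p $ q)
    + (\<Sum>p\<in>UNIV. \<Sum>q\<in>UNIV. \<Sum>m\<in>UNIV. \<Gamma> (\<beta> p q) z $ p $ m * E (\<delta> p q) (\<alpha> p q) z $ m $ q)
    + (\<Sum>p\<in>UNIV. \<Sum>q\<in>UNIV. \<Sum>m\<in>UNIV. E (\<delta> p q) (\<alpha> p q) z $ p $ m * \<Gamma> (\<beta> p q) z $ q $ m))
    + ((\<Sum>p\<in>UNIV. \<Sum>q\<in>UNIV. pd (\<delta> p q) (E (\<alpha> p q) (\<beta> p q)) z $ p $ q)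
    + (\<Sum>p\<in>UNIV. \<Sum>q\<in>UNIV. \<Sum>m\<in>UNIV. \<Gamma> (\<delta> p q) z $ p $ m * E (\<alpha> p q) (\<beta> p q) z $ m $ q)
    + (\<Sum>p\<in>UNIV. \<Sum>q\<in>UNIV. \<Sum>m\<in>UNIV. E (\<alpha> p q) (\<beta> p q) z $ p $ m * \<Gamma> (\<delta> p q) z $ q $ m)) = 0"
proof -
  define t where "t a b c p q = pd a (E b c) z $ p $ q + (\<Sum>m\<in>UNIV. \<Gamma> a z $ p $ m * E b c z $ m $ q) + (\<Sum>m\<in>UNIV. E b c z $ p $ m * \<Gamma> a z $ q $ m)" for a b c p q
  have "t a b c p q + t b c a p q + t c a b p q = 0" for a b c p q
    unfolding t_def by (rule raised_bianchi_comp[OF z])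
  then have "(\<Sum>p\<in>UNIV. \<Sum>q\<in>UNIV. t (\<alpha> p q) (\<beta> p q) (\<delta> p q) p q + t (\<beta> p q) (\<delta> p q) (\<alpha> p q) p q + t (\<delta> p q) (\<alpha> p q) (\<beta> p q) p q) = 0"
    by simp
  then show ?thesis unfolding t_def by (simp only: sum.distrib)
qed

end

text \<open>The tangent bundle of the space slices, pulled back to space-time: the base has the coordinates of
  the slices and the time coordinate \<open>None\<close>, and the torsion condition concerns the spatial directions.\<close>

locale flow_connection = metric_connection S G \<Gamma>
  for S :: "(real^('n::finite option)) set" and G :: "real^('n option) \<Rightarrow> real^'n^'n" and \<Gamma> +
  assumes torsion_free: "z \<in> S \<Longrightarrow> \<Gamma> (Some a) z $ p $ b = \<Gamma> (Some b) z $ p $ a"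
begin

text \<open>\<open>rr b p\<close> is \<open>Ric\<^sub>b\<^sup>p\<close>, and \<open>Rs\<close> is the scalar curvature.\<close>

definition rr where "rr b p z = (\<Sum>a\<in>UNIV. E (Some a) (Some b) z $ a $ p)"

definition Rs where "Rs z = (\<Sum>b\<in>UNIV. rr b b z)"

lemma smooth_rr: "smooth_on (rr b p) S"
  unfolding rr_def[abs_def] by (intro smooth_intros open_S smooth_E) simp

lemma smooth_Rs: "smooth_on Rs S"
  unfolding Rs_def[abs_def] by (intro smooth_intros open_S smooth_rr) simp

lemma rr_alt: "z \<in> S \<Longrightarrow> rr b p z = (\<Sum>c\<in>UNIV. E (Some b) (Some c) z $ p $ c)"
  unfolding rr_def by (rule sum.cong[OF refl], subst E_flip, assumption, subst E_swap, simp)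

lemma sum_pd_E:
  fixes p :: "'n \<Rightarrow> 'n"
  assumes z: "z \<in> S" and "\<And>z. z \<in> S \<Longrightarrow> f z = (\<Sum>a\<in>UNIV. E (\<alpha> a) (\<beta> a) z $ p a $ q a)"
  shows "(\<Sum>a\<in>UNIV. pd k (E (\<alpha> a) (\<beta> a)) z $ p a $ q a) = pd k f z"
proof -
  have "pd k f z = pd k (\<lambda>z. \<Sum>a\<in>UNIV. E (\<alpha> a) (\<beta> a) z $ p a $ q a) z"
    by (rule pd_cong_open[OF open_S z assms(2)])
  also have "\<dots> = (\<Sum>a\<in>UNIV. pd k (\<lambda>z. E (\<alpha> a) (\<beta> a) z $ p a $ q a) z)"
    by (rule pd_sum) (auto intro!: diff[OF _ z] smooth_intros open_S smooth_E)
  finally show ?thesis using pd_vec_nth2[OF diff[OF smooth_E z]] by simp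
qed

text \<open>\<open>2 div Ric = dR\<close>: the raised second Bianchi identity, contracted in two pairs of indices. The two
  connection terms that are no part of the divergence vanish because they contract a skew pair of indices with the symmetric
  lower indices of \<open>\<Gamma>\<close>.\<close>

theorem contracted_bianchi:
  assumes z: "z \<in> S"
  shows "2 * ((\<Sum>a\<in>UNIV. pd (Some a) (rr b a) z) + (\<Sum>a\<in>UNIV. \<Sum>m\<in>UNIV. \<Gamma> (Some a) z $ a $ m * rr b m z)
     - (\<Sum>c\<in>UNIV. \<Sum>m\<in>UNIV. \<Gamma> (Some b) z $ c $ m * rr c m z)) = pd (Some b) Rs z"
proof -
  let ?B = "Some b"
  note * = summed_bianchi[OF z, of "\<lambda>a c. Some a" "\<lambda>a c. ?B" "\<lambda>a c. Some c"]
  have 1: "(\<Sum>a\<in>UNIV. \<Sum>c\<in>UNIV. pd (Some a) (E ?B (Some c)) z $ a $ c) = (\<Sum>a\<in>UNIV. pd (Some a) (rr b a) z)"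
    by (rule sum.cong[OF refl], rule sum_pd_E[OF z]) (rule rr_alt)
  have 2: "(\<Sum>a\<in>UNIV. \<Sum>c\<in>UNIV. \<Sum>m\<in>UNIV. \<Gamma> (Some a) z $ a $ m * E ?B (Some c) z $ m $ c) = (\<Sum>a\<in>UNIV. \<Sum>m\<in>UNIV. \<Gamma> (Some a) z $ a $ m * rr b m z)"
    by (rule sum.cong[OF refl], subst sum.swap) (simp add: rr_alt[OF z] sum_distrib_left)
  have 3: "(\<Sum>a\<in>UNIV. \<Sum>c\<in>UNIV. \<Sum>m\<in>UNIV. E ?B (Some c) z $ a $ m * \<Gamma> (Some a) z $ c $ m) = 0"
    by (subst sum.swap, rule sum.neutral, rule ballI, rule sum_antisym) (subst E_flip[OF z], subst torsion_free[OF z], simp)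
  have 4: "(\<Sum>a\<in>UNIV. \<Sum>c\<in>UNIV. pd ?B (E (Some c) (Some a)) z $ a $ c) = - pd ?B Rs z"
  proof -
    have "(\<Sum>a\<in>UNIV. \<Sum>c\<in>UNIV. pd ?B (E (Some c) (Some a)) z $ a $ c) = (\<Sum>a\<in>UNIV. pd ?B (\<lambda>z. - rr a a z) z)"
      by (rule sum.cong[OF refl], rule sum_pd_E[OF z])
        (subst rr_alt, assumption, subst sum_negf[symmetric], rule sum.cong[OF refl], rule E_swap[symmetric])
    also have "\<dots> = - pd ?B Rs z"
      unfolding Rs_def[abs_def] by (simp add: pd_minus pd_sum diff[OF smooth_rr z] sum_negf)
    finally show ?thesis .
  qed
  have 5: "(\<Sum>a\<in>UNIV. \<Sum>c\<in>UNIV. \<Sum>m\<in>UNIV. \<Gamma> ?B z $ a $ m * E (Some c) (Some a) z $ m $ c) = - (\<Sum>c\<in>UNIV. \<Sum>m\<in>UNIV. \<Gamma> ?B z $ c $ m * rr c m z)"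
    by (subst sum_negf[symmetric], rule sum.cong[OF refl], subst sum.swap, subst E_swap)
      (simp add: rr_alt[OF z] sum_distrib_left sum_negf)
  have 6: "(\<Sum>a\<in>UNIV. \<Sum>c\<in>UNIV. \<Sum>m\<in>UNIV. E (Some c) (Some a) z $ a $ m * \<Gamma> ?B z $ c $ m) = - (\<Sum>c\<in>UNIV. \<Sum>m\<in>UNIV. \<Gamma> ?B z $ c $ m * rr c m z)"
    by (subst sum.swap, subst sum_negf[symmetric], rule sum.cong[OF refl], subst sum.swap, subst E_swap)
      (simp add: rr_def sum_distrib_left sum_negf mult.commute)
  have 7: "(\<Sum>a\<in>UNIV. \<Sum>c\<in>UNIV. pd (Some c) (E (Some a) ?B) z $ a $ c) = (\<Sum>a\<in>UNIV. pd (Some a) (rr b a) z)"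
    by (subst sum.swap, rule sum.cong[OF refl], rule sum_pd_E[OF z]) (rule rr_def)
  have 8: "(\<Sum>a\<in>UNIV. \<Sum>c\<in>UNIV. \<Sum>m\<in>UNIV. \<Gamma> (Some c) z $ a $ m * E (Some a) ?B z $ m $ c) = 0"
    by (rule sum.neutral, rule ballI, rule sum_antisym) (subst E_flip[OF z], subst torsion_free[OF z], simp)
  have 9: "(\<Sum>a\<in>UNIV. \<Sum>c\<in>UNIV. \<Sum>m\<in>UNIV. E (Some a) ?B z $ a $ m * \<Gamma> (Some c) z $ c $ m) = (\<Sum>a\<in>UNIV. \<Sum>m\<in>UNIV. \<Gamma> (Some a) z $ a $ m * rr b m z)"
    by (subst sum.swap, rule sum.cong[OF refl], subst sum.swap)
      (simp add: rr_def sum_distrib_left mult.commute)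
  show ?thesis using * unfolding 1 2 3 4 5 6 7 8 9 by (simp add: algebra_simps)
qed

end

text \<open>Under the flow \<open>\<partial>\<^sub>\<tau> g = 2 Ric\<close> the endomorphism \<open>Ric\<close> is a choice of \<open>\<Gamma>\<close> in the time direction that
  makes the metric parallel in time as well. The Bianchi identity with one time direction then governs the evolution of the curvature.\<close>

locale ricci_flow_connection = flow_connection +
  assumes flow: "z \<in> S \<Longrightarrow> \<Gamma> None z $ p $ b = rr b p z"
    and sym_Ric: "z \<in> S \<Longrightarrow> transpose (G z ** \<Gamma> None z) = G z ** \<Gamma> None z"
begin

text \<open>The covariant derivative \<open>\<nabla>\<^sub>a Ric\<close> with both indices of \<open>Ric\<close> raised.\<close>

definition P where "P a z = (pd a (\<Gamma> None) z + \<Gamma> a z ** \<Gamma> None z - \<Gamma> None z ** \<Gamma> a z) ** Gi z"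

lemma sym_raised_Ric:
  assumes z: "z \<in> S"
  shows "transpose (\<Gamma> None z ** Gi z) = \<Gamma> None z ** Gi z"
proof -
  have "\<Gamma> None z ** Gi z = Gi z ** (G z ** \<Gamma> None z) ** Gi z"
    by (simp add: matrix_mul_assoc Gi_G z)
  then show ?thesis
    by (simp add: matrix_transpose_mul sym_Ric sym_Gi z matrix_mul_assoc)
       (metis matrix_mul_assoc matrix_transpose_mul sym_G sym_Ric z)
qed

lemma P_sym:
  assumes z: "z \<in> S"
  shows "P a z $ p $ q = P a z $ q $ p"
proof -
  let ?B = "\<lambda>z. \<Gamma> None z ** Gi z"
  have sB: "smooth_on ?B S" by (intro smooth_intros open_S smooth_\<Gamma> smooth_Gi)
  have "pd a ?B z = \<Gamma> None z ** pd a Gi z + pd a (\<Gamma> None) z ** Gi z"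
    by (rule pd_matrix_mult) (intro diff smooth_\<Gamma> smooth_Gi z)+
  then have P: "P a z = pd a ?B z + \<Gamma> a z ** ?B z + ?B z ** transpose (\<Gamma> a z)"
    by (simp add: P_def pd_Gi z matrix_distrib matrix_mul_assoc)
  have "transpose (pd a ?B z) = pd a (\<lambda>z. transpose (?B z)) z"
    by (rule pd_transpose[symmetric]) (rule diff[OF sB z])
  also have "\<dots> = pd a ?B z"
    by (rule pd_cong_open[OF open_S z sym_raised_Ric])
  finally have "transpose (P a z) = P a z"
    unfolding P by (simp add: transpose_linear matrix_transpose_mul[of _ "?B z"] matrix_transpose_mul[of "?B z"] sym_raised_Ric[OF z] add_ac)
  from arg_cong[OF this, of "\<lambda>A. A $ q $ p"] show ?thesis by (simp add: transpose_def)
qed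

lemma E_None_plus_P:
  assumes z: "z \<in> S"
  shows "E None a z $ b $ q + P a z $ b $ q = (\<Sum>m\<in>UNIV. pd None (\<Gamma> a) z $ b $ m * Gi z $ m $ q)"
proof -
  have "E None a z + P a z = pd None (\<Gamma> a) z ** Gi z"
    by (simp add: E_def P_def curv_def matrix_distrib)
  from arg_cong[OF this, of "\<lambda>A. A $ b $ q"] show ?thesis by (simp add: matrix_matrix_mult_def)
qed

lemma pd_None_torsion_free:
  assumes z: "z \<in> S"
  shows "pd None (\<Gamma> (Some a)) z $ p $ b = pd None (\<Gamma> (Some b)) z $ p $ a"
proof -
  have "pd None (\<lambda>z. \<Gamma> (Some a) z $ p $ b) z = pd None (\<lambda>z. \<Gamma> (Some b) z $ p $ a) z"
    by (rule pd_cong_open[OF open_S z torsion_free])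
  then show ?thesis by (simp add: pd_vec_nth2 diff[OF smooth_\<Gamma> z])
qed

text \<open>This amounts to the formula \<open>\<nabla>\<^sub>a Ric\<^sup>b\<^sub>c + \<nabla>\<^sub>c Ric\<^sup>b\<^sub>a - \<nabla>\<^sup>b Ric\<^sub>a\<^sub>c\<close> for the time derivative of the
  Levi-Civita connection. The proof is Koszul's argument: the sum of \<open>E None\<close> and \<open>P\<close> is symmetric in its
  lower indices, \<open>P\<close> is symmetric in the upper ones, and \<open>E None\<close> is skew in them.\<close>

lemma mixed_curvature:
  assumes z: "z \<in> S"
  shows "(\<Sum>c\<in>UNIV. Gi z $ p $ c * E None (Some c) z $ b $ q)
     = (\<Sum>c\<in>UNIV. Gi z $ q $ c * P (Some c) z $ b $ p) - (\<Sum>c\<in>UNIV. Gi z $ b $ c * P (Some c) z $ p $ q)"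
proof -
  let ?E = "\<lambda>p b q. \<Sum>c\<in>UNIV. Gi z $ p $ c * E None (Some c) z $ b $ q"
  let ?P = "\<lambda>p b q. \<Sum>c\<in>UNIV. Gi z $ p $ c * P (Some c) z $ b $ q"
  let ?T = "\<lambda>p b q. \<Sum>c\<in>UNIV. \<Sum>m\<in>UNIV. Gi z $ p $ c * (pd None (\<Gamma> (Some c)) z $ b $ m * Gi z $ m $ q)"
  have sym: "Gi z $ i $ j = Gi z $ j $ i" for i j
    by (rule sym_Gi_comp[OF z])
  have T: "?T p b q = ?E p b q + ?P p b q" for p b q
    by (simp add: sum.distrib[symmetric] distrib_left[symmetric] E_None_plus_P[OF z] sum_distrib_left)
  have Tsym: "?T p b q = ?T q b p" for p b q
    by (subst sum.swap, intro sum.cong refl, subst pd_None_torsion_free[OF z], subst sym[of _ q], subst sym[of p]) (simp add: mult_ac)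
  have Esk: "?E p b q = - ?E p q b" for p b q
    unfolding sum_negf[symmetric] by (intro sum.cong refl, subst E_flip[OF z]) simp
  have Psy: "?P p b q = ?P p q b" for p b q
    by (intro sum.cong refl, subst P_sym[OF z]) simp
  show ?thesis
    using T[of p b q] T[of p q b] T[of q b p] T[of q p b] T[of b p q] T[of b q p]
      Tsym[of p b q] Tsym[of q p b] Tsym[of b p q] Tsym[of p q b] Tsym[of b q p] Tsym[of q b p]
      Esk[of p b q] Esk[of q p b] Esk[of b p q] Psy[of p b q] Psy[of q p b] Psy[of b p q]
    by linarith
qed

text \<open>A contraction of the mixed curvature, which turns out to be half the gradient of \<open>Rs\<close>.\<close>

definition Y where "Y b z = (\<Sum>c\<in>UNIV. E (Some c) None z $ b $ c)"

lemma pd_flow: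
  assumes z: "z \<in> S"
  shows "pd k (\<Gamma> None) z $ p $ q = pd k (rr q p) z"
proof -
  have "pd k (\<lambda>z. \<Gamma> None z $ p $ q) z = pd k (rr q p) z"
    by (rule pd_cong_open[OF open_S z]) (rule flow)
  then show ?thesis by (simp add: pd_vec_nth2 diff[OF smooth_\<Gamma> z])
qed

text \<open>The contracted Bianchi identity, in terms of \<open>P\<close>.\<close>

lemma sum_P_diag:
  assumes z: "z \<in> S"
  shows "(\<Sum>p\<in>UNIV. P (Some p) z $ b $ p) = (\<Sum>q\<in>UNIV. Gi z $ b $ q * (pd (Some q) Rs z / 2))"
proof -
  let ?D = "\<lambda>p. pd (Some p) (\<Gamma> None) z + \<Gamma> (Some p) z ** \<Gamma> None z - \<Gamma> None z ** \<Gamma> (Some p) z"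
  have *: "(\<Sum>p\<in>UNIV. ?D p $ p $ q) = pd (Some q) Rs z / 2" for q
  proof -
    have "(\<Sum>p\<in>UNIV. ?D p $ p $ q) = (\<Sum>p\<in>UNIV. pd (Some p) (rr q p) z) + (\<Sum>p\<in>UNIV. \<Sum>m\<in>UNIV. \<Gamma> (Some p) z $ p $ m * rr q m z)
       - (\<Sum>p\<in>UNIV. \<Sum>m\<in>UNIV. rr m p z * \<Gamma> (Some p) z $ m $ q)"
      by (simp add: matrix_matrix_mult_def sum.distrib sum_subtractf pd_flow flow z)
    also have "(\<Sum>p\<in>UNIV. \<Sum>m\<in>UNIV. rr m p z * \<Gamma> (Some p) z $ m $ q) = (\<Sum>c\<in>UNIV. \<Sum>m\<in>UNIV. \<Gamma> (Some q) z $ c $ m * rr c m z)"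
      by (subst sum.swap, intro sum.cong refl, subst torsion_free[OF z]) simp
    finally show ?thesis using contracted_bianchi[OF z, of q] by simp
  qed
  have "(\<Sum>p\<in>UNIV. P (Some p) z $ b $ p) = (\<Sum>p\<in>UNIV. P (Some p) z $ p $ b)"
    by (intro sum.cong refl P_sym z)
  also have "\<dots> = (\<Sum>p\<in>UNIV. \<Sum>q\<in>UNIV. ?D p $ p $ q * Gi z $ q $ b)"
    unfolding P_def matrix_matrix_mult_def[of _ "Gi z"] by simp
  also have "\<dots> = (\<Sum>q\<in>UNIV. (\<Sum>p\<in>UNIV. ?D p $ p $ q) * Gi z $ q $ b)"
    by (subst sum.swap) (simp only: sum_distrib_right)
  also have "\<dots> = (\<Sum>q\<in>UNIV. Gi z $ b $ q * (pd (Some q) Rs z / 2))"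
    unfolding * by (intro sum.cong refl, subst sym_Gi_comp[OF z]) simp
  finally show ?thesis .
qed

lemma trace_P:
  assumes z: "z \<in> S"
  shows "(\<Sum>c\<in>UNIV. \<Sum>p\<in>UNIV. G z $ c $ p * P k z $ p $ c) = pd k Rs z"
proof -
  have "(\<Sum>c\<in>UNIV. \<Sum>p\<in>UNIV. G z $ c $ p * P k z $ p $ c) = trace (G z ** P k z)"
    by (simp add: trace_def matrix_matrix_mult_def)
  also have "\<dots> = trace (P k z ** G z)" by (rule trace_mul_sym)
  also have "P k z ** G z = pd k (\<Gamma> None) z + \<Gamma> k z ** \<Gamma> None z - \<Gamma> None z ** \<Gamma> k z"
    by (simp add: P_def matrix_mul_assoc[symmetric] Gi_G z)
  also have "trace \<dots> = trace (pd k (\<Gamma> None) z)"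
    by (simp add: trace_add trace_sub trace_mul_sym[of "\<Gamma> k z"])
  also have "\<dots> = (\<Sum>b\<in>UNIV. pd k (rr b b) z)"
    unfolding trace_def by (simp add: pd_flow z)
  also have "\<dots> = pd k Rs z"
    unfolding Rs_def[abs_def] by (rule pd_sum[symmetric]) (auto intro: diff[OF smooth_rr z])
  finally show ?thesis .
qed

lemma Y_eq:
  assumes z: "z \<in> S"
  shows "Y b z = (\<Sum>q\<in>UNIV. Gi z $ b $ q * pd (Some q) Rs z) / 2"
proof -
  let ?E = "\<lambda>p b q. \<Sum>c\<in>UNIV. Gi z $ p $ c * E None (Some c) z $ b $ q"
  have mulG: "(\<Sum>p\<in>UNIV. G z $ c $ p * (\<Sum>k\<in>UNIV. Gi z $ p $ k * f k)) = f c" for f c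
  proof -
    have "(\<Sum>p\<in>UNIV. G z $ c $ p * (\<Sum>k\<in>UNIV. Gi z $ p $ k * f k)) = (\<Sum>k\<in>UNIV. (G z ** Gi z) $ c $ k * f k)"
      by (simp add: matrix_matrix_mult_def sum_distrib_left sum_distrib_right mult.assoc) (rule sum.swap)
    then show ?thesis by (simp add: G_Gi z mat_def if_distrib[of "\<lambda>x. x * _"] cong: if_cong)
  qed
  have "Y b z = - (\<Sum>c\<in>UNIV. E None (Some c) z $ b $ c)"
    unfolding Y_def by (subst E_swap) (simp add: sum_negf)
  also have "\<dots> = - (\<Sum>c\<in>UNIV. \<Sum>p\<in>UNIV. G z $ c $ p * ?E p b c)"
    by (simp only: mulG)
  also have "\<dots> = (\<Sum>c\<in>UNIV. \<Sum>p\<in>UNIV. G z $ c $ p * (\<Sum>k\<in>UNIV. Gi z $ b $ k * P (Some k) z $ p $ c))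
     - (\<Sum>c\<in>UNIV. \<Sum>p\<in>UNIV. G z $ c $ p * (\<Sum>k\<in>UNIV. Gi z $ c $ k * P (Some k) z $ b $ p))"
    by (simp add: mixed_curvature[OF z] right_diff_distrib sum_subtractf)
  also have "(\<Sum>c\<in>UNIV. \<Sum>p\<in>UNIV. G z $ c $ p * (\<Sum>k\<in>UNIV. Gi z $ c $ k * P (Some k) z $ b $ p))
     = (\<Sum>p\<in>UNIV. \<Sum>c\<in>UNIV. G z $ p $ c * (\<Sum>k\<in>UNIV. Gi z $ c $ k * P (Some k) z $ b $ p))"
    by (subst sum.swap, intro sum.cong refl, subst sym_G_comp[OF z]) simp
  also have "\<dots> = (\<Sum>p\<in>UNIV. P (Some p) z $ b $ p)"
    by (simp only: mulG)
  also have "(\<Sum>c\<in>UNIV. \<Sum>p\<in>UNIV. G z $ c $ p * (\<Sum>k\<in>UNIV. Gi z $ b $ k * P (Some k) z $ p $ c))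
     = (\<Sum>k\<in>UNIV. Gi z $ b $ k * (\<Sum>c\<in>UNIV. \<Sum>p\<in>UNIV. G z $ c $ p * P (Some k) z $ p $ c))"
  proof -
    have "(\<Sum>c\<in>UNIV. \<Sum>p\<in>UNIV. G z $ c $ p * (\<Sum>k\<in>UNIV. Gi z $ b $ k * P (Some k) z $ p $ c))
       = (\<Sum>k\<in>UNIV. \<Sum>c\<in>UNIV. \<Sum>p\<in>UNIV. G z $ c $ p * (Gi z $ b $ k * P (Some k) z $ p $ c))"
      unfolding sum_distrib_left by (rule sum_rotate[symmetric])
    then show ?thesis by (simp add: sum_distrib_left mult.left_commute)
  qed
  also have "\<dots> = (\<Sum>k\<in>UNIV. Gi z $ b $ k * pd (Some k) Rs z)"
    by (simp only: trace_P[OF z])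
  finally show ?thesis
    by (simp add: sum_P_diag[OF z] sum_subtractf[symmetric] sum_divide_distrib)
qed

text \<open>\<open>\<partial>\<^sub>\<tau> R = - 2 |Ric|\<^sup>2 - \<Delta> R\<close>, as \<open>Y\<close> is half the gradient. It is the contraction that gives \<open>2 div Ric = dR\<close>,
  now with time in place of the free spatial direction.\<close>

theorem evolution_scalar_curvature:
  assumes z: "z \<in> S"
  shows "pd None Rs z = - 2 * (\<Sum>b\<in>UNIV. \<Sum>m\<in>UNIV. rr m b z * rr b m z)
     - 2 * ((\<Sum>b\<in>UNIV. pd (Some b) (Y b) z) + (\<Sum>b\<in>UNIV. \<Sum>m\<in>UNIV. \<Gamma> (Some b) z $ b $ m * Y m z))"
proof -
  note * = summed_bianchi[OF z, of "\<lambda>b c. None" "\<lambda>b c. Some b" "\<lambda>b c. Some c"]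
  have 1: "(\<Sum>b\<in>UNIV. \<Sum>c\<in>UNIV. pd None (E (Some b) (Some c)) z $ b $ c) = pd None Rs z"
  proof -
    have "(\<Sum>b\<in>UNIV. \<Sum>c\<in>UNIV. pd None (E (Some b) (Some c)) z $ b $ c) = (\<Sum>b\<in>UNIV. pd None (rr b b) z)"
      by (rule sum.cong[OF refl], rule sum_pd_E[OF z]) (rule rr_alt)
    also have "\<dots> = pd None Rs z"
      unfolding Rs_def[abs_def] by (rule pd_sum[symmetric]) (auto intro: diff[OF smooth_rr z])
    finally show ?thesis .
  qed
  have 2: "(\<Sum>b\<in>UNIV. \<Sum>c\<in>UNIV. \<Sum>m\<in>UNIV. \<Gamma> None z $ b $ m * E (Some b) (Some c) z $ m $ c) = (\<Sum>b\<in>UNIV. \<Sum>m\<in>UNIV. rr m b z * rr b m z)"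
    by (rule sum.cong[OF refl], subst sum.swap) (simp add: rr_alt[OF z] flow[OF z] sum_distrib_left)
  have 3: "(\<Sum>b\<in>UNIV. \<Sum>c\<in>UNIV. \<Sum>m\<in>UNIV. E (Some b) (Some c) z $ b $ m * \<Gamma> None z $ c $ m) = (\<Sum>b\<in>UNIV. \<Sum>m\<in>UNIV. rr m b z * rr b m z)"
  proof -
    have "(\<Sum>b\<in>UNIV. \<Sum>c\<in>UNIV. \<Sum>m\<in>UNIV. E (Some b) (Some c) z $ b $ m * \<Gamma> None z $ c $ m)
       = (\<Sum>c\<in>UNIV. \<Sum>m\<in>UNIV. \<Sum>b\<in>UNIV. E (Some b) (Some c) z $ b $ m * \<Gamma> None z $ c $ m)"
      by (rule sum_rotate)
    also have "\<dots> = (\<Sum>b\<in>UNIV. \<Sum>m\<in>UNIV. rr m b z * rr b m z)"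
      unfolding sum_distrib_right[symmetric] rr_def[of _ _ z, symmetric] flow[OF z]
      by (intro sum.cong refl) (rule mult.commute)
    finally show ?thesis .
  qed
  have 4: "(\<Sum>b\<in>UNIV. \<Sum>c\<in>UNIV. pd (Some b) (E (Some c) None) z $ b $ c) = (\<Sum>b\<in>UNIV. pd (Some b) (Y b) z)"
    by (rule sum.cong[OF refl], rule sum_pd_E[OF z]) (rule Y_def)
  have 5: "(\<Sum>b\<in>UNIV. \<Sum>c\<in>UNIV. \<Sum>m\<in>UNIV. \<Gamma> (Some b) z $ b $ m * E (Some c) None z $ m $ c) = (\<Sum>b\<in>UNIV. \<Sum>m\<in>UNIV. \<Gamma> (Some b) z $ b $ m * Y m z)"
    by (rule sum.cong[OF refl], subst sum.swap) (simp add: Y_def sum_distrib_left)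
  have 6: "(\<Sum>b\<in>UNIV. \<Sum>c\<in>UNIV. \<Sum>m\<in>UNIV. E (Some c) None z $ b $ m * \<Gamma> (Some b) z $ c $ m) = 0"
    by (subst sum.swap, rule sum.neutral, rule ballI, rule sum_antisym) (subst E_flip[OF z], subst torsion_free[OF z], simp)
  have 7: "(\<Sum>b\<in>UNIV. \<Sum>c\<in>UNIV. pd (Some c) (E None (Some b)) z $ b $ c) = (\<Sum>b\<in>UNIV. pd (Some b) (Y b) z)"
    by (subst sum.swap, rule sum.cong[OF refl], rule sum_pd_E[OF z], unfold Y_def, rule sum.cong[OF refl], subst E_flip, assumption, subst E_swap, simp)
  have 8: "(\<Sum>b\<in>UNIV. \<Sum>c\<in>UNIV. \<Sum>m\<in>UNIV. \<Gamma> (Some c) z $ b $ m * E None (Some b) z $ m $ c) = 0"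
    by (rule sum.neutral, rule ballI, rule sum_antisym) (subst E_flip[OF z], subst torsion_free[OF z], simp)
  have 9: "(\<Sum>b\<in>UNIV. \<Sum>c\<in>UNIV. \<Sum>m\<in>UNIV. E None (Some b) z $ b $ m * \<Gamma> (Some c) z $ c $ m) = (\<Sum>b\<in>UNIV. \<Sum>m\<in>UNIV. \<Gamma> (Some b) z $ b $ m * Y m z)"
  proof -
    have flip: "E None (Some b) z $ b $ m = E (Some b) None z $ m $ b" for b m
      by (subst E_flip[OF z], subst E_swap) simp
    have "(\<Sum>b\<in>UNIV. \<Sum>c\<in>UNIV. \<Sum>m\<in>UNIV. E None (Some b) z $ b $ m * \<Gamma> (Some c) z $ c $ m)
       = (\<Sum>c\<in>UNIV. \<Sum>m\<in>UNIV. \<Sum>b\<in>UNIV. E None (Some b) z $ b $ m * \<Gamma> (Some c) z $ c $ m)"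
      by (rule sum_rotate)
    also have "\<dots> = (\<Sum>b\<in>UNIV. \<Sum>m\<in>UNIV. \<Gamma> (Some b) z $ b $ m * Y m z)"
      unfolding flip sum_distrib_right[symmetric] Y_def[of _ z, symmetric]
      by (intro sum.cong refl) (rule mult.commute)
    finally show ?thesis .
  qed
  show ?thesis using * unfolding 1 2 3 4 5 6 7 8 9 by (simp add: algebra_simps)
qed

end

section \<open>The Levi-Civita connection in coordinates\<close>

text \<open>The Christoffel symbols as a connection matrix for each direction, as required by \<^const>\<open>curv\<close>.\<close>

definition lc :: "(real^'m \<Rightarrow> real^'m^'m::finite) \<Rightarrow> 'm \<Rightarrow> real^'m \<Rightarrow> real^'m^'m" where
  "lc G a y = (\<chi> p q. christoffel G p a q y)"

text \<open>The Christoffel symbols of the first kind.\<close>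

definition koszul :: "(real^'m \<Rightarrow> real^'m^'m::finite) \<Rightarrow> 'm \<Rightarrow> real^'m \<Rightarrow> real^'m^'m" where
  "koszul G a y = (\<chi> m b. (pd a G y $ b $ m + pd b G y $ a $ m - pd m G y $ a $ b) / 2)"

lemma lc_eq_koszul:
  assumes "G differentiable (at y)"
  shows "lc G a y = matrix_inv (G y) ** koszul G a y"
  by (simp add: lc_def koszul_def christoffel_def matrix_matrix_mult_def vec_eq_iff pderiv_at_eq_pd
      pd_vec_nth2[OF assms] sum_divide_distrib)

lemma smooth_on_lc [smooth_intros]:
  assumes S: "open S" and G: "smooth_on G S" and "\<And>y. y \<in> S \<Longrightarrow> det (G y) \<noteq> 0"
  shows "smooth_on (lc G a) S"
  unfolding lc_def[abs_def] christoffel_def pderiv_at_eq_pd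
  by (intro smooth_intros S finite_class.finite_UNIV G assms(3)) auto

lemma pd_transpose_sym:
  fixes G :: "real^'m::finite \<Rightarrow> real^'n::finite^'n"
  assumes S: "open S" "y \<in> S" and G: "smooth_on G S" and sym: "\<And>y. y \<in> S \<Longrightarrow> transpose (G y) = G y"
  shows "pd a G y $ p $ q = pd a G y $ q $ p"
proof -
  have "transpose (pd a G y) = pd a (\<lambda>y. transpose (G y)) y"
    by (rule pd_transpose[symmetric]) (rule smooth_on_differentiable[OF G S(2)])
  also have "\<dots> = pd a G y"
    by (rule pd_cong_open[OF S sym])
  finally have "transpose (pd a G y) = pd a G y" .
  from arg_cong[OF this, of "\<lambda>A. A $ q $ p"] show ?thesis by (simp add: transpose_def)
qed

locale metric_chart =
  fixes S :: "(real^'m::finite) set" and G :: "real^'m \<Rightarrow> real^'m^'m"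
  assumes open_S: "open S"
    and smooth_G: "smooth_on G S"
    and sym_G: "y \<in> S \<Longrightarrow> transpose (G y) = G y"
    and det_G: "y \<in> S \<Longrightarrow> det (G y) \<noteq> 0"
begin

lemma smooth_lc: "smooth_on (lc G a) S"
  by (intro smooth_on_lc open_S smooth_G det_G)

lemma G_lc: "y \<in> S \<Longrightarrow> G y ** lc G a y = koszul G a y"
  by (simp add: lc_eq_koszul smooth_on_differentiable[OF smooth_G] matrix_mul_assoc matrix_inv_right det_G)

lemma pd_G_sym: "y \<in> S \<Longrightarrow> pd a G y $ p $ q = pd a G y $ q $ p"
  by (rule pd_transpose_sym[OF open_S _ smooth_G sym_G])

text \<open>Used to identify Christoffel symbols without inverting a metric: it suffices to exhibit a
  torsion-free connection that preserves it.\<close>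

lemma koszul_unique:
  assumes y: "y \<in> S" and tf: "\<And>a b p. \<Gamma> a $ p $ b = \<Gamma> b $ p $ a"
    and compat: "\<And>a. pd a G y = G y ** \<Gamma> a + transpose (\<Gamma> a) ** G y"
  shows "\<Gamma> a = lc G a y"
proof -
  let ?L = "\<lambda>a. G y ** \<Gamma> a"
  have "transpose (\<Gamma> a) ** G y = transpose (?L a)" for a
    by (simp add: matrix_transpose_mul sym_G y)
  then have c: "pd a G y $ p $ q = ?L a $ p $ q + ?L a $ q $ p" for a p q
    by (simp add: compat) (simp add: transpose_def)
  have t: "?L a $ p $ b = ?L b $ p $ a" for a b p
    by (simp add: matrix_matrix_mult_def tf[of a _ b])
  have "?L a = koszul G a y"
    unfolding vec_eq_iff koszul_def c using t by (simp add: field_simps)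
  then have "matrix_inv (G y) ** G y ** \<Gamma> a = matrix_inv (G y) ** G y ** lc G a y"
    by (simp add: G_lc y matrix_mul_assoc[symmetric])
  then show ?thesis by (simp add: matrix_inv_left det_G y)
qed

lemma lc_torsion_free: "y \<in> S \<Longrightarrow> lc G a y $ p $ b = lc G b y $ p $ a"
proof -
  assume y: "y \<in> S"
  have "koszul G a y $ m $ b = koszul G b y $ m $ a" for m
    by (simp add: koszul_def pd_G_sym[OF y, of m a b])
  then show ?thesis
    by (simp add: lc_eq_koszul smooth_on_differentiable[OF smooth_G y] matrix_matrix_mult_def)
qed

lemma lc_compatible: "y \<in> S \<Longrightarrow> pd a G y = G y ** lc G a y + transpose (lc G a y) ** G y"
proof -
  assume y: "y \<in> S"
  have "transpose (lc G a y) ** G y = transpose (koszul G a y)"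
    by (simp add: G_lc[OF y, symmetric] matrix_transpose_mul sym_G[OF y])
  then show ?thesis
    by (simp add: G_lc y vec_eq_iff transpose_def koszul_def pd_G_sym[OF y, of _ a] pd_G_sym[OF y, of a] field_simps)
qed

lemma riemann_eq_curv: "y \<in> S \<Longrightarrow> riemann G i j k l y = curv (lc G) i j y $ l $ k"
proof -
  assume y: "y \<in> S"
  have "pderiv_at i (christoffel G l j k) y = pd i (lc G j) y $ l $ k" for i j
    using pd_vec_nth2[OF smooth_on_differentiable[OF smooth_lc y], of i j l k] by (simp add: pderiv_at_eq_pd lc_def)
  then show ?thesis
    by (simp add: riemann_def curv_def matrix_matrix_mult_def sum_subtractf lc_def mult.commute)
qed

lemma ricci_eq_curv: "y \<in> S \<Longrightarrow> ricci G y $ j $ k = (\<Sum>i\<in>UNIV. curv (lc G) i j y $ i $ k)"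
  by (simp add: ricci_def riemann_eq_curv)

sublocale metric_connection S G "lc G"
  by unfold_locales (auto intro: open_S smooth_G smooth_lc sym_G lc_compatible dest: det_G)

lemma first_bianchi:
  assumes y: "y \<in> S"
  shows "curv (lc G) i j y $ l $ k + curv (lc G) j k y $ l $ i + curv (lc G) k i y $ l $ j = 0"
proof -
  have pd_tf: "pd i (lc G j) y $ l $ k = pd i (lc G k) y $ l $ j" for i j k
  proof -
    have "pd i (\<lambda>y. lc G j y $ l $ k) y = pd i (\<lambda>y. lc G k y $ l $ j) y"
      by (rule pd_cong_open[OF open_S y lc_torsion_free])
    then show ?thesis by (simp add: pd_vec_nth2 diff[OF smooth_lc y])
  qed
  have C: "curv (lc G) i j y $ l $ k = pd i (lc G j) y $ l $ k - pd j (lc G i) y $ l $ k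
     + (lc G i y ** lc G j y) $ l $ k - (lc G j y ** lc G i y) $ l $ k" for i j k
    by (simp add: curv_def)
  have M: "(lc G i y ** lc G j y) $ l $ k = (lc G i y ** lc G k y) $ l $ j" for i j k
    by (simp add: matrix_matrix_mult_def lc_torsion_free[OF y, of j _ k])
  show ?thesis
    unfolding C using pd_tf[of i j k] pd_tf[of j i k] pd_tf[of k i j] M[of i j k] M[of j i k] M[of k i j] by simp
qed

text \<open>The curvature is skew with respect to \<open>G\<close>, and skew endomorphisms have trace zero.\<close>

lemma trace_curv:
  assumes y: "y \<in> S"
  shows "trace (curv (lc G) i j y) = 0"
proof -
  let ?C = "curv (lc G) i j y"
  have "0 = trace (Gi y ** (G y ** ?C + transpose ?C ** G y))"
    by (simp add: curv_skew y matrix_zero(2) trace_def)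
  also have "\<dots> = trace ?C + trace (Gi y ** transpose ?C ** G y)"
    by (simp add: matrix_distrib matrix_mul_assoc Gi_G y trace_add)
  also have "trace (Gi y ** transpose ?C ** G y) = trace (transpose ?C)"
    by (subst trace_mul_sym) (simp add: matrix_mul_assoc G_Gi y)
  also have "\<dots> = trace ?C" by (simp add: trace_def transpose_def)
  finally show ?thesis by simp
qed

text \<open>Contract the first Bianchi identity; the term that does not contain \<open>Ric\<close> is the trace of the curvature.\<close>

lemma ricci_sym:
  assumes y: "y \<in> S"
  shows "ricci G y $ j $ k = ricci G y $ k $ j"
proof -
  have "0 = (\<Sum>i\<in>UNIV. curv (lc G) i j y $ i $ k + curv (lc G) j k y $ i $ i + curv (lc G) k i y $ i $ j)"
    by (simp add: first_bianchi y)
  also have "\<dots> = ricci G y $ j $ k + trace (curv (lc G) j k y) - ricci G y $ k $ j"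
    by (subst curv_swap[of _ k]) (simp add: ricci_eq_curv y sum.distrib sum_subtractf trace_def)
  finally show ?thesis by (simp add: trace_curv y)
qed

end

section \<open>Behaviour under a change of coordinates\<close>

lemma jacobian_pd:
  assumes "\<phi> differentiable (at y)"
  shows "jacobian \<phi> (at y) = (\<chi> d a. pd a \<phi> y $ d)"
  by (simp add: jacobian_def matrix_def pd_def)

locale chart_change = U: metric_chart U G + V: metric_chart V H
  for U V :: "(real^'m::finite) set" and G H +
  fixes \<phi> :: "real^'m \<Rightarrow> real^'m"
  assumes smooth_\<phi>: "smooth_on \<phi> U"
    and image_\<phi>: "\<phi> ` U \<subseteq> V"
    and pullback: "y \<in> U \<Longrightarrow> G y = transpose (jacobian \<phi> (at y)) ** H (\<phi> y) ** jacobian \<phi> (at y)"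
begin

definition J where "J y = (\<chi> d a. pd a \<phi> y $ d)"

lemma J_eq: "y \<in> U \<Longrightarrow> jacobian \<phi> (at y) = J y"
  unfolding J_def by (rule jacobian_pd[OF U.diff[OF smooth_\<phi>]])

lemma smooth_J: "smooth_on J U"
  unfolding J_def[abs_def] by (intro smooth_intros U.open_S smooth_\<phi>)

lemma det_J: "y \<in> U \<Longrightarrow> det (J y) \<noteq> 0"
  using U.det_G[of y] pullback[of y] by (auto simp: det_mul J_eq)

lemma image: "y \<in> U \<Longrightarrow> \<phi> y \<in> V" using image_\<phi> by auto

lemma smooth_pullback:
  fixes f :: "real^'m \<Rightarrow> 'c::euclidean_space"
  shows "smooth_on f V \<Longrightarrow> smooth_on (\<lambda>y. f (\<phi> y)) U"
  by (rule smooth_on_compose[OF U.open_S smooth_\<phi> _ image_\<phi>])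

lemma pd_pullback:
  fixes f :: "real^'m \<Rightarrow> 'c::euclidean_space"
  assumes "smooth_on f V" "y \<in> U"
  shows "pd a (\<lambda>y. f (\<phi> y)) y = (\<Sum>d\<in>UNIV. J y $ d $ a *\<^sub>R pd d f (\<phi> y))"
  using pd_compose[OF V.diff[OF assms(1) image[OF assms(2)]] U.diff[OF smooth_\<phi> assms(2)]]
  by (simp add: J_def)

lemma pd_J_sym:
  assumes y: "y \<in> U"
  shows "pd a J y $ d $ b = pd b J y $ d $ a"
proof -
  have "pd a J y $ d $ b = pd a (pd b \<phi>) y $ d" for a b
  proof -
    have "pd a J y $ d $ b = pd a (\<lambda>y. J y $ d $ b) y" by (rule pd_vec_nth2[symmetric]) (rule U.diff[OF smooth_J y])
    also have "\<dots> = pd a (\<lambda>y. pd b \<phi> y $ d) y" by (simp add: J_def)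
    also have "\<dots> = pd a (pd b \<phi>) y $ d" by (rule pd_vec_nth) (rule U.diff[OF smooth_on_pd[OF smooth_\<phi>] y])
    finally show ?thesis .
  qed
  then show ?thesis using pd_commute_vec[OF U.open_S y smooth_\<phi>] by simp
qed

text \<open>The connection of \<open>H\<close>, pulled back to \<open>U\<close> along \<open>\<phi>\<close>.\<close>

definition pull where "pull a y = (\<Sum>d\<in>UNIV. J y $ d $ a *\<^sub>R lc H d (\<phi> y))"

lemma smooth_pull: "smooth_on (pull a) U"
  unfolding pull_def[abs_def]
  by (intro smooth_intros smooth_pullback U.open_S smooth_J V.smooth_lc finite_class.finite_UNIV)

lemma matrix_mult_sum_right: "A ** (\<Sum>d\<in>UNIV. c d *\<^sub>R B d) = (\<Sum>d\<in>UNIV. c d *\<^sub>R (A ** B d))"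
  for A :: "real^'m^'m" and c :: "'m \<Rightarrow> real"
  by (simp add: bounded_bilinear.sum_right[OF bounded_bilinear_matrix_mult] matrix_mult_scaleR(2))

lemma matrix_mult_sum_left: "(\<Sum>d\<in>UNIV. c d *\<^sub>R B d) ** A = (\<Sum>d\<in>UNIV. c d *\<^sub>R (B d ** A))"
  for A :: "real^'m^'m" and c :: "'m \<Rightarrow> real"
  by (simp add: bounded_bilinear.sum_left[OF bounded_bilinear_matrix_mult] matrix_mult_scaleR(1))

lemma transpose_sum: "transpose (\<Sum>d\<in>UNIV. c d *\<^sub>R B d) = (\<Sum>d\<in>UNIV. c d *\<^sub>R transpose (B d))"
  for B :: "'m \<Rightarrow> real^'m^'m" and c :: "'m \<Rightarrow> real"
  by (simp add: linear_sum[OF bounded_linear.linear[OF bounded_linear_transpose]] linear_cmul[OF bounded_linear.linear[OF bounded_linear_transpose]])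

text \<open>The transformation law of the Christoffel symbols: the Jacobian is a gauge transformation between the
  Levi-Civita connection of \<open>G\<close> and the pullback of that of \<open>H\<close>. The connection defined by this formula is
  torsion-free and preserves \<open>G\<close>, so uniqueness applies.\<close>

lemma gauge:
  assumes y: "y \<in> U"
  shows "J y ** lc G a y = pull a y ** J y + pd a J y"
proof -
  define \<Gamma> where "\<Gamma> a = matrix_inv (J y) ** (pull a y ** J y + pd a J y)" for a
  have JG: "J y ** \<Gamma> a = pull a y ** J y + pd a J y" for a
    by (simp add: \<Gamma>_def matrix_mul_assoc matrix_inv_right det_J y)
  have "\<Gamma> a = lc G a y"
  proof (rule U.koszul_unique[OF y])
    fix a b p
    have "(pull a y ** J y) $ c $ b = (pull b y ** J y) $ c $ a" for c
      by (simp add: pull_def matrix_matrix_mult_def sum_distrib_right)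
        (subst sum.swap, intro sum.cong refl, subst V.lc_torsion_free[OF image[OF y]], simp)
    then show "\<Gamma> a $ p $ b = \<Gamma> b $ p $ a"
      unfolding \<Gamma>_def matrix_matrix_mult_def[of "matrix_inv (J y)"] by (simp add: pd_J_sym[OF y, of a _ b])
  next
    fix a
    let ?H = "\<lambda>y. H (\<phi> y)"
    have sH: "smooth_on ?H U" by (rule smooth_pullback[OF V.smooth_G])
    have "pd a ?H y = H (\<phi> y) ** pull a y + transpose (pull a y) ** H (\<phi> y)"
      by (simp add: pd_pullback[OF V.smooth_G y] V.lc_compatible[OF image[OF y]] pull_def
          matrix_mult_sum_right matrix_mult_sum_left transpose_sum sum.distrib scaleR_add_right)
    moreover have "pd a G y = pd a (\<lambda>y. transpose (J y) ** ?H y ** J y) y"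
      by (rule pd_cong_open[OF U.open_S y]) (simp add: pullback J_eq)
    moreover have "\<dots> = transpose (J y) ** ?H y ** pd a J y + (transpose (J y) ** pd a ?H y + transpose (pd a J y) ** ?H y) ** J y"
      by (subst pd_matrix_mult pd_transpose; (intro U.diff smooth_intros U.open_S smooth_J sH y)?)+ simp
    ultimately have "pd a G y = transpose (J y) ** ?H y ** (J y ** \<Gamma> a) + transpose (J y ** \<Gamma> a) ** ?H y ** J y"
      by (simp add: JG matrix_distrib transpose_linear matrix_transpose_mul matrix_mul_assoc)
    then show "pd a G y = G y ** \<Gamma> a + transpose (\<Gamma> a) ** G y"
      by (simp add: pullback y J_eq matrix_transpose_mul matrix_mul_assoc)
  qed
  then show ?thesis using JG[of a] by simp
qed

text \<open>Differentiate the gauge relation once more. The second derivatives of \<open>J\<close> drop out by symmetry.\<close>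

lemma curv_gauge:
  assumes y: "y \<in> U"
  shows "J y ** curv (lc G) a b y = curv pull a b y ** J y"
proof -
  have *: "J y ** pd a (lc G b) y + pd a J y ** lc G b y = pull b y ** pd a J y + pd a (pull b) y ** J y + pd a (pd b J) y" for a b
  proof -
    have "pd a (\<lambda>y. J y ** lc G b y) y = pd a (\<lambda>y. pull b y ** J y + pd b J y) y"
      by (rule pd_cong_open[OF U.open_S y gauge])
    moreover have "pd a (\<lambda>y. J y ** lc G b y) y = J y ** pd a (lc G b) y + pd a J y ** lc G b y"
      by (rule pd_matrix_mult) (intro U.diff smooth_J U.smooth_lc y)+
    moreover have "pd a (\<lambda>y. pull b y ** J y + pd b J y) y = pull b y ** pd a J y + pd a (pull b) y ** J y + pd a (pd b J) y"
      by (subst pd_add pd_matrix_mult; (intro U.diff smooth_intros U.open_S smooth_J smooth_pull y)?)+ simp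
    ultimately show ?thesis by simp
  qed
  have 1: "J y ** pd a (lc G b) y + J y ** lc G a y ** lc G b y
     = pull b y ** pd a J y + pd a (pull b) y ** J y + pd a (pd b J) y + pull a y ** pull b y ** J y + pull a y ** pd b J y" for a b
  proof -
    have "J y ** lc G a y ** lc G b y = pull a y ** (pull b y ** J y + pd b J y) + pd a J y ** lc G b y"
      by (simp add: gauge[OF y] matrix_distrib matrix_mul_assoc[symmetric])
    then show ?thesis using *[of a b] by (simp add: matrix_distrib matrix_mul_assoc algebra_simps)
  qed
  have "J y ** curv (lc G) a b y = (J y ** pd a (lc G b) y + J y ** lc G a y ** lc G b y) - (J y ** pd b (lc G a) y + J y ** lc G b y ** lc G a y)"
    by (simp add: curv_def matrix_distrib matrix_mul_assoc)
  also have "\<dots> = curv pull a b y ** J y"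
    unfolding 1 pd_commute_vec[OF U.open_S y smooth_J, of a b]
    by (simp add: curv_def matrix_distrib)
  finally show ?thesis .
qed

text \<open>The derivatives of \<open>J\<close> cancel because \<open>\<partial>\<^sub>a J\<^sub>b\<close> is symmetric, being a second derivative of \<open>\<phi>\<close>.\<close>

lemma curv_pull:
  assumes y: "y \<in> U"
  shows "curv pull a b y = (\<Sum>c\<in>UNIV. \<Sum>d\<in>UNIV. (J y $ c $ a * J y $ d $ b) *\<^sub>R curv (lc H) c d (\<phi> y))"
proof -
  have 1: "pd a (pull b) y = (\<Sum>d\<in>UNIV. pd a J y $ d $ b *\<^sub>R lc H d (\<phi> y)) + (\<Sum>c\<in>UNIV. \<Sum>d\<in>UNIV. (J y $ c $ a * J y $ d $ b) *\<^sub>R pd c (lc H d) (\<phi> y))" for a b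
  proof -
    have "pd a (pull b) y = (\<Sum>d\<in>UNIV. pd a (\<lambda>y. J y $ d $ b *\<^sub>R lc H d (\<phi> y)) y)"
      unfolding pull_def[abs_def]
      by (rule pd_sum) (auto intro!: U.diff[OF _ y] smooth_intros smooth_pullback U.open_S smooth_J V.smooth_lc)
    also have "\<dots> = (\<Sum>d\<in>UNIV. J y $ d $ b *\<^sub>R pd a (\<lambda>y. lc H d (\<phi> y)) y + pd a J y $ d $ b *\<^sub>R lc H d (\<phi> y))"
      by (intro sum.cong refl, subst pd_bilinear[OF bounded_bilinear_scaleR])
        (auto intro!: U.diff[OF _ y] smooth_intros smooth_pullback U.open_S smooth_J V.smooth_lc simp: pd_vec_nth2[OF U.diff[OF smooth_J y]])
    also have "\<dots> = (\<Sum>d\<in>UNIV. pd a J y $ d $ b *\<^sub>R lc H d (\<phi> y)) + (\<Sum>d\<in>UNIV. \<Sum>c\<in>UNIV. (J y $ c $ a * J y $ d $ b) *\<^sub>R pd c (lc H d) (\<phi> y))"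
      by (simp add: pd_pullback[OF V.smooth_lc y] sum.distrib scaleR_sum_right mult.commute)
    also have "(\<Sum>d\<in>UNIV. \<Sum>c\<in>UNIV. (J y $ c $ a * J y $ d $ b) *\<^sub>R pd c (lc H d) (\<phi> y)) = (\<Sum>c\<in>UNIV. \<Sum>d\<in>UNIV. (J y $ c $ a * J y $ d $ b) *\<^sub>R pd c (lc H d) (\<phi> y))"
      by (rule sum.swap)
    finally show ?thesis .
  qed
  have 2: "(\<Sum>d\<in>UNIV. pd a J y $ d $ b *\<^sub>R lc H d (\<phi> y)) = (\<Sum>d\<in>UNIV. pd b J y $ d $ a *\<^sub>R lc H d (\<phi> y))"
    by (subst pd_J_sym[OF y]) simp
  have 3: "pull a y ** pull b y = (\<Sum>c\<in>UNIV. \<Sum>d\<in>UNIV. (J y $ c $ a * J y $ d $ b) *\<^sub>R (lc H c (\<phi> y) ** lc H d (\<phi> y)))" for a b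
    by (simp add: pull_def matrix_mult_sum_left matrix_mult_sum_right scaleR_sum_right)
      (subst sum.swap, simp add: mult.commute)
  have sw: "(\<Sum>c\<in>UNIV. \<Sum>d\<in>UNIV. (J y $ c $ b * J y $ d $ a) *\<^sub>R f c d) = (\<Sum>c\<in>UNIV. \<Sum>d\<in>UNIV. (J y $ c $ a * J y $ d $ b) *\<^sub>R f d c)"
    for f :: "'m \<Rightarrow> 'm \<Rightarrow> real^'m^'m"
    by (subst sum.swap) (simp add: mult.commute)
  show ?thesis
    unfolding curv_def 1 2 3 sw[of "\<lambda>c d. pd c (lc H d) (\<phi> y)"] sw[of "\<lambda>c d. lc H c (\<phi> y) ** lc H d (\<phi> y)"]
    by (simp add: sum.distrib sum_subtractf scaleR_add_right scaleR_diff_right)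
qed

text \<open>In the trace, the Jacobian that acts on the traced direction cancels against the gauge transformation.\<close>

theorem ricci_pullback:
  assumes y: "y \<in> U"
  shows "ricci G y = transpose (J y) ** ricci H (\<phi> y) ** J y"
proof -
  let ?Ji = "matrix_inv (J y)" and ?R = "\<lambda>c d. curv (lc H) c d (\<phi> y)"
  have "ricci G y $ b $ k = (transpose (J y) ** ricci H (\<phi> y) ** J y) $ b $ k" for b k
  proof -
    have "curv (lc G) a b y = ?Ji ** (J y ** curv (lc G) a b y)" for a
      by (simp add: matrix_mul_assoc matrix_inv_left det_J y)
    then have C: "curv (lc G) a b y = ?Ji ** (\<Sum>c\<in>UNIV. \<Sum>d\<in>UNIV. (J y $ c $ a * J y $ d $ b) *\<^sub>R (?R c d ** J y))" for a
      unfolding curv_gauge[OF y] curv_pull[OF y]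
      by (simp add: bounded_bilinear.sum_left[OF bounded_bilinear_matrix_mult] matrix_mult_scaleR(1))
    have JJ: "(\<Sum>a\<in>UNIV. J y $ c $ a * ?Ji $ a $ p) = (if c = p then 1 else 0)" for c p
      using arg_cong[OF matrix_inv_right[OF det_J[OF y]], of "\<lambda>A. A $ c $ p"]
      by (simp add: matrix_matrix_mult_def mat_def)
    have "ricci G y $ b $ k = (\<Sum>a\<in>UNIV. \<Sum>p\<in>UNIV. ?Ji $ a $ p * (\<Sum>c\<in>UNIV. \<Sum>d\<in>UNIV. (J y $ c $ a * J y $ d $ b) * (?R c d ** J y) $ p $ k))"
      by (simp add: U.ricci_eq_curv[OF y] C matrix_matrix_mult_def[of ?Ji])
    also have "\<dots> = (\<Sum>a\<in>UNIV. \<Sum>p\<in>UNIV. \<Sum>c\<in>UNIV. (J y $ c $ a * ?Ji $ a $ p) * (\<Sum>d\<in>UNIV. J y $ d $ b * (?R c d ** J y) $ p $ k))"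
      by (simp add: sum_distrib_left mult_ac)
    also have "\<dots> = (\<Sum>p\<in>UNIV. \<Sum>c\<in>UNIV. \<Sum>a\<in>UNIV. (J y $ c $ a * ?Ji $ a $ p) * (\<Sum>d\<in>UNIV. J y $ d $ b * (?R c d ** J y) $ p $ k))"
      by (rule sum_rotate)
    also have "\<dots> = (\<Sum>p\<in>UNIV. \<Sum>d\<in>UNIV. J y $ d $ b * (?R p d ** J y) $ p $ k)"
      unfolding sum_distrib_right[symmetric] JJ by (simp add: if_distrib[of "\<lambda>x. x * _"] cong: if_cong)
    also have "\<dots> = (\<Sum>d\<in>UNIV. J y $ d $ b * (\<Sum>p\<in>UNIV. \<Sum>e\<in>UNIV. ?R p d $ p $ e * J y $ e $ k))"
      by (subst sum.swap) (simp add: sum_distrib_left matrix_matrix_mult_def)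
    also have "\<dots> = (\<Sum>d\<in>UNIV. J y $ d $ b * (\<Sum>e\<in>UNIV. ricci H (\<phi> y) $ d $ e * J y $ e $ k))"
      by (subst sum.swap) (simp add: sum_distrib_right V.ricci_eq_curv[OF image[OF y]])
    also have "\<dots> = (transpose (J y) ** (ricci H (\<phi> y) ** J y)) $ b $ k"
      by (simp add: matrix_matrix_mult_def transpose_def)
    finally show ?thesis by (simp add: matrix_mul_assoc)
  qed
  then show ?thesis by (simp add: vec_eq_iff)
qed

text \<open>The inhomogeneous term of the transformation law of the Christoffel symbols cancels the second derivatives
  of \<open>\<phi>\<close> from the chain rule.\<close>

theorem hessian_pullback:
  assumes y: "y \<in> U" and f': "smooth_on f' V" and f: "\<And>y. y \<in> U \<Longrightarrow> f y = f' (\<phi> y)"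
  shows "hessian G f y = transpose (J y) ** hessian H f' (\<phi> y) ** J y"
proof -
  have D1: "pd j f x = (\<Sum>c\<in>UNIV. J x $ c $ j * pd c f' (\<phi> x))" if "x \<in> U" for j x
    using pd_cong_open[OF U.open_S that f, where k=j] pd_pullback[OF f' that] by simp
  have D2: "pd i (pd j f) y = (\<Sum>c\<in>UNIV. pd i J y $ c $ j * pd c f' (\<phi> y)) + (\<Sum>c\<in>UNIV. \<Sum>d\<in>UNIV. J y $ c $ j * (J y $ d $ i * pd d (pd c f') (\<phi> y)))" for i j
  proof -
    have "pd i (pd j f) y = pd i (\<lambda>x. \<Sum>c\<in>UNIV. J x $ c $ j * pd c f' (\<phi> x)) y"
      by (rule pd_cong_open[OF U.open_S y D1])
    also have "\<dots> = (\<Sum>c\<in>UNIV. pd i (\<lambda>x. J x $ c $ j * pd c f' (\<phi> x)) y)"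
      by (rule pd_sum) (auto intro!: U.diff[OF _ y] smooth_intros smooth_pullback U.open_S smooth_J f')
    also have "\<dots> = (\<Sum>c\<in>UNIV. J y $ c $ j * pd i (\<lambda>x. pd c f' (\<phi> x)) y + pd i J y $ c $ j * pd c f' (\<phi> y))"
      by (intro sum.cong refl, subst pd_mult)
        (auto intro!: U.diff[OF _ y] smooth_intros smooth_pullback U.open_S smooth_J f' simp: pd_vec_nth2[OF U.diff[OF smooth_J y]])
    finally show ?thesis
      by (simp add: pd_pullback[OF smooth_on_pd[OF f'] y] sum.distrib sum_distrib_left)
  qed
  have "hessian G f y $ i $ j = (transpose (J y) ** hessian H f' (\<phi> y) ** J y) $ i $ j" for i j
  proof -
    have "(\<Sum>k\<in>UNIV. christoffel G k i j y * pd k f y) = (\<Sum>k\<in>UNIV. \<Sum>c\<in>UNIV. J y $ c $ k * lc G i y $ k $ j * pd c f' (\<phi> y))"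
      by (simp add: D1 y lc_def sum_distrib_left mult_ac)
    also have "\<dots> = (\<Sum>c\<in>UNIV. (J y ** lc G i y) $ c $ j * pd c f' (\<phi> y))"
      by (subst sum.swap) (simp add: matrix_matrix_mult_def sum_distrib_right)
    also have "\<dots> = (\<Sum>c\<in>UNIV. (pull i y ** J y) $ c $ j * pd c f' (\<phi> y)) + (\<Sum>c\<in>UNIV. pd i J y $ c $ j * pd c f' (\<phi> y))"
      by (simp add: gauge[OF y] distrib_right sum.distrib)
    finally have 1: "hessian G f y $ i $ j = (\<Sum>c\<in>UNIV. \<Sum>d\<in>UNIV. J y $ c $ j * (J y $ d $ i * pd d (pd c f') (\<phi> y)))
       - (\<Sum>c\<in>UNIV. (pull i y ** J y) $ c $ j * pd c f' (\<phi> y))"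
      by (simp add: hessian_def pderiv_at_eq_pd D2)
    have "(\<Sum>c\<in>UNIV. (pull i y ** J y) $ c $ j * pd c f' (\<phi> y))
       = (\<Sum>c\<in>UNIV. \<Sum>e\<in>UNIV. \<Sum>d\<in>UNIV. J y $ d $ i * lc H d (\<phi> y) $ c $ e * J y $ e $ j * pd c f' (\<phi> y))"
      by (simp add: pull_def matrix_matrix_mult_def sum_distrib_right)
    also have "\<dots> = (\<Sum>e\<in>UNIV. \<Sum>d\<in>UNIV. \<Sum>c\<in>UNIV. J y $ d $ i * lc H d (\<phi> y) $ c $ e * J y $ e $ j * pd c f' (\<phi> y))"
      by (rule sum_rotate)
    also have "\<dots> = (\<Sum>e\<in>UNIV. \<Sum>d\<in>UNIV. J y $ e $ j * (J y $ d $ i * (\<Sum>c\<in>UNIV. lc H d (\<phi> y) $ c $ e * pd c f' (\<phi> y))))"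
      by (simp add: sum_distrib_left mult_ac)
    finally have "hessian G f y $ i $ j = (\<Sum>c\<in>UNIV. \<Sum>d\<in>UNIV. J y $ c $ j * (J y $ d $ i * hessian H f' (\<phi> y) $ d $ c))"
      unfolding 1 by (simp add: hessian_def pderiv_at_eq_pd lc_def sum_subtractf right_diff_distrib)
    then show ?thesis by (simp add: matrix_matrix_mult_def transpose_def sum_distrib_right sum_distrib_left mult_ac)
  qed
  then show ?thesis by (simp add: vec_eq_iff)
qed

end

section \<open>A reverse Ricci flow in a space-time chart\<close>

text \<open>Space-time coordinates are split into the space coordinates \<open>sp z\<close> and the time \<open>z $ None\<close>.\<close>

definition sp :: "real^('n::finite option) \<Rightarrow> real^'n" where
  "sp z = (\<chi> k. z $ Some k)"

definition join :: "real^'n::finite \<Rightarrow> real \<Rightarrow> real^('n option)" where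
  "join y t = (\<chi> \<alpha>. case \<alpha> of None \<Rightarrow> t | Some k \<Rightarrow> y $ k)"

lemma join_simps [simp]: "sp (join y t) = y" "join y t $ None = t" "join y t $ Some k = y $ k" "join (sp z) (z $ None) = z"
  by (auto simp: sp_def join_def vec_eq_iff split: option.split)

lemma linear_sp: "linear sp"
  by (rule linearI) (auto simp: sp_def vec_eq_iff)

lemma linear_join: "linear (\<lambda>(y, t). join y t)"
  by (rule linearI) (auto simp: join_def vec_eq_iff split: option.split)

lemma bounded_linear_sp: "bounded_linear sp"
  using linear_sp linear_conv_bounded_linear by blast

lemma bounded_linear_join: "bounded_linear (\<lambda>(y, t). join y t)"
  using linear_join linear_conv_bounded_linear by blast

lemma sum_option: "(\<Sum>\<alpha>\<in>UNIV. f \<alpha>) = f None + (\<Sum>k\<in>UNIV. f (Some k))" for f :: "'n::finite option \<Rightarrow> 'b::comm_monoid_add"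
  by (simp add: UNIV_option_conv sum.reindex)

lemma open_space_time:
  fixes V :: "(real^'n::finite) set"
  assumes "open V" "open I"
  shows "open {z. sp z \<in> V \<and> z $ None \<in> I}"
proof -
  have "open (sp -` V)" "open ((\<lambda>z::real^('n option). z $ None) -` I)"
    using open_vimage assms linear_continuous_on bounded_linear_sp bounded_linear_vec_nth by blast+
  from open_Int[OF this] show ?thesis by (simp add: vimage_def Collect_conj_eq)
qed

text \<open>A spatial derivative of a time slice is a space-time derivative in the same direction.\<close>

lemma pd_slice:
  assumes "\<And>y t. F (join y t) = f t y" "F differentiable (at z)"
  shows "pd k (f (z $ None)) (sp z) = pd (Some k) F z"
proof -
  have "((\<lambda>y. join y (z $ None)) has_derivative (\<lambda>v. join v 0)) (at (sp z))"
  proof -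
    have "((\<lambda>y. (\<lambda>(y, t). join y t) (y, z $ None)) has_derivative (\<lambda>v. (\<lambda>(y, t). join y t) (v, 0))) (at (sp z))"
      by (rule bounded_linear.has_derivative[OF bounded_linear_join]) (auto intro!: derivative_eq_intros)
    then show ?thesis by simp
  qed
  moreover have "(F has_derivative frechet_derivative F (at z)) (at (join (sp z) (z $ None)))"
    using frechet_derivative_works[THEN iffD1, OF assms(2)] by simp
  ultimately have "((\<lambda>y. F (join y (z $ None))) has_derivative (\<lambda>v. frechet_derivative F (at z) (join v 0))) (at (sp z))"
    using diff_chain_at[of "\<lambda>y. join y (z $ None)" _ "sp z" F] by (simp add: o_def)
  moreover have "join (axis k 1) 0 = axis (Some k) (1::real)"
    by (auto simp: join_def axis_def vec_eq_iff split: option.split)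
  ultimately show ?thesis
    using pd_has_derivative unfolding assms(1) by (metis pd_def)
qed

lemma pd_time:
  fixes F :: "real^('n::finite option) \<Rightarrow> 'b::real_normed_vector"
  assumes "F differentiable (at z)" "((\<lambda>s. F (join (sp z) s)) has_vector_derivative D) (at (z $ None))"
  shows "pd None F z = D"
proof -
  have "((\<lambda>s. join (sp z) s) has_derivative (\<lambda>v. join 0 v)) (at (z $ None))"
  proof -
    have "((\<lambda>s. (\<lambda>(y, t). join y t) (sp z, s)) has_derivative (\<lambda>v. (\<lambda>(y, t). join y t) (0, v))) (at (z $ None))"
      by (rule bounded_linear.has_derivative[OF bounded_linear_join]) (auto intro!: derivative_eq_intros)
    then show ?thesis by simp
  qed
  moreover have "(F has_derivative frechet_derivative F (at z)) (at (join (sp z) (z $ None)))"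
    using frechet_derivative_works[THEN iffD1, OF assms(1)] by simp
  ultimately have "((\<lambda>s. F (join (sp z) s)) has_derivative (\<lambda>v. frechet_derivative F (at z) (join 0 v))) (at (z $ None))"
    using diff_chain_at[of "\<lambda>s. join (sp z) s" _ "z $ None" F] by (simp add: o_def)
  then have "(\<lambda>v. frechet_derivative F (at z) (join 0 v)) = (\<lambda>v. v *\<^sub>R D)"
    using assms(2) has_derivative_unique unfolding has_vector_derivative_def by blast
  from fun_cong[OF this, of 1] have "frechet_derivative F (at z) (join 0 1) = D" by simp
  moreover have "join 0 1 = (axis None 1 :: real^('n option))"
    by (auto simp: join_def axis_def vec_eq_iff split: option.split)
  ultimately show ?thesis by (simp add: pd_def)
qed

lemma pos_def_det: "pos_def_matrix B \<Longrightarrow> det B \<noteq> 0"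
  unfolding pos_def_matrix_def
  by (metis det_nz_iff_inj inj_matrix_vector_mult inner_zero_right invertible_det_nz less_irrefl matrix_left_invertible_ker invertible_left_inverse)

text \<open>The component matrices of a flow in one chart with image \<open>U\<close>. All geometric quantities of the slices
  are regarded as functions on the space-time domain \<open>\<Omega>\<close>, where space and time derivatives commute.\<close>

locale flow_chart =
  fixes U :: "(real^'n::finite) set" and I :: "real set" and \<gamma> :: "real \<Rightarrow> real^'n \<Rightarrow> real^'n^'n"
  assumes open_U: "open U" and open_I: "open I" and I_pos: "t \<in> I \<Longrightarrow> t > 0"
    and smooth_\<gamma>: "smooth_on (\<lambda>(y, t). \<gamma> t y) (U \<times> I)"
    and sym_\<gamma>: "t \<in> I \<Longrightarrow> y \<in> U \<Longrightarrow> transpose (\<gamma> t y) = \<gamma> t y"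
    and det_\<gamma>: "t \<in> I \<Longrightarrow> y \<in> U \<Longrightarrow> det (\<gamma> t y) \<noteq> 0"
    and flow_\<gamma>: "t \<in> I \<Longrightarrow> y \<in> U \<Longrightarrow> ((\<lambda>s. \<gamma> s y) has_vector_derivative 2 *\<^sub>R ricci (\<gamma> t) y) (at t)"
begin

definition \<Omega> where "\<Omega> = {z. sp z \<in> U \<and> z $ None \<in> I}"

definition G where "G z = \<gamma> (z $ None) (sp z)"

definition Rc where "Rc z = ricci (\<gamma> (z $ None)) (sp z)"

text \<open>In the time direction the connection is the Ricci endomorphism.\<close>

definition \<Gamma> where "\<Gamma> \<alpha> z = (case \<alpha> of None \<Rightarrow> matrix_inv (G z) ** Rc z | Some a \<Rightarrow> lc (\<gamma> (z $ None)) a (sp z))"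

lemma open_\<Omega>: "open \<Omega>"
  unfolding \<Omega>_def by (rule open_space_time[OF open_U open_I])

lemma \<Omega>D: "z \<in> \<Omega> \<Longrightarrow> sp z \<in> U" "z \<in> \<Omega> \<Longrightarrow> z $ None \<in> I" "z \<in> \<Omega> \<Longrightarrow> z $ None > 0"
  using I_pos by (auto simp: \<Omega>_def)

lemma G_join: "G (join y t) = \<gamma> t y" by (simp add: G_def)

lemma smooth_G: "smooth_on G \<Omega>"
proof -
  have "linear (\<lambda>z::real^('n option). (sp z, z $ None))"
    by (rule linearI) (auto simp: linear_add[OF linear_sp] linear_cmul[OF linear_sp])
  then have "smooth_on (\<lambda>z::real^('n option). (sp z, z $ None)) \<Omega>"
    using smooth_on_bounded_linear[OF _ open_\<Omega>] linear_conv_bounded_linear by blast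
  from smooth_on_compose[OF open_\<Omega> this smooth_\<gamma>] \<Omega>D show ?thesis
    by (auto simp: G_def[abs_def])
qed

lemma slice: "t \<in> I \<Longrightarrow> metric_chart U (\<gamma> t)"
proof
  assume t: "t \<in> I"
  have "smooth_on (\<lambda>y. (y, t)) U"
  proof -
    have "linear (\<lambda>y::real^'n. (y, 0::real))" by (rule linearI) auto
    then have "smooth_on (\<lambda>y::real^'n. (y, 0::real)) U"
      using smooth_on_bounded_linear[OF _ open_U] linear_conv_bounded_linear by blast
    from smooth_on_add[OF open_U this smooth_on_const[of "(0, t)"]] show ?thesis by simp
  qed
  from smooth_on_compose[OF open_U this smooth_\<gamma>] t
  show "smooth_on (\<gamma> t) U" by auto
qed (use open_U sym_\<gamma> det_\<gamma> in auto)

lemma diff: "smooth_on f \<Omega> \<Longrightarrow> z \<in> \<Omega> \<Longrightarrow> f differentiable (at z)"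
  by (rule smooth_on_differentiable)

lemma det_G: "z \<in> \<Omega> \<Longrightarrow> det (G z) \<noteq> 0" and sym_G: "z \<in> \<Omega> \<Longrightarrow> transpose (G z) = G z"
  using det_\<gamma> sym_\<gamma> \<Omega>D by (auto simp: G_def)

lemma pd_G_space: "z \<in> \<Omega> \<Longrightarrow> pd k (\<gamma> (z $ None)) (sp z) = pd (Some k) G z"
  by (rule pd_slice[OF G_join diff[OF smooth_G]])

lemma \<Gamma>_space: "z \<in> \<Omega> \<Longrightarrow> \<Gamma> (Some a) z = matrix_inv (G z) ** (\<chi> m b. (pd (Some a) G z $ b $ m + pd (Some b) G z $ a $ m - pd (Some m) G z $ a $ b) / 2)"
  using lc_eq_koszul[OF smooth_on_differentiable[OF metric_chart.smooth_G[OF slice[OF \<Omega>D(2)]] \<Omega>D(1)], of z z a]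
  by (simp add: \<Gamma>_def koszul_def pd_G_space G_def[symmetric])

lemma smooth_\<Gamma>_space: "smooth_on (\<Gamma> (Some a)) \<Omega>"
proof (rule smooth_on_cong[OF open_\<Omega>])
  show "smooth_on (\<lambda>z. matrix_inv (G z) ** (\<chi> m b. (pd (Some a) G z $ b $ m + pd (Some b) G z $ a $ m - pd (Some m) G z $ a $ b) / 2)) \<Omega>"
    by (intro smooth_intros open_\<Omega> smooth_G det_G) auto
qed (simp add: \<Gamma>_space)

lemma curv_space:
  assumes z: "z \<in> \<Omega>"
  shows "curv (lc (\<gamma> (z $ None))) i j (sp z) = curv \<Gamma> (Some i) (Some j) z"
proof -
  have "pd i (lc (\<gamma> (z $ None)) j) (sp z) = pd (Some i) (\<Gamma> (Some j)) z" for i j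
    by (rule pd_slice[OF _ diff[OF smooth_\<Gamma>_space z]]) (simp add: \<Gamma>_def)
  then show ?thesis by (simp add: curv_def \<Gamma>_def)
qed

lemma Rc_comp: "z \<in> \<Omega> \<Longrightarrow> Rc z $ j $ k = (\<Sum>i\<in>UNIV. curv \<Gamma> (Some i) (Some j) z $ i $ k)"
  using metric_chart.ricci_eq_curv[OF slice[OF \<Omega>D(2)] \<Omega>D(1), of z z j k]
  by (simp add: Rc_def curv_space)

lemma smooth_Rc: "smooth_on Rc \<Omega>"
proof (rule smooth_on_cong[OF open_\<Omega>])
  show "smooth_on (\<lambda>z. \<chi> j k. \<Sum>i\<in>UNIV. curv \<Gamma> (Some i) (Some j) z $ i $ k) \<Omega>"
    unfolding curv_def
    by (intro smooth_intros open_\<Omega> smooth_\<Gamma>_space finite_class.finite_UNIV)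
qed (simp add: Rc_comp vec_eq_iff)

lemma smooth_\<Gamma>: "smooth_on (\<Gamma> \<alpha>) \<Omega>"
proof (cases \<alpha>)
  case None
  have "smooth_on (\<lambda>z. matrix_inv (G z) ** Rc z) \<Omega>"
    by (intro smooth_intros open_\<Omega> smooth_G smooth_Rc det_G)
  then show ?thesis using None by (simp add: \<Gamma>_def[abs_def])
qed (simp add: smooth_\<Gamma>_space)

lemma sym_Rc: "z \<in> \<Omega> \<Longrightarrow> transpose (Rc z) = Rc z"
  using metric_chart.ricci_sym[OF slice[OF \<Omega>D(2)] \<Omega>D(1), of z z]
  by (simp add: Rc_def vec_eq_iff transpose_def)

lemma pd_None_G: "z \<in> \<Omega> \<Longrightarrow> pd None G z = 2 *\<^sub>R Rc z"
  using pd_time[OF diff[OF smooth_G], of z "2 *\<^sub>R Rc z"] flow_\<gamma>[OF \<Omega>D(2) \<Omega>D(1), of z z]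
  by (simp add: G_join Rc_def)

lemma G_\<Gamma>_None: "z \<in> \<Omega> \<Longrightarrow> G z ** \<Gamma> None z = Rc z"
  by (simp add: \<Gamma>_def matrix_mul_assoc matrix_inv_right det_G)

text \<open>In the time direction this is the flow equation.\<close>

lemma G_compatible:
  assumes z: "z \<in> \<Omega>"
  shows "pd \<alpha> G z = G z ** \<Gamma> \<alpha> z + transpose (\<Gamma> \<alpha> z) ** G z"
proof (cases \<alpha>)
  case None
  have "transpose (\<Gamma> None z) ** G z = transpose (G z ** \<Gamma> None z)"
    by (simp add: matrix_transpose_mul sym_G z)
  then show ?thesis using None by (simp add: pd_None_G z G_\<Gamma>_None sym_Rc scaleR_2)
next
  case (Some a)
  show ?thesis
    using metric_chart.lc_compatible[OF slice[OF \<Omega>D(2)] \<Omega>D(1), OF z z, of a] z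
    unfolding Some pd_G_space[OF z, symmetric] by (simp add: G_def \<Gamma>_def)
qed

sublocale flow_connection \<Omega> G \<Gamma>
proof
  fix z a p b assume z: "z \<in> \<Omega>"
  show "\<Gamma> (Some a) z $ p $ b = \<Gamma> (Some b) z $ p $ a"
    using metric_chart.lc_torsion_free[OF slice[OF \<Omega>D(2)] \<Omega>D(1), OF z z] by (simp add: \<Gamma>_def)
qed (use open_\<Omega> smooth_G smooth_\<Gamma> sym_G det_G G_compatible in auto)

lemma rr_Rc: "z \<in> \<Omega> \<Longrightarrow> rr b p z = (\<Sum>q\<in>UNIV. Rc z $ b $ q * Gi z $ q $ p)"
  unfolding rr_def E_def matrix_matrix_mult_def
  by (simp add: Rc_comp sum_distrib_right) (rule sum.swap)

sublocale ricci_flow_connection \<Omega> G \<Gamma>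
proof
  fix z p b assume z: "z \<in> \<Omega>"
  have "Rc z $ q $ b = Rc z $ b $ q" for q
    using arg_cong[OF sym_Rc[OF z], of "\<lambda>A. A $ b $ q"] by (simp add: transpose_def)
  then show "\<Gamma> None z $ p $ b = rr b p z"
    unfolding rr_Rc[OF z] by (simp add: \<Gamma>_def Gi_def[symmetric] matrix_matrix_mult_def)
      (intro sum.cong refl, subst sym_Gi_comp[OF z], simp)
  show "transpose (G z ** \<Gamma> None z) = G z ** \<Gamma> None z"
    by (simp add: G_\<Gamma>_None z sym_Rc)
qed

lemma scalar_curv_eq: "z \<in> \<Omega> \<Longrightarrow> scalar_curv (\<gamma> (z $ None)) (sp z) = Rs z"
  unfolding scalar_curv_def Rs_def rr_Rc Rc_def[symmetric] G_def[symmetric] Gi_def[symmetric]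
  by (intro sum.cong refl, subst sym_Gi_comp) auto

end

section \<open>The space-time metric in a chart\<close>

lemma pd_time_fun:
  fixes z :: "real^('n::finite option)"
  assumes "(q has_real_derivative d) (at (z $ None))"
  shows "pd \<alpha> (\<lambda>z. q (z $ None)) z = (if \<alpha> = None then d else 0)"
proof -
  have "((\<lambda>z. q (z $ None)) has_derivative (\<lambda>v. d * (v $ None))) (at z)"
    using has_derivative_compose[OF bounded_linear_imp_has_derivative[OF bounded_linear_vec_nth[of None]], of q _ z UNIV] assms
    by (simp add: has_field_derivative_def)
  from pd_has_derivative[OF this, of \<alpha>] show ?thesis by (auto simp: axis_def)
qed

context flow_chart
begin

text \<open>The function for which \<open>hat N $ None $ None = (N + c) / (2 \<tau>\<^sup>3)\<close>.\<close>

definition c where "c z = 2 * (z $ None)\<^sup>2 * Rs z - real CARD('n) * z $ None"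

definition hat :: "nat \<Rightarrow> real^('n option) \<Rightarrow> real^('n option)^('n option)" where
  "hat N z = (\<chi> \<alpha> \<beta>. case (\<alpha>, \<beta>) of
      (Some k, Some l) \<Rightarrow> \<gamma> (z $ None) (sp z) $ k $ l / z $ None
    | (None, None) \<Rightarrow> real N / (2 * (z $ None)^3) + scalar_curv (\<gamma> (z $ None)) (sp z) / z $ None - real CARD('n) / (2 * (z $ None)^2)
    | _ \<Rightarrow> 0)"

definition F where "F N z = (real N + c z) / (2 * (z $ None)^3)"

lemma hat_comp:
  "hat N z $ Some k $ Some l = G z $ k $ l / z $ None"
  "hat N z $ Some k $ None = 0" "hat N z $ None $ Some k = 0"
  "z \<in> \<Omega> \<Longrightarrow> hat N z $ None $ None = F N z"
  using \<Omega>D(3)[of z]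
  by (auto simp: hat_def G_def scalar_curv_eq F_def c_def field_simps power2_eq_square power3_eq_cube)

lemma smooth_time: "smooth_on (\<lambda>z. z $ None) \<Omega>"
  by (rule smooth_on_bounded_linear[OF bounded_linear_vec_nth open_\<Omega>])

lemma time_nz: "z \<in> \<Omega> \<Longrightarrow> z $ None \<noteq> 0"
  using \<Omega>D(3) by fastforce

lemma smooth_c: "smooth_on c \<Omega>"
  unfolding c_def[abs_def] by (intro smooth_intros open_\<Omega> smooth_time smooth_Rs)

lemma smooth_F: "smooth_on (F N) \<Omega>"
  unfolding F_def[abs_def] by (intro smooth_intros open_\<Omega> smooth_time smooth_c) (simp add: time_nz)

lemma smooth_hat: "smooth_on (hat N) \<Omega>"
proof -
  have "smooth_on (\<lambda>z. hat N z $ \<alpha> $ \<beta>) \<Omega>" for \<alpha> \<beta>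
  proof (cases \<alpha>; cases \<beta>)
    assume "\<alpha> = None" "\<beta> = None"
    then show ?thesis using smooth_on_cong[OF open_\<Omega> hat_comp(4)[symmetric] smooth_F] by simp
  next
    fix k l assume "\<alpha> = Some k" "\<beta> = Some l"
    then show ?thesis by (auto simp: hat_comp time_nz intro!: smooth_intros open_\<Omega> smooth_time smooth_G)
  qed (auto simp: hat_comp intro: smooth_on_const)
  from smooth_on_vec_lambda[OF open_\<Omega>, of "\<lambda>\<alpha> z. \<chi> \<beta>. hat N z $ \<alpha> $ \<beta>", OF smooth_on_vec_lambda[OF open_\<Omega> this]]
  show ?thesis by simp
qed

lemma sym_hat: "z \<in> \<Omega> \<Longrightarrow> transpose (hat N z) = hat N z"
proof -
  assume z: "z \<in> \<Omega>"
  have "hat N z $ \<beta> $ \<alpha> = hat N z $ \<alpha> $ \<beta>" for \<alpha> \<beta>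
    by (cases \<alpha>; cases \<beta>) (auto simp: hat_comp sym_G_comp[OF z])
  then show ?thesis by (simp add: vec_eq_iff transpose_def)
qed

lemma pd_c_space: "z \<in> \<Omega> \<Longrightarrow> pd (Some a) c z = 2 * (z $ None)\<^sup>2 * pd (Some a) Rs z"
  and pd_c_time: "z \<in> \<Omega> \<Longrightarrow> pd None c z = 4 * z $ None * Rs z + 2 * (z $ None)\<^sup>2 * pd None Rs z - real CARD('n)"
proof -
  assume z: "z \<in> \<Omega>"
  have "pd \<alpha> c z = 2 * (z $ None)\<^sup>2 * pd \<alpha> Rs z + pd \<alpha> (\<lambda>z. 2 * (z $ None)\<^sup>2) z * Rs z - pd \<alpha> (\<lambda>z. real CARD('n) * z $ None) z" for \<alpha>
    unfolding c_def[abs_def]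
    by (subst pd_diff pd_mult; (intro diff smooth_intros open_\<Omega> smooth_time smooth_Rs z)?)+ simp
  moreover have "pd \<alpha> (\<lambda>z. 2 * (z $ None)\<^sup>2) z = (if \<alpha> = None then 4 * z $ None else 0)" for \<alpha>
    by (rule pd_time_fun) (auto intro!: derivative_eq_intros)
  moreover have "pd \<alpha> (\<lambda>z. real CARD('n) * z $ None) z = (if \<alpha> = None then real CARD('n) else 0)" for \<alpha>
    by (rule pd_time_fun) (auto intro!: derivative_eq_intros)
  ultimately show "pd (Some a) c z = 2 * (z $ None)\<^sup>2 * pd (Some a) Rs z"
    "pd None c z = 4 * z $ None * Rs z + 2 * (z $ None)\<^sup>2 * pd None Rs z - real CARD('n)"
    by simp_all
qed

lemma pd_F:
  assumes z: "z \<in> \<Omega>"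
  shows "pd \<alpha> (F N) z = pd \<alpha> c z / (2 * (z $ None)^3) - (if \<alpha> = None then 3 * F N z / z $ None else 0)"
proof -
  have "pd \<alpha> (F N) z = pd \<alpha> (\<lambda>z. (real N + c z) * (1 / (2 * (z $ None)^3))) z"
    by (simp add: F_def[abs_def])
  also have "\<dots> = (real N + c z) * pd \<alpha> (\<lambda>z. 1 / (2 * (z $ None)^3)) z + pd \<alpha> (\<lambda>z. real N + c z) z * (1 / (2 * (z $ None)^3))"
    by (rule pd_mult; intro diff smooth_intros open_\<Omega> smooth_time smooth_c z) (simp add: time_nz)
  also have "pd \<alpha> (\<lambda>z. real N + c z) z = pd \<alpha> c z"
    by (subst pd_add; (intro diff smooth_intros smooth_c z)?) simp
  also have "pd \<alpha> (\<lambda>z. 1 / (2 * (z $ None)^3)) z = (if \<alpha> = None then - 3 / (2 * (z $ None)^4) else 0)"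
    by (rule pd_time_fun) (auto intro!: derivative_eq_intros simp: time_nz[OF z] field_simps power_def numeral_eq_Suc)
  finally have E: "pd \<alpha> (F N) z = (real N + c z) * (if \<alpha> = None then - 3 / (2 * z $ None ^ 4) else 0) + pd \<alpha> c z * (1 / (2 * z $ None ^ 3))" .
  have "real N + c z = F N z * (2 * (z $ None)^3)" using time_nz[OF z] by (simp add: F_def)
  then show ?thesis unfolding E using time_nz[OF z]
    by (cases \<alpha>) (simp_all add: field_simps power3_eq_cube power4_eq_xxxx)
qed

lemma pd_hat_space:
  assumes z: "z \<in> \<Omega>"
  shows "pd \<alpha> (\<lambda>z. G z $ m $ b / z $ None) z = pd \<alpha> G z $ m $ b / z $ None - (if \<alpha> = None then G z $ m $ b / (z $ None)\<^sup>2 else 0)"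
proof -
  have "pd \<alpha> (\<lambda>z. G z $ m $ b * (1 / z $ None)) z = G z $ m $ b * pd \<alpha> (\<lambda>z. 1 / z $ None) z + pd \<alpha> (\<lambda>z. G z $ m $ b) z * (1 / z $ None)"
    by (rule pd_mult; intro diff smooth_intros open_\<Omega> smooth_time smooth_G z) (simp add: time_nz)
  moreover have "pd \<alpha> (\<lambda>z. 1 / z $ None) z = (if \<alpha> = None then - 1 / (z $ None)\<^sup>2 else 0)"
    by (rule pd_time_fun) (auto intro!: derivative_eq_intros simp: time_nz[OF z] power2_eq_square)
  ultimately show ?thesis by (simp add: pd_vec_nth2 diff[OF smooth_G z])
qed

definition w where "w N z = inverse (real N + c z)"

definition Q where "Q p a z = \<Gamma> None z $ p $ a - (if p = a then 1 / (2 * z $ None) else 0)"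

text \<open>The time derivative of \<open>G / \<tau>\<close>.\<close>

definition Pt where "Pt a b z = 2 * Rc z $ a $ b / z $ None - G z $ a $ b / (z $ None)\<^sup>2"

text \<open>\<open>X \<mu> \<alpha> \<beta>\<close> is the Christoffel symbol \<open>\<Gamma>\<^sup>\<mu>\<^sub>\<alpha>\<^sub>\<beta>\<close> of \<open>hat N\<close>. Except in the component with three time indices,
  an upper time index produces the factor \<open>w\<close>, and all other symbols do not depend on \<open>N\<close>.\<close>

definition X :: "'n option \<Rightarrow> 'n option \<Rightarrow> 'n option \<Rightarrow> nat \<Rightarrow> real^('n option) \<Rightarrow> real" where
  "X \<mu> \<alpha> \<beta> N z = (case (\<mu>, \<alpha>, \<beta>) of
      (Some p, Some a, Some b) \<Rightarrow> \<Gamma> (Some a) z $ p $ b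
    | (Some p, Some a, None) \<Rightarrow> Q p a z
    | (Some p, None, Some a) \<Rightarrow> Q p a z
    | (Some p, None, None) \<Rightarrow> - Y p z
    | (None, Some a, Some b) \<Rightarrow> - (w N z * (z $ None ^ 3 * Pt a b z))
    | (None, Some a, None) \<Rightarrow> w N z * (pd (Some a) c z / 2)
    | (None, None, Some a) \<Rightarrow> w N z * (pd (Some a) c z / 2)
    | (None, None, None) \<Rightarrow> w N z * (pd None c z / 2) - 3 / (2 * z $ None))"

lemma X_simps:
  "X (Some p) (Some a) (Some b) N z = \<Gamma> (Some a) z $ p $ b"
  "X (Some p) (Some a) None N z = Q p a z"
  "X (Some p) None (Some a) N z = Q p a z"
  "X (Some p) None None N z = - Y p z"
  "X None (Some a) (Some b) N z = - (w N z * (z $ None ^ 3 * Pt a b z))"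
  "X None (Some a) None N z = w N z * (pd (Some a) c z / 2)"
  "X None None (Some a) N z = w N z * (pd (Some a) c z / 2)"
  "X None None None N z = w N z * (pd None c z / 2) - 3 / (2 * z $ None)"
  by (simp_all add: X_def)

lemma Rc_sym_comp: "z \<in> \<Omega> \<Longrightarrow> Rc z $ p $ q = Rc z $ q $ p"
  using arg_cong[OF sym_Rc, of z "\<lambda>A. A $ q $ p"] by (simp add: transpose_def)

lemma X_sym: "z \<in> \<Omega> \<Longrightarrow> X \<mu> \<alpha> \<beta> N z = X \<mu> \<beta> \<alpha> N z"
  by (cases \<mu>; cases \<alpha>; cases \<beta>)
    (auto simp: X_simps Pt_def Rc_sym_comp[of z] sym_G_comp[of z] torsion_free[of z])

text \<open>Metric compatibility of the connection with symbols \<open>X\<close>, in components.\<close>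

lemma X_lower:
  assumes z: "z \<in> \<Omega>" and pos: "real N + c z > 0"
  shows "(\<Sum>\<beta>\<in>UNIV. hat N z $ \<mu> $ \<beta> * X \<beta> \<alpha> \<nu> N z) + (\<Sum>\<beta>\<in>UNIV. hat N z $ \<nu> $ \<beta> * X \<beta> \<alpha> \<mu> N z) = pd \<alpha> (hat N) z $ \<mu> $ \<nu>"
proof -
  let ?t = "z $ None"
  let ?L = "\<lambda>\<mu> \<alpha> \<nu>. \<Sum>\<beta>\<in>UNIV. hat N z $ \<mu> $ \<beta> * X \<beta> \<alpha> \<nu> N z"
  have t: "?t > 0" by (rule \<Omega>D(3)[OF z])
  have L1: "?L (Some m) \<alpha> \<nu> = (\<Sum>p\<in>UNIV. G z $ m $ p * X (Some p) \<alpha> \<nu> N z) / ?t" for m \<alpha> \<nu>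
    by (simp add: sum_option hat_comp sum_divide_distrib)
  have L2: "?L None \<alpha> \<nu> = F N z * X None \<alpha> \<nu> N z" for \<alpha> \<nu>
    by (simp add: sum_option hat_comp z)
  have Fw: "F N z * (w N z * x) = x / (2 * ?t^3)" for x
    using pos by (simp add: F_def w_def)
  have GQ: "(\<Sum>p\<in>UNIV. G z $ m $ p * Q p a z) = ?t / 2 * Pt m a z" for m a
  proof -
    have "(\<Sum>p\<in>UNIV. G z $ m $ p * Q p a z) = (G z ** \<Gamma> None z) $ m $ a - (\<Sum>p\<in>UNIV. G z $ m $ p * (if p = a then 1 / (2 * ?t) else 0))"
      by (simp add: Q_def right_diff_distrib sum_subtractf matrix_matrix_mult_def)
    also have "\<dots> = Rc z $ m $ a - G z $ m $ a / (2 * ?t)"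
      by (simp add: G_\<Gamma>_None z if_distrib[of "\<lambda>x. _ * x"] cong: if_cong)
    also have "\<dots> = ?t / 2 * Pt m a z"
      using t by (simp add: Pt_def field_simps power2_eq_square)
    finally show ?thesis .
  qed
  have GY: "(\<Sum>p\<in>UNIV. G z $ m $ p * Y p z) = pd (Some m) Rs z / 2" for m
  proof -
    have "(\<Sum>p\<in>UNIV. G z $ m $ p * Y p z) = (\<Sum>p\<in>UNIV. \<Sum>q\<in>UNIV. G z $ m $ p * Gi z $ p $ q * pd (Some q) Rs z) / 2"
      by (simp add: Y_eq z sum_distrib_left sum_divide_distrib mult.assoc)
    also have "\<dots> = (\<Sum>q\<in>UNIV. (G z ** Gi z) $ m $ q * pd (Some q) Rs z) / 2"
      by (subst sum.swap) (simp add: matrix_matrix_mult_def sum_distrib_right)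
    finally show ?thesis by (simp add: G_Gi z mat_def if_distrib[of "\<lambda>x. x * _"] cong: if_cong)
  qed
  have pdh: "pd \<alpha> (hat N) z $ \<mu> $ \<nu> = pd \<alpha> (\<lambda>z. hat N z $ \<mu> $ \<nu>) z" for \<alpha> \<mu> \<nu>
    by (rule pd_vec_nth2[symmetric]) (rule diff[OF smooth_hat z])
  have pd00: "pd \<alpha> (hat N) z $ None $ None = pd \<alpha> (F N) z" for \<alpha>
    unfolding pdh by (rule pd_cong_open[OF open_\<Omega> z]) (rule hat_comp)
  have comp: "pd \<alpha> G z $ m $ b = (\<Sum>p\<in>UNIV. G z $ m $ p * \<Gamma> \<alpha> z $ p $ b) + (\<Sum>p\<in>UNIV. G z $ b $ p * \<Gamma> \<alpha> z $ p $ m)" for \<alpha> m b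
    by (simp add: G_compatible z matrix_matrix_mult_def transpose_def sym_G_comp[OF z, of _ b] mult.commute)
  have Pt_sym: "Pt a b z = Pt b a z" for a b
    by (simp add: Pt_def Rc_sym_comp[OF z, of a] sym_G_comp[OF z, of a])
  show ?thesis
  proof (cases \<alpha>; cases \<mu>; cases \<nu>)
    fix a m b assume "\<alpha> = Some a" "\<mu> = Some m" "\<nu> = Some b"
    then show ?thesis
      by (simp add: L1 X_simps pdh hat_comp pd_hat_space[OF z] comp add_divide_distrib)
  next
    fix a m assume "\<alpha> = Some a" "\<mu> = Some m" "\<nu> = None"
    then show ?thesis using t
      by (simp add: L1 L2 X_simps pdh hat_comp Fw GQ Pt_sym[of m a] power3_eq_cube)
  next
    fix a m assume "\<alpha> = Some a" "\<mu> = None" "\<nu> = Some m"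
    then show ?thesis using t
      by (simp add: L1 L2 X_simps pdh hat_comp Fw GQ Pt_sym[of m a] power3_eq_cube)
  next
    fix a assume "\<alpha> = Some a" "\<mu> = None" "\<nu> = None"
    then show ?thesis
      by (simp add: L2 X_simps pd00 Fw pd_F[OF z])
  next
    fix m b assume "\<alpha> = None" "\<mu> = Some m" "\<nu> = Some b"
    then show ?thesis using t
      by (simp add: L1 X_simps pdh hat_comp pd_hat_space[OF z] GQ Pt_sym[of b m] pd_None_G[OF z])
        (simp add: Pt_def)
  next
    fix m assume "\<alpha> = None" "\<mu> = Some m" "\<nu> = None"
    then show ?thesis using t
      by (simp add: L1 L2 X_simps pdh hat_comp Fw GY sum_negf pd_c_space[OF z])
        (simp add: field_simps power2_eq_square power3_eq_cube)
  next
    fix m assume "\<alpha> = None" "\<mu> = None" "\<nu> = Some m"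
    then show ?thesis using t
      by (simp add: L1 L2 X_simps pdh hat_comp Fw GY sum_negf pd_c_space[OF z])
        (simp add: field_simps power2_eq_square power3_eq_cube)
  next
    assume "\<alpha> = None" "\<mu> = None" "\<nu> = None"
    then show ?thesis
      by (simp add: L2 X_simps pd00 Fw right_diff_distrib pd_F[OF z])
  qed
qed

end

locale hat_chart = flow_chart U I \<gamma>
  for U :: "(real^'n::finite) set" and I :: "real set" and \<gamma> :: "real \<Rightarrow> real^'n \<Rightarrow> real^'n^'n" +
  fixes NN :: "nat set"
  assumes pos_hat: "N \<in> NN \<Longrightarrow> z \<in> \<Omega> \<Longrightarrow> pos_def_matrix (hat N z)"
begin

lemma F_pos: "N \<in> NN \<Longrightarrow> z \<in> \<Omega> \<Longrightarrow> F N z > 0"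
proof -
  assume "N \<in> NN" and z: "z \<in> \<Omega>"
  from pos_hat[OF this] have "axis None 1 \<bullet> (hat N z *v axis None 1) > 0"
    unfolding pos_def_matrix_def by (auto simp: axis_eq_0_iff)
  then show ?thesis using z
    by (simp add: inner_axis' matrix_vector_mul_component inner_axis hat_comp)
qed

lemma pos: "N \<in> NN \<Longrightarrow> z \<in> \<Omega> \<Longrightarrow> real N + c z > 0"
  using F_pos[of N z] \<Omega>D(3)[of z] by (simp add: F_def zero_less_divide_iff)

lemma hat_metric: "N \<in> NN \<Longrightarrow> metric_chart \<Omega> (hat N)"
  by unfold_locales (auto intro: open_\<Omega> smooth_hat sym_hat dest: pos_def_det[OF pos_hat])

lemma lc_hat:
  assumes N: "N \<in> NN" and z: "z \<in> \<Omega>"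
  shows "lc (hat N) \<alpha> z = (\<chi> \<mu> \<beta>. X \<mu> \<alpha> \<beta> N z)"
proof (rule metric_chart.koszul_unique[OF hat_metric[OF N] z, symmetric])
  fix a b p
  show "(\<chi> \<mu> \<beta>. X \<mu> a \<beta> N z) $ p $ b = (\<chi> \<mu> \<beta>. X \<mu> b \<beta> N z) $ p $ a"
    by (simp add: X_sym[OF z, of _ a])
next
  fix \<alpha>
  have "hat N z $ \<mu> $ \<nu> = hat N z $ \<nu> $ \<mu>" for \<mu> \<nu>
    using arg_cong[OF sym_hat[OF z], of "\<lambda>A. A $ \<nu> $ \<mu>"] by (simp add: transpose_def)
  then show "pd \<alpha> (hat N) z = hat N z ** (\<chi> \<mu> \<beta>. X \<mu> \<alpha> \<beta> N z) + transpose (\<chi> \<mu> \<beta>. X \<mu> \<alpha> \<beta> N z) ** hat N z"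
    by (simp add: vec_eq_iff matrix_matrix_mult_def transpose_def X_lower[OF z pos[OF N z], symmetric] mult.commute)
qed

text \<open>The polynomials in \<open>w = 1 / (N + c)\<close> whose coefficients are smooth and do not depend on \<open>N\<close>. Derivatives
  of \<open>w\<close> are \<open>w\<^sup>2\<close> times such a coefficient, so this class of families is closed under differentiation;
  and \<open>w\<close> is locally bounded uniformly in \<open>N\<close>. The first rule is there because the quantities of interest are known only
  on \<open>\<Omega>\<close> and for admissible \<open>N\<close>.\<close>

inductive tame :: "(nat \<Rightarrow> real^('n option) \<Rightarrow> real) \<Rightarrow> bool" where
  tame_cong: "(\<And>N z. N \<in> NN \<Longrightarrow> z \<in> \<Omega> \<Longrightarrow> f N z = g N z) \<Longrightarrow> tame g \<Longrightarrow> tame f"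
| tame_smooth: "smooth_on A \<Omega> \<Longrightarrow> tame (\<lambda>N. A)"
| tame_w: "tame w"
| tame_add: "tame f \<Longrightarrow> tame g \<Longrightarrow> tame (\<lambda>N z. f N z + g N z)"
| tame_mult: "tame f \<Longrightarrow> tame g \<Longrightarrow> tame (\<lambda>N z. f N z * g N z)"

lemma smooth_w: "N \<in> NN \<Longrightarrow> smooth_on (w N) \<Omega>"
  unfolding w_def[abs_def] by (intro smooth_intros open_\<Omega> smooth_c) (use pos in fastforce)

lemma pd_w:
  assumes N: "N \<in> NN" and z: "z \<in> \<Omega>"
  shows "pd \<alpha> (w N) z = - pd \<alpha> c z * (w N z * w N z)"
proof -
  have "pd \<alpha> (\<lambda>z. real N + c z) z = pd \<alpha> c z"
    by (subst pd_add; (intro diff smooth_intros smooth_c z)?) simp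
  then show ?thesis
    unfolding w_def[abs_def] using pos[OF N z]
    by (subst pd_inverse; (intro diff smooth_intros smooth_c open_\<Omega> z)?) (auto simp: power2_eq_square)
qed

lemma smooth_tame: "tame f \<Longrightarrow> N \<in> NN \<Longrightarrow> smooth_on (f N) \<Omega>"
proof (induction rule: tame.induct)
  case (tame_cong f g)
  then show ?case using smooth_on_cong[OF open_\<Omega>, of "g N" "f N"] by simp
qed (auto intro!: smooth_intros smooth_w open_\<Omega>)

lemma tame_pd_ex: "tame f \<Longrightarrow> \<exists>h. tame h \<and> (\<forall>N\<in>NN. \<forall>z\<in>\<Omega>. pd \<alpha> (f N) z = h N z)"
proof (induction rule: tame.induct)
  case (tame_cong f g)
  have "pd \<alpha> (f N) z = pd \<alpha> (g N) z" if "N \<in> NN" "z \<in> \<Omega>" for N z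
    by (rule pd_cong_open[OF open_\<Omega> that(2)]) (rule tame_cong.hyps(1)[OF that(1)])
  then show ?case using tame_cong.IH by auto
next
  case (tame_smooth A)
  then show ?case using tame.tame_smooth[OF smooth_on_pd] by blast
next
  case tame_w
  have "tame (\<lambda>N z. - pd \<alpha> c z * (w N z * w N z))"
    by (intro tame.tame_smooth tame.tame_mult tame.tame_w smooth_intros open_\<Omega> smooth_c)
  then show ?case using pd_w by blast
next
  case (tame_add f g)
  then obtain f' g' where "tame f'" "tame g'" "\<forall>N\<in>NN. \<forall>z\<in>\<Omega>. pd \<alpha> (f N) z = f' N z" "\<forall>N\<in>NN. \<forall>z\<in>\<Omega>. pd \<alpha> (g N) z = g' N z" by blast
  moreover have "pd \<alpha> (\<lambda>z. f N z + g N z) z = pd \<alpha> (f N) z + pd \<alpha> (g N) z" if "N \<in> NN" "z \<in> \<Omega>" for N z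
    by (rule pd_add) (use tame_add that diff smooth_tame in blast)+
  ultimately show ?case by (intro exI[of _ "\<lambda>N z. f' N z + g' N z"]) (auto intro: tame.tame_add)
next
  case (tame_mult f g)
  then obtain f' g' where "tame f'" "tame g'" "\<forall>N\<in>NN. \<forall>z\<in>\<Omega>. pd \<alpha> (f N) z = f' N z" "\<forall>N\<in>NN. \<forall>z\<in>\<Omega>. pd \<alpha> (g N) z = g' N z" by blast
  moreover have "pd \<alpha> (\<lambda>z. f N z * g N z) z = f N z * pd \<alpha> (g N) z + pd \<alpha> (f N) z * g N z" if "N \<in> NN" "z \<in> \<Omega>" for N z
    by (rule pd_mult) (use tame_mult that diff smooth_tame in blast)+
  ultimately show ?case using tame_mult by (intro exI[of _ "\<lambda>N z. f N z * g' N z + f' N z * g N z"]) (auto intro: tame.tame_add tame.tame_mult)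
qed

text \<open>On a compact set \<open>N + c\<close> is smallest for the least admissible \<open>N\<close>, for which it is continuous and positive.\<close>

lemma w_bounded:
  assumes K: "compact K" "K \<subseteq> \<Omega>"
  shows "\<exists>C. \<forall>N\<in>NN. \<forall>z\<in>K. \<bar>w N z\<bar> \<le> C"
proof (cases "NN = {} \<or> K = {}")
  case False
  define N0 where "N0 = (LEAST N. N \<in> NN)"
  have N0: "N0 \<in> NN" "\<And>N. N \<in> NN \<Longrightarrow> N0 \<le> N"
    using False unfolding N0_def by (auto intro: LeastI Least_le)
  have "continuous_on K (\<lambda>z. real N0 + c z)"
    by (intro continuous_intros continuous_on_subset[OF smooth_on_continuous[OF smooth_c] K(2)])
  then obtain z0 where z0: "z0 \<in> K" "\<And>z. z \<in> K \<Longrightarrow> real N0 + c z0 \<le> real N0 + c z"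
    using continuous_attains_inf[OF K(1)] False by blast
  have p: "real N0 + c z0 > 0" using pos N0(1) z0(1) K(2) by blast
  show ?thesis
  proof (intro exI ballI)
    fix N z assume "N \<in> NN" "z \<in> K"
    then have "real N0 + c z0 \<le> real N + c z" using z0(2) N0(2) by fastforce
    then show "\<bar>w N z\<bar> \<le> inverse (real N0 + c z0)" using p by (simp add: w_def le_imp_inverse_le)
  qed
qed auto

lemma tame_bounded:
  assumes "tame f" and K: "compact K" "K \<subseteq> \<Omega>"
  shows "\<exists>C. \<forall>N\<in>NN. \<forall>z\<in>K. \<bar>f N z\<bar> \<le> C"
  using assms(1)
proof (induction rule: tame.induct)
  case (tame_cong f g)
  then show ?case using K(2) by (metis subsetD)
next
  case (tame_smooth A)
  have "compact (A ` K)"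
    by (rule compact_continuous_image[OF continuous_on_subset[OF smooth_on_continuous[OF tame_smooth] K(2)] K(1)])
  then obtain C where "\<forall>x\<in>A ` K. norm x \<le> C" using compact_imp_bounded bounded_iff by metis
  then show ?case by auto
next
  case tame_w
  then show ?case using w_bounded[OF K] .
next
  case (tame_add f g)
  then obtain C D where "\<forall>N\<in>NN. \<forall>z\<in>K. \<bar>f N z\<bar> \<le> C" "\<forall>N\<in>NN. \<forall>z\<in>K. \<bar>g N z\<bar> \<le> D" by blast
  then have "\<forall>N\<in>NN. \<forall>z\<in>K. \<bar>f N z + g N z\<bar> \<le> C + D"
    by (meson abs_triangle_ineq add_mono order_trans)
  then show ?case by blast
next
  case (tame_mult f g)
  then obtain C D where CD: "\<forall>N\<in>NN. \<forall>z\<in>K. \<bar>f N z\<bar> \<le> C" "\<forall>N\<in>NN. \<forall>z\<in>K. \<bar>g N z\<bar> \<le> D" by blast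
  have "\<forall>N\<in>NN. \<forall>z\<in>K. \<bar>f N z * g N z\<bar> \<le> C * D"
    unfolding abs_mult using CD by (auto intro!: mult_mono intro: order_trans[OF abs_ge_zero])
  then show ?case by blast
qed

lemma tame_minus: "tame f \<Longrightarrow> tame (\<lambda>N z. - f N z)"
  using tame_mult[OF tame_smooth[OF smooth_on_const[of "-1"]]] by fastforce

lemma tame_diff: "tame f \<Longrightarrow> tame g \<Longrightarrow> tame (\<lambda>N z. f N z - g N z)"
  using tame_add[OF _ tame_minus] by fastforce

lemma tame_pd: "tame f \<Longrightarrow> tame (\<lambda>N. pd \<alpha> (f N))"
proof -
  assume "tame f"
  then obtain h where "tame h" "\<forall>N\<in>NN. \<forall>z\<in>\<Omega>. pd \<alpha> (f N) z = h N z" using tame_pd_ex by blast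
  then show ?thesis by (intro tame_cong[of "\<lambda>N. pd \<alpha> (f N)" h]) blast+
qed

text \<open>The families of order \<open>1 / N\<close>: the multiples of \<open>w\<close>.\<close>

definition small where "small f \<longleftrightarrow> (\<exists>h. tame h \<and> (\<forall>N\<in>NN. \<forall>z\<in>\<Omega>. f N z = w N z * h N z))"

lemma smallI: "tame h \<Longrightarrow> small (\<lambda>N z. w N z * h N z)" unfolding small_def by blast

lemma small_cong: "(\<And>N z. N \<in> NN \<Longrightarrow> z \<in> \<Omega> \<Longrightarrow> f N z = g N z) \<Longrightarrow> small g \<Longrightarrow> small f"
  unfolding small_def by auto

lemma small_add: "small f \<Longrightarrow> small g \<Longrightarrow> small (\<lambda>N z. f N z + g N z)"
proof -
  assume "small f" "small g"
  then obtain f' g' where h: "tame f'" "tame g'" "\<forall>N\<in>NN. \<forall>z\<in>\<Omega>. f N z = w N z * f' N z" "\<forall>N\<in>NN. \<forall>z\<in>\<Omega>. g N z = w N z * g' N z" unfolding small_def by blast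
  show ?thesis unfolding small_def using tame_add[OF h(1,2)] h by (auto simp: distrib_left[symmetric])
qed

lemma small_mult: "small f \<Longrightarrow> tame g \<Longrightarrow> small (\<lambda>N z. f N z * g N z)"
proof -
  assume g: "tame g" and "small f"
  then obtain f' where h: "tame f'" "\<forall>N\<in>NN. \<forall>z\<in>\<Omega>. f N z = w N z * f' N z" unfolding small_def by blast
  show ?thesis unfolding small_def using tame_mult[OF h(1) g] h by (auto simp: mult.assoc)
qed

lemma small_minus: "small f \<Longrightarrow> small (\<lambda>N z. - f N z)"
  using small_mult[OF _ tame_smooth[OF smooth_on_const[of "-1"]]] by fastforce

lemma small_diff: "small f \<Longrightarrow> small g \<Longrightarrow> small (\<lambda>N z. f N z - g N z)"
  using small_add[OF _ small_minus] by fastforce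

lemma small_sum: "finite B \<Longrightarrow> (\<And>i. i \<in> B \<Longrightarrow> small (f i)) \<Longrightarrow> small (\<lambda>N z. \<Sum>i\<in>B. f i N z)"
proof (induction B rule: finite_induct)
  case empty
  then show ?case using smallI[OF tame_smooth[OF smooth_on_const[of 0]]] by simp
qed (auto intro: small_add)

lemma small_pd: "small f \<Longrightarrow> small (\<lambda>N. pd \<alpha> (f N))"
proof -
  assume "small f"
  then obtain h where h: "tame h" "\<forall>N\<in>NN. \<forall>z\<in>\<Omega>. f N z = w N z * h N z" unfolding small_def by blast
  have "pd \<alpha> (f N) z = w N z * (pd \<alpha> (h N) z - pd \<alpha> c z * (w N z * h N z))" if N: "N \<in> NN" and z: "z \<in> \<Omega>" for N z
  proof -
    have "pd \<alpha> (f N) z = pd \<alpha> (\<lambda>z. w N z * h N z) z"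
      by (rule pd_cong_open[OF open_\<Omega> z]) (use h(2) N in blast)
    also have "\<dots> = w N z * pd \<alpha> (h N) z + pd \<alpha> (w N) z * h N z"
      by (rule pd_mult) (intro diff smooth_w smooth_tame h(1) N z)+
    finally show ?thesis by (simp add: pd_w[OF N z] algebra_simps)
  qed
  moreover have "tame (\<lambda>N z. pd \<alpha> (h N) z - pd \<alpha> c z * (w N z * h N z))"
    by (intro tame_diff tame_pd tame_mult tame_w h(1) tame_smooth smooth_on_pd smooth_c)
  ultimately show ?thesis unfolding small_def by blast
qed

text \<open>Because \<open>N w = 1 - c w\<close>.\<close>

lemma small_tame_scaled:
  assumes "small f"
  shows "tame (\<lambda>N z. real N * f N z)"
proof -
  obtain h where h: "tame h" "\<forall>N\<in>NN. \<forall>z\<in>\<Omega>. f N z = w N z * h N z" using assms unfolding small_def by blast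
  show ?thesis
  proof (rule tame_cong)
    show "tame (\<lambda>N z. (1 - c z * w N z) * h N z)"
      by (intro tame_diff tame_mult tame_w h(1) tame_smooth smooth_on_const smooth_c)
    fix N z assume N: "N \<in> NN" and z: "z \<in> \<Omega>"
    have "real N * w N z = 1 - c z * w N z"
      using pos[OF N z] by (simp add: w_def field_simps)
    then show "real N * f N z = (1 - c z * w N z) * h N z"
      using h(2) N z by (simp add: mult.assoc[symmetric])
  qed
qed

end

section \<open>The soliton tensor in a chart\<close>

context hat_chart
begin

lemma smooth_Y: "smooth_on (Y b) \<Omega>"
  unfolding Y_def[abs_def] by (intro smooth_intros open_\<Omega> smooth_E finite_class.finite_UNIV)

lemma smooth_Q: "smooth_on (Q p a) \<Omega>"
proof -
  have "smooth_on (\<lambda>z. if p = a then 1 / (2 * z $ None) else 0) \<Omega>"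
    by (cases "p = a") (auto intro!: smooth_intros open_\<Omega> smooth_time simp: time_nz)
  then show ?thesis
    unfolding Q_def[abs_def] by (intro smooth_intros open_\<Omega> smooth_\<Gamma>)
qed

lemma smooth_Pt: "smooth_on (Pt a b) \<Omega>"
  unfolding Pt_def[abs_def] by (intro smooth_intros open_\<Omega> smooth_Rc smooth_G smooth_time) (auto simp: time_nz)

lemma tame_X: "tame (X \<mu> \<alpha> \<beta>)"
proof -
  have [intro]: "tame (\<lambda>N z. - (w N z * (z $ None ^ 3 * Pt a b z)))" for a b
    by (intro tame_minus tame_mult tame_w tame_smooth smooth_on_power smooth_time smooth_Pt open_\<Omega>)
  have [intro]: "tame (\<lambda>N z. w N z * (pd \<alpha> c z / 2))" for \<alpha>
    by (intro tame_mult tame_w tame_smooth smooth_on_divide smooth_on_pd smooth_c smooth_on_const open_\<Omega>) simp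
  have [intro]: "tame (\<lambda>N z. w N z * (pd \<alpha> c z / 2) - 3 / (2 * z $ None))" for \<alpha>
    by (intro tame_diff tame_mult tame_w tame_smooth smooth_on_divide smooth_on_mult smooth_on_pd smooth_c smooth_on_const open_\<Omega> smooth_time)
      (auto simp: time_nz)
  have "tame (\<lambda>N z. X \<mu> \<alpha> \<beta> N z)"
    by (cases \<mu>; cases \<alpha>; cases \<beta>)
      (auto simp only: X_simps intro!: tame_smooth smooth_on_vec_nth smooth_on_minus smooth_\<Gamma> smooth_Q smooth_Y open_\<Omega>)
  then show ?thesis by simp
qed

lemma small_X: "small (X None (Some a) \<beta>)" "small (X None None (Some a))"
proof -
  have 1: "small (\<lambda>N z. - (w N z * (z $ None ^ 3 * Pt a b z)))" for b
    by (intro small_minus smallI tame_smooth smooth_on_mult smooth_on_power smooth_time smooth_Pt open_\<Omega>)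
  have 2: "small (\<lambda>N z. w N z * (pd \<alpha> c z / 2))" for \<alpha>
    by (intro smallI tame_smooth smooth_on_divide smooth_on_pd smooth_c smooth_on_const open_\<Omega>) simp
  have "small (\<lambda>N z. X None (Some a) \<beta> N z)"
    by (cases \<beta>) (auto simp only: X_simps intro: 1 2)
  then show "small (X None (Some a) \<beta>)" by simp
  have "small (\<lambda>N z. X None None (Some a) N z)" unfolding X_simps by (rule 2)
  then show "small (X None None (Some a))" by simp
qed

lemma christoffel_hat: "N \<in> NN \<Longrightarrow> z \<in> \<Omega> \<Longrightarrow> christoffel (hat N) \<mu> \<alpha> \<beta> z = X \<mu> \<alpha> \<beta> N z"
  using arg_cong[OF lc_hat, of N z "\<lambda>A. A $ \<mu> $ \<beta>" \<alpha>] by (simp add: lc_def)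

lemma ricci_hat:
  assumes N: "N \<in> NN" and z: "z \<in> \<Omega>"
  shows "ricci (hat N) z $ \<beta> $ \<kappa> = (\<Sum>\<mu>\<in>UNIV. pd \<mu> (X \<mu> \<beta> \<kappa> N) z - pd \<beta> (X \<mu> \<mu> \<kappa> N) z
     + (\<Sum>\<nu>\<in>UNIV. X \<nu> \<beta> \<kappa> N z * X \<mu> \<mu> \<nu> N z - X \<nu> \<mu> \<kappa> N z * X \<mu> \<beta> \<nu> N z))"
proof -
  have "pd i (christoffel (hat N) l j k) z = pd i (X l j k N) z" for i j k l
    by (rule pd_cong_open[OF open_\<Omega> z christoffel_hat[OF N]])
  then show ?thesis
    by (simp add: ricci_def riemann_def pderiv_at_eq_pd christoffel_hat[OF N z])
qed

abbreviation potential :: "nat \<Rightarrow> real^('n option) \<Rightarrow> real" where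
  "potential N z \<equiv> real N / (2 * z $ None)"

lemma hessian_hat:
  assumes N: "N \<in> NN" and z: "z \<in> \<Omega>"
  shows "hessian (hat N) (potential N) z $ \<alpha> $ \<beta> = (if \<alpha> = None \<and> \<beta> = None then real N / (z $ None)^3 else 0)
     + X None \<alpha> \<beta> N z * (real N / (2 * (z $ None)\<^sup>2))"
proof -
  have 1: "pd k (potential N) z = (if k = None then - real N / (2 * (z $ None)\<^sup>2) else 0)" if "z \<in> \<Omega>" for k z
    by (rule pd_time_fun) (auto intro!: derivative_eq_intros simp: time_nz[OF that] field_simps power2_eq_square)
  have 2: "pd \<alpha> (\<lambda>z. - real N / (2 * (z $ None)\<^sup>2)) z = (if \<alpha> = None then real N / (z $ None)^3 else 0)"
    by (rule pd_time_fun) (auto intro!: derivative_eq_intros simp: time_nz[OF z] field_simps power2_eq_square power3_eq_cube)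
  have "pd \<alpha> (pd \<beta> (potential N)) z = pd \<alpha> (\<lambda>z. if \<beta> = None then - real N / (2 * (z $ None)\<^sup>2) else 0) z"
    by (rule pd_cong_open[OF open_\<Omega> z 1])
  then have 3: "pd \<alpha> (pd \<beta> (potential N)) z = (if \<alpha> = None \<and> \<beta> = None then real N / (z $ None)^3 else 0)"
    using 2 by (cases \<beta>) simp_all
  show ?thesis
    by (simp add: hessian_def pderiv_at_eq_pd christoffel_hat[OF N z] sum_option 1 z 3)
qed

definition T where
  "T N z = ricci (hat N) z + hessian (hat N) (potential N) z - (1 / 2) *\<^sub>R hat N z"

lemma N_w: "N \<in> NN \<Longrightarrow> z \<in> \<Omega> \<Longrightarrow> w N z * real N = 1 - c z * w N z"
  using pos[of N z] by (simp add: w_def field_simps)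

text \<open>The factor \<open>N\<close> from the potential is absorbed by the factor \<open>w\<close> of the Christoffel symbols.\<close>

lemma X_hess: "N \<in> NN \<Longrightarrow> z \<in> \<Omega> \<Longrightarrow> w N z * x * (real N / y) = (1 - c z * w N z) * x / y"
  using N_w[of N z] by (metis mult.assoc mult.commute times_divide_eq_right)

text \<open>The part of the space-time Ricci tensor without time indices.\<close>

lemma Rc_X:
  assumes z: "z \<in> \<Omega>"
  shows "Rc z $ a $ b = (\<Sum>i\<in>UNIV. pd (Some i) (X (Some i) (Some a) (Some b) N) z - pd (Some a) (X (Some i) (Some i) (Some b) N) z
     + (\<Sum>m\<in>UNIV. X (Some m) (Some a) (Some b) N z * X (Some i) (Some i) (Some m) N z - X (Some m) (Some i) (Some b) N z * X (Some i) (Some a) (Some m) N z))"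
proof -
  have "X (Some p) (Some a) (Some b) N = (\<lambda>z. \<Gamma> (Some a) z $ p $ b)" for p a b by (simp add: fun_eq_iff X_simps)
  then show ?thesis
    by (simp add: Rc_comp[OF z] curv_def matrix_matrix_mult_def pd_vec_nth2 diff[OF smooth_\<Gamma> z] sum.distrib sum_subtractf mult.commute)
qed

lemma pd_Q:
  assumes z: "z \<in> \<Omega>"
  shows "pd k (Q p a) z = pd k (rr a p) z + (if p = a \<and> k = None then 1 / (2 * (z $ None)\<^sup>2) else 0)"
proof -
  have *: "pd k (\<lambda>z. 1 / (2 * z $ None)) z = (if k = None then - 1 / (2 * (z $ None)\<^sup>2) else 0)"
    by (rule pd_time_fun) (auto intro!: derivative_eq_intros simp: time_nz[OF z] field_simps power2_eq_square)
  show ?thesis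
  proof (cases "p = a")
    case True
    have "pd k (Q p a) z = pd k (\<lambda>z. \<Gamma> None z $ p $ a - 1 / (2 * z $ None)) z"
      using True by (simp add: Q_def[abs_def])
    also have "\<dots> = pd k (\<lambda>z. \<Gamma> None z $ p $ a) z - pd k (\<lambda>z. 1 / (2 * z $ None)) z"
      by (rule pd_diff; intro diff[OF _ z] smooth_intros open_\<Omega> smooth_\<Gamma> smooth_time) (simp add: time_nz)
    finally show ?thesis using True by (simp add: * pd_vec_nth2 diff[OF smooth_\<Gamma> z] pd_flow z)
  next
    case False
    then show ?thesis
      by (simp add: Q_def[abs_def] pd_vec_nth2 diff[OF smooth_\<Gamma> z] pd_flow z)
  qed
qed

lemma sum_Q_diag: "z \<in> \<Omega> \<Longrightarrow> (\<Sum>i\<in>UNIV. Q i i z) = Rs z - real CARD('n) / (2 * z $ None)"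
  by (simp add: Q_def flow Rs_def sum_subtractf)

lemma sum_Q_Q:
  assumes z: "z \<in> \<Omega>"
  shows "(\<Sum>i\<in>UNIV. \<Sum>m\<in>UNIV. Q m i z * Q i m z) = (\<Sum>i\<in>UNIV. \<Sum>m\<in>UNIV. rr m i z * rr i m z)
     - Rs z / z $ None + real CARD('n) / (4 * (z $ None)\<^sup>2)"
proof -
  let ?e = "1 / (2 * z $ None)"
  have "Q m i z * Q i m z = rr m i z * rr i m z - (if m = i then 2 * ?e * rr i i z else 0) + (if m = i then ?e * ?e else 0)" for i m
    by (simp add: Q_def flow[OF z] algebra_simps)
  then have "(\<Sum>i\<in>UNIV. \<Sum>m\<in>UNIV. Q m i z * Q i m z) = (\<Sum>i\<in>UNIV. \<Sum>m\<in>UNIV. rr m i z * rr i m z)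
     - (\<Sum>i\<in>UNIV. 2 * ?e * rr i i z) + (\<Sum>i\<in>(UNIV::'n set). ?e * ?e)"
    by (simp add: sum.distrib sum_subtractf)
  also have "(\<Sum>i\<in>UNIV. 2 * ?e * rr i i z) = 2 * ?e * Rs z"
    by (simp only: Rs_def sum_distrib_left)
  finally show ?thesis by (simp add: power2_eq_square)
qed

text \<open>The contracted Bianchi identity for the endomorphism \<open>Q = Ric - 1 / (2\<tau>)\<close>.\<close>

lemma div_Q:
  assumes z: "z \<in> \<Omega>"
  shows "(\<Sum>i\<in>UNIV. pd (Some i) (Q i a) z - pd (Some a) (Q i i) z
     + (\<Sum>m\<in>UNIV. Q m a z * \<Gamma> (Some i) z $ i $ m - Q m i z * \<Gamma> (Some a) z $ i $ m)) = - pd (Some a) Rs z / 2"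
proof -
  let ?e = "1 / (2 * z $ None)"
  have 1: "(\<Sum>i\<in>UNIV. pd (Some i) (Q i a) z) = (\<Sum>i\<in>UNIV. pd (Some i) (rr a i) z)"
    by (simp add: pd_Q z)
  have 2: "(\<Sum>i\<in>UNIV. pd (Some a) (Q i i) z) = pd (Some a) Rs z"
  proof -
    have "pd (Some a) Rs z = (\<Sum>i\<in>UNIV. pd (Some a) (rr i i) z)"
      unfolding Rs_def[abs_def] by (rule pd_sum) (auto intro: diff[OF smooth_rr z])
    then show ?thesis by (simp add: pd_Q z)
  qed
  have Qg: "Q m i z * g m = g m * rr i m z - (if m = i then ?e * g i else 0)" for m i and g :: "'n \<Rightarrow> real"
    by (simp add: Q_def flow[OF z] algebra_simps)
  have 3: "(\<Sum>i\<in>UNIV. \<Sum>m\<in>UNIV. Q m a z * \<Gamma> (Some i) z $ i $ m) = (\<Sum>i\<in>UNIV. \<Sum>m\<in>UNIV. \<Gamma> (Some i) z $ i $ m * rr a m z) - (\<Sum>i\<in>UNIV. ?e * \<Gamma> (Some i) z $ i $ a)"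
    by (simp add: Qg sum_subtractf)
  have 4: "(\<Sum>i\<in>UNIV. \<Sum>m\<in>UNIV. Q m i z * \<Gamma> (Some a) z $ i $ m) = (\<Sum>i\<in>UNIV. \<Sum>m\<in>UNIV. \<Gamma> (Some a) z $ i $ m * rr i m z) - (\<Sum>i\<in>UNIV. ?e * \<Gamma> (Some a) z $ i $ i)"
    by (simp add: Qg sum_subtractf)
  have 5: "(\<Sum>i\<in>UNIV. ?e * \<Gamma> (Some i) z $ i $ a) = (\<Sum>i\<in>UNIV. ?e * \<Gamma> (Some a) z $ i $ i)"
    by (intro sum.cong refl, subst torsion_free[OF z]) simp
  show ?thesis
    using contracted_bianchi[OF z, of a]
    by (simp only: sum.distrib sum_subtractf 1 2 3 4 5) simp
qed

text \<open>Every term of the space-time Ricci tensor with a time index contains a small Christoffel symbol or a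
  derivative of one, so this tensor differs from \<open>Ric\<close> by a small family. The Hessian contributes
  \<open>- \<tau> / 2 \<cdot> \<partial>\<^sub>\<tau> (g / \<tau>) = - Ric + g / (2 \<tau>)\<close> up to a small family.\<close>

lemma small_T_space: "small (\<lambda>N z. T N z $ Some a $ Some b)"
proof (rule small_cong)
  let ?S = "\<lambda>N z. pd None (X None (Some a) (Some b) N) z - pd (Some a) (X None None (Some b) N) z
    + (X None (Some a) (Some b) N z * X None None None N z - X None None (Some b) N z * X None (Some a) None N z)
    + (\<Sum>m\<in>UNIV. X None None (Some m) N z * X (Some m) (Some a) (Some b) N z - X None (Some a) (Some m) N z * X (Some m) None (Some b) N z)
    + (\<Sum>i\<in>UNIV. X None (Some a) (Some b) N z * X (Some i) (Some i) None N z - X None (Some i) (Some b) N z * X (Some i) (Some a) None N z)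
    + w N z * (c z * z $ None * Pt a b z / 2)"
  show "small ?S"
    by (intro small_add small_diff small_sum small_mult small_pd small_X tame_X finite_class.finite_UNIV smallI
        tame_smooth smooth_on_divide smooth_on_mult smooth_on_const smooth_c smooth_time smooth_Pt open_\<Omega>) simp
  fix N z assume N: "N \<in> NN" and z: "z \<in> \<Omega>"
  let ?t = "z $ None"
  have t: "?t > 0" by (rule \<Omega>D(3)[OF z])
  have R: "ricci (hat N) z $ Some a $ Some b = ?S N z - w N z * (c z * z $ None * Pt a b z / 2) + Rc z $ a $ b"
    unfolding ricci_hat[OF N z] sum_option Rc_X[OF z, of a b N]
    by (simp add: sum.distrib sum_subtractf algebra_simps)
  have H: "hessian (hat N) (potential N) z $ Some a $ Some b = - ((1 - c z * w N z) * (?t * Pt a b z / 2))"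
  proof -
    have "hessian (hat N) (potential N) z $ Some a $ Some b = - (w N z * (?t ^ 3 * Pt a b z) * (real N / (2 * ?t\<^sup>2)))"
      by (simp add: hessian_hat[OF N z] X_simps)
    also have "\<dots> = - ((1 - c z * w N z) * (?t ^ 3 * Pt a b z) / (2 * ?t\<^sup>2))"
      by (simp only: X_hess[OF N z])
    also have "(1 - c z * w N z) * (?t ^ 3 * Pt a b z) / (2 * ?t\<^sup>2) = (1 - c z * w N z) * (?t * Pt a b z / 2)"
      using t by (simp add: power2_eq_square power3_eq_cube)
    finally show ?thesis .
  qed
  have M: "(1 - c z * w N z) * (?t * Pt a b z / 2) = ?t * Pt a b z / 2 - w N z * (c z * ?t * Pt a b z / 2)"
    by (simp add: field_simps)
  have P: "?t * Pt a b z / 2 = Rc z $ a $ b - G z $ a $ b / (2 * ?t)"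
    using t by (simp add: Pt_def field_simps power2_eq_square)
  have "T N z $ Some a $ Some b = ricci (hat N) z $ Some a $ Some b - (1 - c z * w N z) * (?t * Pt a b z / 2) - G z $ a $ b / (2 * ?t)"
    by (simp add: T_def H hat_comp)
  also have "\<dots> = ?S N z - w N z * (c z * z $ None * Pt a b z / 2) + Rc z $ a $ b - ?t * Pt a b z / 2 + w N z * (c z * z $ None * Pt a b z / 2) - G z $ a $ b / (2 * ?t)"
    unfolding R M by simp
  finally show "T N z $ Some a $ Some b = ?S N z" unfolding P by simp
qed

text \<open>The leading parts are \<open>div Ric - dR = - dR / 2\<close> from the Ricci tensor, by the contracted Bianchi identity,
  and \<open>dR / 2\<close> from the Hessian.\<close>

lemma small_T_mixed: "small (\<lambda>N z. T N z $ Some a $ None)"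
proof (rule small_cong)
  let ?s = "\<lambda>N z. w N z * (pd None c z / 2)"
  let ?S = "\<lambda>N z. pd None (X None (Some a) None N) z - pd (Some a) (?s N) z
    + (\<Sum>m\<in>UNIV. X None None (Some m) N z * X (Some m) (Some a) None N z - X None (Some a) (Some m) N z * X (Some m) None None N z)
    + (\<Sum>i\<in>UNIV. X None (Some a) None N z * X (Some i) (Some i) None N z - X None (Some i) None N z * X (Some i) (Some a) None N z)
    - w N z * (c z * pd (Some a) c z / (4 * (z $ None)\<^sup>2))"
  show "small ?S"
    by (intro small_add small_diff small_sum small_mult small_pd[of ?s] small_pd small_X tame_X finite_class.finite_UNIV smallI
        tame_smooth smooth_on_divide smooth_on_mult smooth_on_pd smooth_on_const smooth_c smooth_time smooth_on_power open_\<Omega>) (auto simp: time_nz)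
  fix N z assume N: "N \<in> NN" and z: "z \<in> \<Omega>"
  let ?t = "z $ None"
  have t: "?t > 0" by (rule \<Omega>D(3)[OF z])
  \<comment> \<open>The \<open>N\<close>-independent part of this symbol depends on time only.\<close>
  have p000: "pd (Some a) (X None None None N) z = pd (Some a) (?s N) z"
  proof -
    have "pd (Some a) (\<lambda>z. 3 / (2 * z $ None)) z = 0"
      by (subst pd_time_fun[where d = "- 3 / (2 * ?t\<^sup>2)"])
        (auto intro!: derivative_eq_intros simp: time_nz[OF z] field_simps power2_eq_square)
    moreover have "pd (Some a) (\<lambda>z. ?s N z - 3 / (2 * z $ None)) z = pd (Some a) (?s N) z - pd (Some a) (\<lambda>z. 3 / (2 * z $ None)) z"
      by (rule pd_diff; intro diff[OF _ z] smooth_intros open_\<Omega> smooth_w[OF N] smooth_c smooth_time) (auto simp: time_nz)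
    moreover have "X None None None N = (\<lambda>z. ?s N z - 3 / (2 * z $ None))" by (simp add: fun_eq_iff X_simps)
    ultimately show ?thesis by simp
  qed
  have XQ: "X (Some p) (Some b) None N = Q p b" for p b by (simp add: fun_eq_iff X_simps)
  have R: "ricci (hat N) z $ Some a $ None = ?S N z + w N z * (c z * pd (Some a) c z / (4 * (z $ None)\<^sup>2)) - pd (Some a) Rs z / 2"
    unfolding ricci_hat[OF N z] sum_option p000 XQ using div_Q[OF z, of a]
    by (simp add: X_simps(1) sum.distrib sum_subtractf algebra_simps)
  have "T N z $ Some a $ None = ricci (hat N) z $ Some a $ None + (1 - c z * w N z) * (pd (Some a) c z / 2) / (2 * ?t\<^sup>2)"
    by (simp add: T_def hessian_hat[OF N z] hat_comp X_simps X_hess[OF N z, symmetric])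
  also have "(1 - c z * w N z) * (pd (Some a) c z / 2) / (2 * ?t\<^sup>2) = pd (Some a) c z / (4 * ?t\<^sup>2) - w N z * (c z * pd (Some a) c z / (4 * (z $ None)\<^sup>2))"
    using t by (simp add: field_simps)
  also have "pd (Some a) c z / (4 * ?t\<^sup>2) = pd (Some a) Rs z / 2"
    using t by (simp add: pd_c_space[OF z])
  finally show "T N z $ Some a $ None = ?S N z" unfolding R by simp
qed

text \<open>The terms proportional to \<open>N\<close> cancel. Since \<open>- \<Delta> R / 2 - |Ric|\<^sup>2 = \<partial>\<^sub>\<tau> R / 2\<close> by the evolution
  equation, the leading part of the Ricci tensor is \<open>- \<partial>\<^sub>\<tau> R / 2 - R / (2 \<tau>)\<close>; the Hessian and \<open>- hat N / 2\<close> contribute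
  its negative.\<close>

lemma small_T_time: "small (\<lambda>N z. T N z $ None $ None)"
proof (rule small_cong)
  let ?s = "\<lambda>N z. w N z * (pd None c z / 2)"
  let ?S = "\<lambda>N z. ?s N z * (\<Sum>i\<in>UNIV. Q i i z) + (\<Sum>i\<in>UNIV. X None (Some i) None N z * Y i z)
    - w N z * (c z * pd None c z / (4 * (z $ None)\<^sup>2))"
  show "small ?S"
    by (intro small_add small_diff small_sum small_mult small_X finite_class.finite_UNIV smallI
        tame_smooth smooth_on_divide smooth_on_mult smooth_on_sum smooth_on_pd smooth_on_const smooth_c smooth_time smooth_on_power smooth_Q smooth_Y open_\<Omega>) (auto simp: time_nz)
  fix N z assume N: "N \<in> NN" and z: "z \<in> \<Omega>"
  let ?t = "z $ None" and ?n = "real CARD('n)"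
  have t: "?t > 0" by (rule \<Omega>D(3)[OF z])
  have XQ: "X (Some p) (Some b) None N = Q p b" "X (Some p) None (Some b) N = Q p b" for p b by (simp_all add: fun_eq_iff X_simps)
  have XY: "X (Some p) None None N = (\<lambda>z. - Y p z)" for p by (simp add: fun_eq_iff X_simps)
  have pdY: "pd k (\<lambda>z. - Y p z) z = - pd k (Y p) z" for k p
    by (rule pd_minus) (rule diff[OF smooth_Y z])
  have pdR: "(\<Sum>i\<in>UNIV. pd None (rr i i) z) = pd None Rs z"
    unfolding Rs_def[abs_def] by (rule pd_sum[symmetric]) (auto intro: diff[OF smooth_rr z])
  have "ricci (hat N) z $ None $ None = - (\<Sum>i\<in>UNIV. pd (Some i) (Y i) z) - (\<Sum>i\<in>UNIV. pd None (Q i i) z)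
     + X None None None N z * (\<Sum>i\<in>UNIV. Q i i z) + (\<Sum>i\<in>UNIV. X None (Some i) None N z * Y i z)
     - (\<Sum>i\<in>UNIV. \<Sum>m\<in>UNIV. \<Gamma> (Some i) z $ i $ m * Y m z) - (\<Sum>i\<in>UNIV. \<Sum>m\<in>UNIV. Q m i z * Q i m z)"
    unfolding ricci_hat[OF N z] sum_option XQ XY pdY
    by (simp add: X_simps(1) sum.distrib sum_subtractf sum_negf sum_distrib_left algebra_simps)
  also have "(\<Sum>i\<in>UNIV. pd None (Q i i) z) = pd None Rs z + ?n / (2 * ?t\<^sup>2)"
    by (simp add: pd_Q z sum.distrib pdR)
  also have "X None None None N z * (\<Sum>i\<in>UNIV. Q i i z) = ?s N z * (\<Sum>i\<in>UNIV. Q i i z) - 3 / (2 * ?t) * (Rs z - ?n / (2 * ?t))"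
    by (simp add: X_simps left_diff_distrib sum_Q_diag z)
  finally have ric: "ricci (hat N) z $ None $ None = - (\<Sum>i\<in>UNIV. pd (Some i) (Y i) z) - (pd None Rs z + ?n / (2 * ?t\<^sup>2))
     + (?s N z * (\<Sum>i\<in>UNIV. Q i i z) - 3 / (2 * ?t) * (Rs z - ?n / (2 * ?t))) + (\<Sum>i\<in>UNIV. X None (Some i) None N z * Y i z)
     - (\<Sum>i\<in>UNIV. \<Sum>m\<in>UNIV. \<Gamma> (Some i) z $ i $ m * Y m z) - (\<Sum>i\<in>UNIV. \<Sum>m\<in>UNIV. Q m i z * Q i m z)" .
  have R: "ricci (hat N) z $ None $ None = ?S N z + w N z * (c z * pd None c z / (4 * (z $ None)\<^sup>2)) - pd None Rs z / 2 - Rs z / (2 * ?t)"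
  proof -
    have "- (3 / (2 * ?t) * (Rs z - ?n / (2 * ?t))) + Rs z / ?t - ?n / (4 * ?t\<^sup>2) - ?n / (2 * ?t\<^sup>2) = - (Rs z / (2 * ?t))"
      using t by (simp add: field_simps power2_eq_square)
    note K = this
    have "ric = - A - (Rt + n2) + (sQ - B1) + B - C - QQ \<Longrightarrow> - B1 + r - n4 - n2 = - h \<Longrightarrow> Rt = - 2 * D - 2 * (A + C)
      \<Longrightarrow> QQ = D - r + n4 \<Longrightarrow> ric = (sQ + B - W) + W - Rt / 2 - h" for ric A Rt n2 sQ B1 B C QQ r n4 h D W :: real
      by argo
    from this[OF ric K evolution_scalar_curvature[OF z] sum_Q_Q[OF z]] show ?thesis .
  qed
  have "T N z $ None $ None = ricci (hat N) z $ None $ None + real N / ?t^3 + X None None None N z * (real N / (2 * ?t\<^sup>2)) - F N z / 2"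
    by (simp add: T_def hessian_hat[OF N z] hat_comp z)
  also have "X None None None N z * (real N / (2 * ?t\<^sup>2)) = (1 - c z * w N z) * (pd None c z / 2) / (2 * ?t\<^sup>2) - 3 / (2 * ?t) * (real N / (2 * ?t\<^sup>2))"
    by (simp only: X_simps left_diff_distrib[of _ "3 / (2 * ?t)"] X_hess[OF N z])
  also have "(1 - c z * w N z) * (pd None c z / 2) / (2 * ?t\<^sup>2) = pd None c z / (4 * ?t\<^sup>2) - w N z * (c z * pd None c z / (4 * (z $ None)\<^sup>2))"
    using t by (simp add: field_simps)
  also have "pd None c z / (4 * ?t\<^sup>2) = Rs z / ?t + pd None Rs z / 2 - ?n / (4 * ?t\<^sup>2)"
    using t by (simp add: pd_c_time[OF z] field_simps power2_eq_square)
  also have "F N z / 2 = real N / (4 * ?t^3) + Rs z / (2 * ?t) - ?n / (4 * ?t\<^sup>2)"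
    using t by (simp add: F_def c_def field_simps power2_eq_square power3_eq_cube)
  finally have E: "T N z $ None $ None = ricci (hat N) z $ None $ None + real N / ?t^3
     + ((Rs z / ?t + pd None Rs z / 2 - ?n / (4 * ?t\<^sup>2) - w N z * (c z * pd None c z / (4 * (z $ None)\<^sup>2))) - 3 / (2 * ?t) * (real N / (2 * ?t\<^sup>2)))
     - (real N / (4 * ?t^3) + Rs z / (2 * ?t) - ?n / (4 * ?t\<^sup>2))" .
  have K: "real N / ?t^3 - 3 / (2 * ?t) * (real N / (2 * ?t\<^sup>2)) = real N / (4 * ?t^3)" "Rs z / ?t = Rs z / (2 * ?t) + Rs z / (2 * ?t)"
    using t by (simp_all add: field_simps power2_eq_square power3_eq_cube)
  have "TT = ric + p + ((rt + q - n4 - W) - u) - (N4 + h - n4) \<Longrightarrow> ric = (s + B - W) + W - q - h \<Longrightarrow> p - u = N4 \<Longrightarrow> rt = h + h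
     \<Longrightarrow> TT = s + B - W" for TT ric p rt q n4 W u N4 h s B :: real
    by argo
  from this[OF E R K] show "T N z $ None $ None = ?S N z" .
qed

lemma T_sym: "N \<in> NN \<Longrightarrow> z \<in> \<Omega> \<Longrightarrow> T N z $ \<alpha> $ \<beta> = T N z $ \<beta> $ \<alpha>"
proof -
  assume N: "N \<in> NN" and z: "z \<in> \<Omega>"
  have "hat N z $ \<alpha> $ \<beta> = hat N z $ \<beta> $ \<alpha>"
    using arg_cong[OF sym_hat[OF z], of "\<lambda>A. A $ \<beta> $ \<alpha>"] by (simp add: transpose_def)
  then show ?thesis
    by (simp add: T_def metric_chart.ricci_sym[OF hat_metric[OF N] z, of \<alpha> \<beta>] hessian_hat[OF N z] X_sym[OF z, of _ \<alpha> \<beta>] conj_commute)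
qed

lemma small_T: "small (\<lambda>N z. T N z $ \<alpha> $ \<beta>)"
proof (cases \<alpha>; cases \<beta>)
  fix a assume "\<alpha> = None" "\<beta> = Some a"
  then show ?thesis
    using small_cong[OF _ small_T_mixed[of a], of "\<lambda>N z. T N z $ \<alpha> $ \<beta>"] T_sym by auto
qed (simp_all add: small_T_space small_T_mixed small_T_time)

theorem scaled_T_bounded:
  assumes "compact K" "K \<subseteq> \<Omega>"
  shows "\<exists>C. \<forall>N\<in>NN. \<forall>z\<in>K. \<bar>real N * T N z $ \<alpha> $ \<beta>\<bar> \<le> C"
  by (rule tame_bounded[OF small_tame_scaled[OF small_T] assms])

end

section \<open>Tensors and their norms under a change of chart\<close>

lemma matrix_inv_congruence:
  fixes J H :: "real^'n::finite^'n"
  assumes "det J \<noteq> 0" "det H \<noteq> 0"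
  shows "matrix_inv (transpose J ** H ** J) = matrix_inv J ** matrix_inv H ** transpose (matrix_inv J)"
proof (rule matrix_inv_unique)
  have JT: "transpose J ** transpose (matrix_inv J) = mat 1"
    by (simp add: matrix_transpose_mul[symmetric] matrix_inv_left assms)
  have "transpose J ** H ** J ** (matrix_inv J ** matrix_inv H ** transpose (matrix_inv J))
     = transpose J ** (H ** ((J ** matrix_inv J) ** matrix_inv H)) ** transpose (matrix_inv J)"
    by (simp only: matrix_mul_assoc)
  then show "transpose J ** H ** J ** (matrix_inv J ** matrix_inv H ** transpose (matrix_inv J)) = mat 1"
    by (simp add: matrix_inv_right assms JT)
qed

text \<open>In this form the invariance under a change of basis is the cyclicity of the trace.\<close>

lemma tensor2_norm_trace:
  "tensor2_norm H B = sqrt (trace (transpose B ** matrix_inv H ** B ** transpose (matrix_inv H)))"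
proof -
  let ?K = "matrix_inv H"
  have "(\<Sum>k\<in>UNIV. \<Sum>l\<in>UNIV. \<Sum>p\<in>UNIV. \<Sum>q\<in>UNIV. ?K $ k $ p * ?K $ l $ q * B $ k $ l * B $ p $ q)
      = (\<Sum>l\<in>UNIV. \<Sum>p\<in>UNIV. \<Sum>k\<in>UNIV. \<Sum>q\<in>UNIV. ?K $ k $ p * ?K $ l $ q * B $ k $ l * B $ p $ q)"
    by (rule sum_rotate)
  also have "\<dots> = (\<Sum>l\<in>UNIV. \<Sum>q\<in>UNIV. \<Sum>p\<in>UNIV. \<Sum>k\<in>UNIV. ?K $ k $ p * ?K $ l $ q * B $ k $ l * B $ p $ q)"
    by (rule sum.cong[OF refl], rule sum_rotate[symmetric])
  also have "\<dots> = trace (transpose B ** ?K ** B ** transpose ?K)"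
    by (simp add: trace_def matrix_matrix_mult_def transpose_def sum_distrib_right sum_distrib_left mult_ac)
  finally show ?thesis by (simp add: tensor2_norm_def)
qed

lemma tensor2_norm_congruence:
  fixes J H B :: "real^'n::finite^'n"
  assumes J: "det J \<noteq> 0" and H: "det H \<noteq> 0"
  shows "tensor2_norm (transpose J ** H ** J) (transpose J ** B ** J) = tensor2_norm H B"
proof -
  let ?Ji = "matrix_inv J" and ?K = "matrix_inv H"
  have JJ: "J ** ?Ji = mat 1" by (rule matrix_inv_right[OF J])
  have JT: "transpose ?Ji ** transpose J = mat 1"
    by (simp add: matrix_transpose_mul[symmetric] matrix_inv_right J)
  have "transpose (transpose J ** B ** J) ** (?Ji ** ?K ** transpose ?Ji) ** (transpose J ** B ** J) ** transpose (?Ji ** ?K ** transpose ?Ji)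
     = transpose J ** transpose B ** (J ** ?Ji) ** ?K ** (transpose ?Ji ** transpose J) ** B ** (J ** ?Ji) ** transpose ?K ** transpose ?Ji"
    by (simp only: matrix_transpose_mul transpose_transpose matrix_mul_assoc)
  also have "\<dots> = transpose J ** (transpose B ** ?K ** B ** transpose ?K) ** transpose ?Ji"
    by (simp only: JJ JT matrix_mul_rid matrix_mul_assoc)
  finally show ?thesis
    unfolding tensor2_norm_trace matrix_inv_congruence[OF J H]
    by (simp add: trace_mul_sym[of _ "transpose ?Ji"] matrix_mul_assoc JT)
qed

lemma tensor2_norm_le:
  fixes H B :: "real^'n::finite^'n"
  assumes "\<And>k p. \<bar>matrix_inv H $ k $ p\<bar> \<le> E" "\<And>k l. \<bar>B $ k $ l\<bar> \<le> D"
  shows "tensor2_norm H B \<le> sqrt (\<Sum>k\<in>(UNIV::'n set). \<Sum>l\<in>(UNIV::'n set). \<Sum>p\<in>(UNIV::'n set). \<Sum>q\<in>(UNIV::'n set). E * E * D * D)"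
  unfolding tensor2_norm_def
proof (intro real_sqrt_le_mono sum_mono)
  fix k l p q
  have "0 \<le> E" "0 \<le> D" using assms abs_ge_zero order_trans by metis+
  have "\<bar>matrix_inv H $ k $ p * matrix_inv H $ l $ q * B $ k $ l * B $ p $ q\<bar> \<le> E * E * D * D"
    unfolding abs_mult by (intro mult_mono assms mult_nonneg_nonneg abs_ge_zero \<open>0 \<le> E\<close> \<open>0 \<le> D\<close>)
  then show "matrix_inv H $ k $ p * matrix_inv H $ l $ q * B $ k $ l * B $ p $ q \<le> E * E * D * D"
    by linarith
qed

lemma scalar_curv_trace: "scalar_curv G y = trace (matrix_inv (G y) ** transpose (ricci G y))"
  by (simp add: scalar_curv_def trace_def matrix_matrix_mult_def transpose_def)

lemma (in chart_change) scalar_curv_pullback: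
  assumes y: "y \<in> U"
  shows "scalar_curv G y = scalar_curv H (\<phi> y)"
proof -
  let ?Ji = "matrix_inv (J y)" and ?K = "matrix_inv (H (\<phi> y))" and ?R = "ricci H (\<phi> y)"
  have JJ: "J y ** ?Ji = mat 1" by (rule matrix_inv_right[OF det_J[OF y]])
  have JT: "transpose ?Ji ** transpose (J y) = mat 1"
    by (simp add: matrix_transpose_mul[symmetric] matrix_inv_right det_J[OF y])
  have Gi: "matrix_inv (G y) = ?Ji ** ?K ** transpose ?Ji"
    using pullback[OF y] matrix_inv_congruence[OF det_J[OF y] V.det_G[OF image[OF y]]] by (simp add: J_eq y)
  have "scalar_curv G y = trace (?Ji ** (?K ** (transpose ?Ji ** transpose (J y)) ** transpose ?R ** J y))"
    unfolding scalar_curv_trace Gi ricci_pullback[OF y]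
    by (simp only: matrix_transpose_mul transpose_transpose matrix_mul_assoc)
  also have "\<dots> = trace (?K ** transpose ?R ** (J y ** ?Ji))"
    by (subst trace_mul_sym) (simp only: JT matrix_mul_rid matrix_mul_assoc)
  finally show ?thesis by (simp add: JJ scalar_curv_trace)
qed

lemma metric_chart_subset: "metric_chart S G \<Longrightarrow> open T \<Longrightarrow> T \<subseteq> S \<Longrightarrow> metric_chart T G"
  unfolding metric_chart_def using smooth_on_subset by blast

lemma hessian_cong:
  assumes "open S" "z \<in> S" "\<And>x. x \<in> S \<Longrightarrow> f x = f' x"
  shows "hessian G f z = hessian G f' z"
proof -
  have 1: "pd j f x = pd j f' x" if "x \<in> S" for j x
    by (rule pd_cong_open[OF assms(1) that assms(3)])
  have "pd i (pd j f) z = pd i (pd j f') z" for i j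
    by (rule pd_cong_open[OF assms(1,2) 1])
  then show ?thesis by (simp add: hessian_def pderiv_at_eq_pd 1 assms(2))
qed

section \<open>The space-time of a reverse Ricci flow\<close>

locale flow_on_manifold =
  fixes M :: "'m::{t2_space,second_countable_topology} set"
    and A :: "('i, 'm, 'n::finite) atlas" and I :: "real set"
    and g :: "real \<Rightarrow> ('i, 'n) tensor2"
  assumes manifold: "smooth_manifold M A"
    and open_I: "open I" and I_pos: "t \<in> I \<Longrightarrow> t > 0"
    and flow: "reverse_ricci_flow A I g"
begin

abbreviation "\<P> \<equiv> prod_atlas A I"

abbreviation "\<Omega> i \<equiv> {z. sp z \<in> chart_img A i \<and> z $ None \<in> I}"

lemma chart_homeo: "homeomorphism (chart_dom A i) (chart_img A i) (chart_map A i) (chart_inv A i)"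
  and chart_dom_openin: "openin (top_of_set M) (chart_dom A i)"
  and open_chart_img: "open (chart_img A i)"
  using manifold unfolding smooth_manifold_def by auto

lemma chart_inv_map: "x \<in> chart_dom A i \<Longrightarrow> chart_inv A i (chart_map A i x) = x"
  using homeomorphism_apply1[OF chart_homeo] .

lemma chart_map_inv: "y \<in> chart_img A i \<Longrightarrow> chart_map A i (chart_inv A i y) = y"
  and chart_inv_dom: "y \<in> chart_img A i \<Longrightarrow> chart_inv A i y \<in> chart_dom A i"
  using homeomorphism_apply2[OF chart_homeo] homeomorphism_image2[OF chart_homeo] by blast+

lemma metric: "t \<in> I \<Longrightarrow> riemannian_metric A (g t)"
  using flow unfolding reverse_ricci_flow_def by blast

lemma flow_chart: "flow_chart (chart_img A i) I (\<lambda>t. g t i)"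
proof
  show "smooth_on (\<lambda>(y, t). g t i y) (chart_img A i \<times> I)"
    using flow unfolding reverse_ricci_flow_def by blast
  show "((\<lambda>s. g s i y) has_vector_derivative 2 *\<^sub>R ricci (g t i) y) (at t)" if "t \<in> I" "y \<in> chart_img A i" for t y
    using flow that unfolding reverse_ricci_flow_def Ric_def by blast
  show "det (g t i y) \<noteq> 0" if "t \<in> I" "y \<in> chart_img A i" for t y
    using metric[OF that(1)] that(2) by (intro pos_def_det) (auto simp: riemannian_metric_def pos_def_tensor_def)
qed (use open_chart_img open_I I_pos metric in \<open>auto simp: riemannian_metric_def\<close>)

lemma flow_chart_\<Omega>: "flow_chart.\<Omega> (chart_img A i) I = \<Omega> i"
  using flow_chart.\<Omega>_def[OF flow_chart] .

lemma open_\<Omega>: "open (\<Omega> i)"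
  using flow_chart.open_\<Omega>[OF flow_chart] by (simp add: flow_chart_\<Omega>)

lemma ghat_eq_hat: "ghat g N i = flow_chart.hat (\<lambda>t. g t i) N"
  unfolding fun_eq_iff ghat_def flow_chart.hat_def[OF flow_chart] sp_def Let_def by simp

lemma prod_dom: "chart_dom \<P> i = chart_dom A i \<times> I"
  by (simp add: chart_dom_def prod_atlas_def)

lemma prod_map: "chart_map \<P> i (x, t) = join (chart_map A i x) t"
  by (simp add: chart_map_def prod_atlas_def join_def)

lemma prod_img: "chart_img \<P> i = \<Omega> i"
proof -
  have "z \<in> \<Omega> i \<Longrightarrow> z = chart_map \<P> i (chart_inv A i (sp z), z $ None)" for z
    by (simp add: prod_map chart_map_inv)
  moreover have "z \<in> \<Omega> i \<Longrightarrow> (chart_inv A i (sp z), z $ None) \<in> chart_dom \<P> i" for z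
    by (simp add: prod_dom chart_inv_dom)
  moreover have "p \<in> chart_dom \<P> i \<Longrightarrow> chart_map \<P> i p \<in> \<Omega> i" for p
    by (cases p) (auto simp: prod_dom prod_map chart_img_def)
  ultimately show ?thesis unfolding chart_img_def[of "\<P>"] by blast
qed

lemma prod_inv:
  assumes "z \<in> \<Omega> i"
  shows "chart_inv \<P> i z = (chart_inv A i (sp z), z $ None)"
  unfolding chart_inv_def[of "\<P>"]
proof (rule inv_into_f_eq)
  show "inj_on (chart_map \<P> i) (chart_dom \<P> i)"
  proof (rule inj_onI)
    fix p q assume pq: "p \<in> chart_dom \<P> i" "q \<in> chart_dom \<P> i"
      "chart_map \<P> i p = chart_map \<P> i q"
    obtain x t x' t' where [simp]: "p = (x, t)" "q = (x', t')" by fastforce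
    have "sp (join (chart_map A i x) t) = sp (join (chart_map A i x') t')" "join (chart_map A i x) t $ None = join (chart_map A i x') t' $ None"
      using pq(3) by (simp_all only: \<open>p = _\<close> \<open>q = _\<close> prod_map)
    then have "chart_inv A i (chart_map A i x) = chart_inv A i (chart_map A i x')" "t = t'" by simp_all
    then show "p = q" using pq(1,2) by (simp add: chart_inv_map prod_dom)
  qed
qed (use assms in \<open>auto simp: prod_dom prod_map chart_inv_dom chart_map_inv\<close>)

definition overlap where "overlap i j = chart_map A i ` (chart_dom A i \<inter> chart_dom A j)"

definition overlap_st where "overlap_st i j = {z. sp z \<in> overlap i j \<and> z $ None \<in> I}"

text \<open>The transition maps of the product atlas.\<close>

definition trans where "trans i j z = join (transition A i j (sp z)) (z $ None)"

lemma overlap_subset: "overlap i j \<subseteq> chart_img A i"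
  by (auto simp: overlap_def chart_img_def)

lemma open_overlap: "open (overlap i j)"
proof -
  have "openin (top_of_set (chart_dom A i)) (chart_dom A i \<inter> chart_dom A j)"
    using openin_subset_trans[OF openin_Int[OF chart_dom_openin chart_dom_openin, of i j], of "chart_dom A i"]
      openin_imp_subset[OF chart_dom_openin] by blast
  from homeomorphism_imp_open_map[OF chart_homeo this]
  show ?thesis unfolding overlap_def by (rule openin_open_trans[OF _ open_chart_img])
qed

lemma open_overlap_st: "open (overlap_st i j)"
  unfolding overlap_st_def by (rule open_space_time[OF open_overlap open_I])

lemma overlap_transition: "y \<in> overlap i j \<Longrightarrow> transition A i j y \<in> chart_img A j"
  by (auto simp: overlap_def transition_def chart_inv_map chart_img_def)

lemma smooth_transition: "smooth_on (transition A i j) (overlap i j)"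
  using manifold unfolding smooth_manifold_def overlap_def by blast

lemma tensor2_transition:
  assumes "is_tensor2 A H" "y \<in> overlap i j"
  shows "H i y = transpose (jacobian (transition A i j) (at y)) ** H j (transition A i j y) ** jacobian (transition A i j) (at y)"
proof -
  obtain x where x: "x \<in> chart_dom A i \<inter> chart_dom A j" "y = chart_map A i x" using assms(2) overlap_def by auto
  then show ?thesis using assms(1) by (auto simp: is_tensor2_def Let_def transition_def chart_inv_map)
qed

lemma space_change:
  assumes t: "t \<in> I"
  shows "chart_change (overlap i j) (chart_img A j) (g t i) (g t j) (transition A i j)"
proof -
  have m: "metric_chart (chart_img A k) (g t k)" for k
    using flow_chart.slice[OF flow_chart t] .
  show ?thesis
    unfolding chart_change_def chart_change_axioms_def
    using metric_chart_subset[OF m open_overlap overlap_subset] m smooth_transition overlap_transition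
      tensor2_transition metric[OF t] by (auto simp: riemannian_metric_def)
qed

lemma smooth_trans: "smooth_on (trans i j) (overlap_st i j)"
proof -
  have 1: "smooth_on (\<lambda>z. transition A i j (sp z)) (overlap_st i j)"
    by (rule smooth_on_compose[OF open_overlap_st smooth_on_bounded_linear[OF bounded_linear_sp open_overlap_st] smooth_transition])
      (auto simp: overlap_st_def)
  have "smooth_on (\<lambda>z. case \<alpha> of None \<Rightarrow> z $ None | Some k \<Rightarrow> transition A i j (sp z) $ k) (overlap_st i j)" for \<alpha>
    using smooth_on_bounded_linear[OF bounded_linear_vec_nth[of None] open_overlap_st] smooth_on_vec_nth[OF open_overlap_st 1]
    by (cases \<alpha>) auto
  from smooth_on_vec_lambda[OF open_overlap_st this] show ?thesis
    by (simp add: trans_def[abs_def] join_def)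
qed

lemma jacobian_trans:
  assumes z: "z \<in> overlap_st i j"
  shows "jacobian (trans i j) (at z) $ Some d $ Some a = jacobian (transition A i j) (at (sp z)) $ d $ a"
    "jacobian (trans i j) (at z) $ None $ Some a = 0"
    "jacobian (trans i j) (at z) $ Some d $ None = 0"
    "jacobian (trans i j) (at z) $ None $ None = 1"
proof -
  note D = smooth_on_differentiable[OF smooth_trans z]
  have "sp z \<in> overlap i j" using z by (simp add: overlap_st_def)
  note D' = smooth_on_differentiable[OF smooth_transition this]
  have J: "jacobian (trans i j) (at z) $ \<mu> $ \<alpha> = pd \<alpha> (\<lambda>z. trans i j z $ \<mu>) z" for \<mu> \<alpha>
    by (simp add: jacobian_pd[OF D] pd_vec_nth[OF D])
  have 1: "pd (Some a) (\<lambda>z. trans i j z $ Some d) z = pd a (\<lambda>y. transition A i j y $ d) (sp z)"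
    by (rule pd_slice[symmetric]) (simp add: trans_def, rule differentiable_vec_nth[OF D])
  show "jacobian (trans i j) (at z) $ Some d $ Some a = jacobian (transition A i j) (at (sp z)) $ d $ a"
    unfolding J 1 by (simp add: jacobian_pd[OF D'] pd_vec_nth[OF D'])
  have "pd None (\<lambda>z. trans i j z $ Some d) z = 0"
    by (rule pd_time[OF differentiable_vec_nth[OF D]]) (simp add: trans_def)
  then show "jacobian (trans i j) (at z) $ Some d $ None = 0" by (simp only: J)
  show "jacobian (trans i j) (at z) $ None $ Some a = 0" "jacobian (trans i j) (at z) $ None $ None = 1"
    unfolding J by (simp_all add: trans_def pd_coord)
qed

lemma prod_transition: "z \<in> overlap_st i j \<Longrightarrow> transition \<P> i j z = trans i j z"
proof -
  assume "z \<in> overlap_st i j"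
  then have "z \<in> \<Omega> i" using overlap_subset by (auto simp: overlap_st_def)
  then show ?thesis by (simp add: transition_def prod_inv prod_map trans_def)
qed

lemma jacobian_prod_transition:
  assumes z: "z \<in> overlap_st i j"
  shows "jacobian (transition \<P> i j) (at z) = jacobian (trans i j) (at z)"
  using frechet_derivative_transform_within_open[OF smooth_on_differentiable[OF smooth_trans z] open_overlap_st z, of "transition \<P> i j"]
  by (simp add: jacobian_def prod_transition)

text \<open>The scalar curvature occurs in the time component, so this rests on its invariance under a change of chart.\<close>

lemma ghat_transition:
  assumes z: "z \<in> overlap_st i j"
  shows "ghat g N i z = transpose (jacobian (trans i j) (at z)) ** ghat g N j (trans i j z) ** jacobian (trans i j) (at z)"
proof -
  let ?J = "jacobian (trans i j) (at z)" and ?j = "jacobian (transition A i j) (at (sp z))" and ?t = "z $ None"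
  have t: "?t \<in> I" and y: "sp z \<in> overlap i j" using z by (auto simp: overlap_st_def)
  have G: "g ?t i (sp z) = transpose ?j ** g ?t j (transition A i j (sp z)) ** ?j"
    using tensor2_transition[OF _ y] metric[OF t] by (auto simp: riemannian_metric_def)
  have R: "scalar_curv (g ?t i) (sp z) = scalar_curv (g ?t j) (transition A i j (sp z))"
    by (rule chart_change.scalar_curv_pullback[OF space_change[OF t] y])
  have tr: "trans i j z $ None = ?t" "sp (trans i j z) = transition A i j (sp z)" by (simp_all add: trans_def)
  have hat: "ghat g N k v $ \<alpha> $ \<beta> = (case (\<alpha>, \<beta>) of (Some p, Some q) \<Rightarrow> g (v $ None) k (sp v) $ p $ q / v $ None
        | (None, None) \<Rightarrow> real N / (2 * (v $ None)^3) + scalar_curv (g (v $ None) k) (sp v) / v $ None - real CARD('n) / (2 * (v $ None)^2)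
        | _ \<Rightarrow> 0)" for k v \<alpha> \<beta>
    unfolding ghat_def Let_def sp_def by simp
  have comp: "(transpose ?J ** ghat g N j (trans i j z) ** ?J) $ \<alpha> $ \<beta> = (\<Sum>\<nu>\<in>UNIV. (\<Sum>\<mu>\<in>UNIV. ?J $ \<mu> $ \<alpha> * ghat g N j (trans i j z) $ \<mu> $ \<nu>) * ?J $ \<nu> $ \<beta>)" for \<alpha> \<beta>
    by (simp add: matrix_matrix_mult_def transpose_def)
  have "ghat g N i z $ \<alpha> $ \<beta> = (transpose ?J ** ghat g N j (trans i j z) ** ?J) $ \<alpha> $ \<beta>" for \<alpha> \<beta>
    unfolding comp hat sum_option tr G R
    by (cases \<alpha>; cases \<beta>)
      (simp_all add: jacobian_trans[OF z] matrix_matrix_mult_def transpose_def sum_divide_distrib sum_distrib_right)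
  then show ?thesis by (simp add: vec_eq_iff)
qed

definition "positive_N = {N. pos_def_tensor \<P> (ghat g N)}"

lemma hat_chart: "hat_chart (chart_img A i) I (\<lambda>t. g t i) positive_N"
  unfolding hat_chart_def hat_chart_axioms_def
  using flow_chart by (auto simp: positive_N_def pos_def_tensor_def prod_img ghat_eq_hat flow_chart_\<Omega>)

text \<open>The tensor whose size is to be estimated, with the potential written in the time coordinate.\<close>

definition soliton where
  "soliton N i z = ricci (ghat g N i) z + hessian (ghat g N i) (\<lambda>z. real N / (2 * z $ None)) z - (1 / 2) *\<^sub>R ghat g N i z"

lemma ghat_metric: "N \<in> positive_N \<Longrightarrow> metric_chart (\<Omega> i) (ghat g N i)"
  using hat_chart.hat_metric[OF hat_chart] by (simp add: flow_chart_\<Omega> ghat_eq_hat)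

lemma trans_\<Omega>: "z \<in> overlap_st i j \<Longrightarrow> trans i j z \<in> \<Omega> j"
  using overlap_transition by (auto simp: overlap_st_def trans_def)

lemma soliton_transition:
  assumes N: "N \<in> positive_N" and z: "z \<in> overlap_st i j"
  defines "\<J> \<equiv> jacobian (trans i j) (at z)"
  shows "soliton N i z = transpose \<J> ** soliton N j (trans i j z) ** \<J>" "det \<J> \<noteq> 0"
proof -
  interpret chart_change "overlap_st i j" "\<Omega> j" "ghat g N i" "ghat g N j" "trans i j"
  proof -
    have "overlap_st i j \<subseteq> \<Omega> i" using overlap_subset by (auto simp: overlap_st_def)
    from metric_chart_subset[OF ghat_metric[OF N] open_overlap_st this]
    show "chart_change (overlap_st i j) (\<Omega> j) (ghat g N i) (ghat g N j) (trans i j)"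
      unfolding chart_change_def chart_change_axioms_def
      using ghat_metric[OF N] smooth_trans ghat_transition trans_\<Omega> by auto
  qed
  let ?f = "\<lambda>z::real^('n option). real N / (2 * z $ None)"
  have f: "smooth_on ?f (\<Omega> j)"
    by (intro smooth_intros open_\<Omega> smooth_on_bounded_linear bounded_linear_vec_nth) (use I_pos in fastforce)
  have h: "hessian (ghat g N i) ?f z = transpose (J z) ** hessian (ghat g N j) ?f (trans i j z) ** J z"
    by (rule hessian_pullback[OF z f]) (simp add: trans_def)
  have J: "J z = \<J>" unfolding \<J>_def by (rule J_eq[OF z, symmetric])
  show "det \<J> \<noteq> 0" using det_J[OF z] J by simp
  show "soliton N i z = transpose \<J> ** soliton N j (trans i j z) ** \<J>"
    unfolding soliton_def ricci_pullback[OF z] h J ghat_transition[OF z] \<J>_def[symmetric]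
    by (simp add: matrix_distrib matrix_mult_scaleR)
qed

abbreviation "soliton_norm h N i q \<equiv> tensor2_norm (h i (chart_map \<P> i q)) (real N *\<^sub>R soliton N i (chart_map \<P> i q))"

lemma soliton_eq:
  assumes "z \<in> \<Omega> i"
  shows "Ric (ghat g N) i z + Hess \<P> (ghat g N) (\<lambda>(x, \<tau>). real N / (2 * \<tau>)) i z - (1 / 2) *\<^sub>R ghat g N i z = soliton N i z"
proof -
  have "Hess \<P> (ghat g N) (\<lambda>(x, \<tau>). real N / (2 * \<tau>)) i z = hessian (ghat g N i) (\<lambda>z. real N / (2 * z $ None)) z"
    unfolding Hess_def by (rule hessian_cong[OF open_\<Omega> assms]) (simp add: prod_inv)
  then show ?thesis by (simp add: soliton_def Ric_def)
qed

lemma soliton_bounded_in_chart: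
  assumes B: "compact B" "B \<subseteq> \<Omega> j"
  shows "\<exists>D. \<forall>N\<in>positive_N. \<forall>z\<in>B. \<forall>\<alpha> \<beta>. \<bar>(real N *\<^sub>R soliton N j z) $ \<alpha> $ \<beta>\<bar> \<le> D"
proof -
  have "soliton N j z = hat_chart.T (\<lambda>t. g t j) N z" for N z
    by (simp add: soliton_def hat_chart.T_def[OF hat_chart] ghat_eq_hat)
  then have "\<exists>D. \<forall>N\<in>positive_N. \<forall>z\<in>B. \<bar>(real N *\<^sub>R soliton N j z) $ \<alpha> $ \<beta>\<bar> \<le> D" for \<alpha> \<beta>
    using hat_chart.scaled_T_bounded[OF hat_chart B(1), of j \<alpha> \<beta>] B(2) by (simp add: flow_chart_\<Omega>)
  then obtain D where D: "\<And>\<alpha> \<beta> N z. N \<in> positive_N \<Longrightarrow> z \<in> B \<Longrightarrow> \<bar>(real N *\<^sub>R soliton N j z) $ \<alpha> $ \<beta>\<bar> \<le> D \<alpha> \<beta>"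
    by metis
  have "\<bar>(real N *\<^sub>R soliton N j z) $ \<alpha> $ \<beta>\<bar> \<le> (\<Sum>\<alpha>\<in>UNIV. \<Sum>\<beta>\<in>UNIV. \<bar>D \<alpha> \<beta>\<bar>)" if "N \<in> positive_N" "z \<in> B" for N z \<alpha> \<beta>
  proof -
    have "\<bar>(real N *\<^sub>R soliton N j z) $ \<alpha> $ \<beta>\<bar> \<le> \<bar>D \<alpha> \<beta>\<bar>" using D[OF that, of \<alpha> \<beta>] by linarith
    also have "\<dots> \<le> (\<Sum>\<beta>\<in>UNIV. \<bar>D \<alpha> \<beta>\<bar>)" by (rule member_le_sum) auto
    also have "\<dots> \<le> (\<Sum>\<alpha>\<in>UNIV. \<Sum>\<beta>\<in>UNIV. \<bar>D \<alpha> \<beta>\<bar>)"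
      by (rule member_le_sum[of \<alpha> UNIV "\<lambda>\<alpha>. \<Sum>\<beta>\<in>UNIV. \<bar>D \<alpha> \<beta>\<bar>"]) (auto intro: sum_nonneg)
    finally show ?thesis .
  qed
  then show ?thesis by blast
qed

lemma metric_inv_bounded:
  assumes h: "riemannian_metric \<P> h" and B: "compact B" "B \<subseteq> \<Omega> j"
  shows "\<exists>E. \<forall>z\<in>B. \<forall>\<alpha> \<beta>. \<bar>matrix_inv (h j z) $ \<alpha> $ \<beta>\<bar> \<le> E"
proof -
  have "smooth_on (\<lambda>z. matrix_inv (h j z)) (\<Omega> j)"
  proof (rule smooth_on_matrix_inv[OF open_\<Omega>])
    show "smooth_on (h j) (\<Omega> j)" using h by (auto simp: riemannian_metric_def prod_img)
    show "det (h j z) \<noteq> 0" if "z \<in> \<Omega> j" for z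
      using h that by (intro pos_def_det) (auto simp: riemannian_metric_def pos_def_tensor_def prod_img)
  qed
  then have "compact ((\<lambda>z. matrix_inv (h j z)) ` B)"
    using B by (intro compact_continuous_image continuous_on_subset[OF smooth_on_continuous])
  then obtain E where E: "\<And>z. z \<in> B \<Longrightarrow> norm (matrix_inv (h j z)) \<le> E"
    using compact_imp_bounded bounded_iff by (metis imageI)
  have "\<bar>X $ \<alpha> $ \<beta>\<bar> \<le> norm X" for X :: "real^('n option)^('n option)" and \<alpha> \<beta>
    using order_trans[OF component_le_norm_cart Finite_Cartesian_Product.norm_nth_le] by blast
  then show ?thesis using E order_trans by blast
qed

text \<open>Component bounds are available in one chart \<open>j\<close> around \<open>p\<close>, whereas the point may lie in infinitely many
  charts. The bound holds in all of them because both \<open>h\<close> and the tensor obey the transformation law, so the norm is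
  the same in each chart.\<close>

lemma soliton_locally_bounded:
  assumes h: "riemannian_metric \<P> h" and p: "p \<in> M \<times> I"
  shows "\<exists>W C. openin (top_of_set (M \<times> I)) W \<and> p \<in> W \<and> (\<forall>N\<in>positive_N. \<forall>q\<in>W. \<forall>i. q \<in> chart_dom \<P> i \<longrightarrow>
     soliton_norm h N i q \<le> C)"
proof -
  obtain j where j: "fst p \<in> chart_dom A j" using p manifold unfolding smooth_manifold_def by auto
  let ?z = "\<lambda>q. chart_map \<P> j q"
  have zp: "?z p \<in> \<Omega> j" using j p by (cases p) (auto simp: prod_map chart_img_def)
  have "\<exists>r>0. cball (?z p) r \<subseteq> \<Omega> j"
    by (rule open_contains_cball[THEN iffD1, OF open_\<Omega>, THEN bspec, OF zp])
  then obtain r where r: "r > 0" "cball (?z p) r \<subseteq> \<Omega> j" by blast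
  define W where "W = (chart_dom A j \<times> I) \<inter> ?z -` ball (?z p) r"
  have "continuous_on (chart_dom A j \<times> I) ?z"
  proof -
    have "continuous_on (chart_dom A j \<times> I) (\<lambda>q. (chart_map A j (fst q), snd q))"
      using homeomorphism_cont1[OF chart_homeo[of j]]
      by (intro continuous_on_Pair continuous_on_compose2[of "chart_dom A j" "chart_map A j" _ fst] continuous_intros) auto
    from continuous_on_compose2[OF linear_continuous_on[OF bounded_linear_join, of UNIV] this]
    have "continuous_on (chart_dom A j \<times> I) (\<lambda>q. join (chart_map A j (fst q)) (snd q))" by simp
    moreover have "?z = (\<lambda>q. join (chart_map A j (fst q)) (snd q))" by (auto simp: fun_eq_iff prod_map)
    ultimately show ?thesis by simp
  qed
  then have "openin (top_of_set (chart_dom A j \<times> I)) W"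
    unfolding W_def by (rule continuous_openin_preimage_gen) simp
  moreover have "openin (top_of_set (M \<times> I)) (chart_dom A j \<times> I)"
    by (rule openin_Times[OF chart_dom_openin]) simp
  ultimately have W: "openin (top_of_set (M \<times> I)) W" by (rule openin_trans)
  have pW: "p \<in> W" using j p r by (cases p) (auto simp: W_def)
  obtain D where D: "\<And>N z \<alpha> \<beta>. N \<in> positive_N \<Longrightarrow> z \<in> cball (?z p) r \<Longrightarrow> \<bar>(real N *\<^sub>R soliton N j z) $ \<alpha> $ \<beta>\<bar> \<le> D"
    using soliton_bounded_in_chart[OF compact_cball r(2)] by blast
  obtain E where E: "\<And>z \<alpha> \<beta>. z \<in> cball (?z p) r \<Longrightarrow> \<bar>matrix_inv (h j z) $ \<alpha> $ \<beta>\<bar> \<le> E"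
    using metric_inv_bounded[OF h compact_cball r(2)] by blast
  let ?C = "sqrt (\<Sum>k\<in>(UNIV::'n option set). \<Sum>l\<in>(UNIV::'n option set). \<Sum>p\<in>(UNIV::'n option set). \<Sum>q\<in>(UNIV::'n option set). E * E * D * D)"
  have "soliton_norm h N i q \<le> ?C"
    if N: "N \<in> positive_N" and q: "q \<in> W" "q \<in> chart_dom \<P> i" for N q i
  proof -
    obtain x t where xt: "q = (x, t)" by (cases q)
    have x: "x \<in> chart_dom A i" "x \<in> chart_dom A j" "t \<in> I" using q by (auto simp: xt W_def prod_dom)
    let ?v = "chart_map \<P> i q" and ?w = "chart_map \<P> j q"
    have v: "?v \<in> overlap_st i j" using x by (auto simp: xt prod_map overlap_st_def overlap_def)
    have tr: "trans i j ?v = ?w" by (simp add: xt prod_map trans_def transition_def chart_inv_map x)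
    let ?J = "jacobian (trans i j) (at ?v)"
    have w: "?w \<in> cball (?z p) r" using q(1) by (auto simp: W_def)
    have dh: "det (h j ?w) \<noteq> 0"
      using h w r(2) by (intro pos_def_det) (auto simp: riemannian_metric_def pos_def_tensor_def prod_img)
    have "q \<in> chart_dom \<P> i \<inter> chart_dom \<P> j" using x by (simp add: xt prod_dom)
    then have hh: "h i ?v = transpose ?J ** h j ?w ** ?J"
      using h unfolding riemannian_metric_def is_tensor2_def Let_def
      by (simp add: jacobian_prod_transition[OF v, symmetric])
    have "real N *\<^sub>R soliton N i ?v = transpose ?J ** (real N *\<^sub>R soliton N j ?w) ** ?J"
      by (simp add: soliton_transition(1)[OF N v] tr matrix_mult_scaleR)
    then have "tensor2_norm (h i ?v) (real N *\<^sub>R soliton N i ?v) = tensor2_norm (h j ?w) (real N *\<^sub>R soliton N j ?w)"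
      by (simp add: hh tensor2_norm_congruence[OF soliton_transition(2)[OF N v] dh])
    also have "\<dots> \<le> ?C"
      by (rule tensor2_norm_le) (use D[OF N w] E[OF w] in auto)
    finally show ?thesis .
  qed
  then show ?thesis using W pW by blast
qed

lemma soliton_bounded_on_compact:
  assumes h: "riemannian_metric \<P> h" and K: "compact K" "K \<subseteq> M \<times> I"
  shows "\<exists>C. \<forall>N\<in>positive_N. \<forall>q\<in>K. \<forall>i. q \<in> chart_dom \<P> i \<longrightarrow>
     soliton_norm h N i q \<le> C"
proof -
  let ?P = "\<lambda>q C. \<forall>N\<in>positive_N. \<forall>i. q \<in> chart_dom \<P> i \<longrightarrow>
     soliton_norm h N i q \<le> C"
  have "\<exists>W C. openin (top_of_set (M \<times> I)) W \<and> p \<in> W \<and> (\<forall>q\<in>W. ?P q C)" if "p \<in> K" for p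
    using soliton_locally_bounded[OF h, of p] K(2) that by blast
  then obtain W C where WC: "\<And>p. p \<in> K \<Longrightarrow> openin (top_of_set (M \<times> I)) (W p)" "\<And>p. p \<in> K \<Longrightarrow> p \<in> W p" "\<And>p q. p \<in> K \<Longrightarrow> q \<in> W p \<Longrightarrow> ?P q (C p)"
    by metis
  have "\<exists>T. open T \<and> W p = (M \<times> I) \<inter> T" if "p \<in> K" for p
    using WC(1)[OF that] by (simp add: openin_open)
  then obtain T where T: "\<And>p. p \<in> K \<Longrightarrow> open (T p)" "\<And>p. p \<in> K \<Longrightarrow> W p = (M \<times> I) \<inter> T p" by metis
  have "K \<subseteq> (\<Union>p\<in>K. T p)" using WC(2) T(2) by blast
  with compactE_image[OF K(1), of K T] T(1) obtain F where F: "F \<subseteq> K" "finite F" "K \<subseteq> (\<Union>p\<in>F. T p)" by metis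
  show ?thesis
  proof (intro exI ballI allI impI)
    fix N q i assume N: "N \<in> positive_N" and q: "q \<in> K" and i: "q \<in> chart_dom \<P> i"
    obtain p where p: "p \<in> F" "q \<in> T p" using F(3) q by blast
    then have "q \<in> W p" using T(2) F(1) K(2) q by blast
    then have "soliton_norm h N i q \<le> C p"
      using WC(3) p F(1) N i by blast
    also have "\<dots> \<le> \<bar>C p\<bar>" by simp
    also have "\<dots> \<le> (\<Sum>p\<in>F. \<bar>C p\<bar>)" by (rule member_le_sum[OF p(1)]) (auto simp: F(2))
    finally show "soliton_norm h N i q \<le> (\<Sum>p\<in>F. \<bar>C p\<bar>)" .
  qed
qed

end

theorem theorem1p1:
  fixes M :: "'m::{t2_space,second_countable_topology} set"
    and A :: "('i, 'm, 'n::finite) atlas"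
    and a b :: ereal
    and g :: "real \<Rightarrow> ('i, 'n) tensor2"
    and h :: "('i, 'n option) tensor2"
    and K :: "('m \<times> real) set"
  assumes "smooth_manifold M A"
    and "0 \<le> a" and "a < b"
    and "reverse_ricci_flow A (einterval a b) g"
    and "bounded_curvature A (einterval a b) g"
    and "riemannian_metric (prod_atlas A (einterval a b)) h"
    and "compact K" and "K \<subseteq> M \<times> einterval a b"
  shows "\<exists>C. \<forall>N. pos_def_tensor (prod_atlas A (einterval a b)) (ghat g N) \<longrightarrow>
    (\<forall>p\<in>K. \<forall>i. p \<in> chart_dom (prod_atlas A (einterval a b)) i \<longrightarrow>
      (let z = chart_map (prod_atlas A (einterval a b)) i p
       in tensor2_norm (h i z)
            (real N *\<^sub>R (Ric (ghat g N) i z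
               + Hess (prod_atlas A (einterval a b)) (ghat g N) (\<lambda>(x, \<tau>). real N / (2 * \<tau>)) i z
               - (1 / 2) *\<^sub>R ghat g N i z)) \<le> C))"
proof -
  let ?I = "einterval a b"
  have "t > 0" if "t \<in> ?I" for t
  proof -
    have "0 < ereal t" using that by (intro le_less_trans[OF assms(2)]) (simp add: einterval_iff)
    then show ?thesis by simp
  qed
  then interpret flow_on_manifold M A ?I g
    using assms(1,4) by unfold_locales auto
  obtain C where C: "\<And>N p i. N \<in> positive_N \<Longrightarrow> p \<in> K \<Longrightarrow> p \<in> chart_dom (prod_atlas A ?I) i \<Longrightarrow>
     soliton_norm h N i p \<le> C"
    using soliton_bounded_on_compact[OF assms(6,7,8)] by metis
  show ?thesis
    unfolding Let_def
  proof (intro exI allI impI ballI)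
    fix N p i
    assume N: "pos_def_tensor (prod_atlas A ?I) (ghat g N)" and p: "p \<in> K" "p \<in> chart_dom (prod_atlas A ?I) i"
    have "chart_map (prod_atlas A ?I) i p \<in> \<Omega> i"
      using imageI[OF p(2), of "chart_map (prod_atlas A ?I) i"] prod_img[of i] by (simp only: chart_img_def[of "prod_atlas A ?I"])
    from soliton_eq[OF this] C[OF _ p, of N] N
    show "tensor2_norm (h i (chart_map (prod_atlas A ?I) i p))
            (real N *\<^sub>R (Ric (ghat g N) i (chart_map (prod_atlas A ?I) i p)
               + Hess (prod_atlas A ?I) (ghat g N) (\<lambda>(x, \<tau>). real N / (2 * \<tau>)) i (chart_map (prod_atlas A ?I) i p)
               - (1 / 2) *\<^sub>R ghat g N i (chart_map (prod_atlas A ?I) i p))) \<le> C"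
      by (simp add: positive_N_def)
  qed
qed

end
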